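(* Let $p$ be an odd prime, $S$ a finite $p$-group and $\mathcal{F}$ a saturated fusion system on $S$. Let $E$ be an $\mathcal{F}$-essential subgroup of $S$ such that $E$ has rank $2$, $\Phi(E)$ has rank at most $3$, and $E$ is not $\mathcal{F}$-characteristic in $S$. Then $E$ is an $\mathcal{F}$-pearl.
   Context: Rank: minimal size of a generating set. For $P\le S$, $\mathrm{Aut}_{\mathcal{F}}(P)=\mathrm{Hom}_{\mathcal{F}}(P,P)$, $\mathrm{Out}_{\mathcal{F}}(P)=\mathrm{Aut}_{\mathcal{F}}(P)/\mathrm{Inn}(P)$, $P^{\mathcal{F}}=\{P\alpha:\alpha\in\mathrm{Hom}_{\mathcal{F}}(P,S)\}$. $E\le S$ is $\mathcal{F}$-essential if $C_S(P)\le P$ and $|N_S(E)|\ge|N_S(P)|$ for all $P\in E^{\mathcal{F}}$, and $\mathrm{Out}_{\mathcal{F}}(E)$ has a strongly $p$-embedded subgroup. $E$ is $\mathcal{F}$-characteristic in $S$ if $E$ is normalized by $\mathrm{Aut}_{\mathcal{F}}(S)$. An $\mathcal{F}$-pearl is an $\mathcal{F}$-essential subgroup that is either elementary abelian of order $p^2$ or non-abelian of order $p^3$. *)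

theory Defs
  imports "HOL-Algebra.Algebra" "HOL-Library.FuncSet"
begin

text \<open>Conventions: S is a finite group (HOL-Algebra record); subgroups of S are sets.
  Morphisms are functions written on the left, extensional (undefined outside the domain).
  The conjugation map c_g : x \<mapsto> g^-1 x g (right action, as in the paper).
  A fusion system is given by F :: 'a set => 'a set => ('a => 'a) set, F P Q = Hom_F(P,Q).\<close>

definition conjmap :: "('a,'b) monoid_scheme \<Rightarrow> 'a \<Rightarrow> 'a \<Rightarrow> 'a" where
  "conjmap S g = (\<lambda>x. inv\<^bsub>S\<^esub> g \<otimes>\<^bsub>S\<^esub> x \<otimes>\<^bsub>S\<^esub> g)"

definition p_group :: "nat \<Rightarrow> ('a,'b) monoid_scheme \<Rightarrow> bool" where
  "p_group p S \<longleftrightarrow> group S \<and> finite (carrier S) \<and> (\<exists>n. card (carrier S) = p ^ n)"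

definition normS :: "('a,'b) monoid_scheme \<Rightarrow> 'a set \<Rightarrow> 'a set" where
  "normS S P = {g \<in> carrier S. conjmap S g ` P = P}"

definition centS :: "('a,'b) monoid_scheme \<Rightarrow> 'a set \<Rightarrow> 'a set" where
  "centS S P = {g \<in> carrier S. \<forall>x\<in>P. g \<otimes>\<^bsub>S\<^esub> x = x \<otimes>\<^bsub>S\<^esub> g}"

definition HomS :: "('a,'b) monoid_scheme \<Rightarrow> 'a set \<Rightarrow> 'a set \<Rightarrow> ('a \<Rightarrow> 'a) set" where
  "HomS S P Q = {restrict (conjmap S g) P | g. g \<in> carrier S \<and> conjmap S g ` P \<subseteq> Q}"

definition InnS :: "('a,'b) monoid_scheme \<Rightarrow> 'a set \<Rightarrow> ('a \<Rightarrow> 'a) set" where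
  "InnS S P = {restrict (conjmap S g) P | g. g \<in> P}"

definition injhom :: "('a,'b) monoid_scheme \<Rightarrow> 'a set \<Rightarrow> 'a set \<Rightarrow> ('a \<Rightarrow> 'a) set" where
  "injhom S P Q = {\<phi>. \<phi> \<in> P \<rightarrow>\<^sub>E Q \<and> inj_on \<phi> P \<and>
       (\<forall>x\<in>P. \<forall>y\<in>P. \<phi> (x \<otimes>\<^bsub>S\<^esub> y) = \<phi> x \<otimes>\<^bsub>S\<^esub> \<phi> y)}"

definition fusion_system :: "('a,'b) monoid_scheme \<Rightarrow> ('a set \<Rightarrow> 'a set \<Rightarrow> ('a \<Rightarrow> 'a) set) \<Rightarrow> bool" where
  "fusion_system S F \<longleftrightarrow>
     (\<forall>P Q. \<not> (subgroup P S \<and> subgroup Q S) \<longrightarrow> F P Q = {}) \<and>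
     (\<forall>P Q. subgroup P S \<and> subgroup Q S \<longrightarrow> HomS S P Q \<subseteq> F P Q \<and> F P Q \<subseteq> injhom S P Q) \<and>
     (\<forall>P Q R \<phi> \<psi>. \<phi> \<in> F P Q \<and> \<psi> \<in> F Q R \<longrightarrow> restrict (\<psi> \<circ> \<phi>) P \<in> F P R) \<and>
     (\<forall>P Q R \<phi>. \<phi> \<in> F P Q \<and> subgroup R S \<and> \<phi> ` P \<subseteq> R \<longrightarrow> \<phi> \<in> F P R) \<and>
     (\<forall>P Q \<phi>. \<phi> \<in> F P Q \<longrightarrow> restrict (inv_into P \<phi>) (\<phi> ` P) \<in> F (\<phi> ` P) P)"

text \<open>Aut_F(P) as a group, with the product \<phi>\<psi> = "first \<phi>, then \<psi>" (right actions).\<close>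
definition AutGrp :: "('a set \<Rightarrow> 'a set \<Rightarrow> ('a \<Rightarrow> 'a) set) \<Rightarrow> 'a set \<Rightarrow> ('a \<Rightarrow> 'a) monoid" where
  "AutGrp F P = \<lparr>carrier = F P P, monoid.mult = (\<lambda>\<phi> \<psi>. restrict (\<psi> \<circ> \<phi>) P), one = restrict id P\<rparr>"

definition OutGrp :: "('a,'b) monoid_scheme \<Rightarrow> ('a set \<Rightarrow> 'a set \<Rightarrow> ('a \<Rightarrow> 'a) set) \<Rightarrow> 'a set
     \<Rightarrow> ('a \<Rightarrow> 'a) set monoid" where
  "OutGrp S F P = AutGrp F P Mod InnS S P"

definition sylow_subgroup :: "('c,'d) monoid_scheme \<Rightarrow> nat \<Rightarrow> 'c set \<Rightarrow> bool" where
  "sylow_subgroup G p H \<longleftrightarrow> subgroup H G \<and> (\<exists>n. card H = p ^ n) \<and>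
      \<not> p dvd (card (carrier G) div card H)"

definition strongly_p_embedded :: "('c,'d) monoid_scheme \<Rightarrow> nat \<Rightarrow> 'c set \<Rightarrow> bool" where
  "strongly_p_embedded G p H \<longleftrightarrow> subgroup H G \<and> H \<noteq> carrier G \<and> p dvd card H \<and>
      (\<forall>g \<in> carrier G - H. \<not> p dvd card (H \<inter> ((inv\<^bsub>G\<^esub> g) <#\<^bsub>G\<^esub> H #>\<^bsub>G\<^esub> g)))"

definition Fclass :: "('a set \<Rightarrow> 'a set \<Rightarrow> ('a \<Rightarrow> 'a) set) \<Rightarrow> ('a,'b) monoid_scheme \<Rightarrow> 'a set \<Rightarrow> 'a set set" where
  "Fclass F S P = {\<phi> ` P | \<phi>. \<phi> \<in> F P (carrier S)}"

definition fully_automized :: "nat \<Rightarrow> ('a,'b) monoid_scheme \<Rightarrow> ('a set \<Rightarrow> 'a set \<Rightarrow> ('a \<Rightarrow> 'a) set) \<Rightarrow> 'a set \<Rightarrow> bool" where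
  "fully_automized p S F P \<longleftrightarrow> sylow_subgroup (AutGrp F P) p (HomS S P P)"

definition receptive :: "('a,'b) monoid_scheme \<Rightarrow> ('a set \<Rightarrow> 'a set \<Rightarrow> ('a \<Rightarrow> 'a) set) \<Rightarrow> 'a set \<Rightarrow> bool" where
  "receptive S F P \<longleftrightarrow>
     (\<forall>Q \<phi>. \<phi> \<in> F Q P \<and> \<phi> ` Q = P \<longrightarrow>
        (let N = {g \<in> normS S Q. restrict (\<phi> \<circ> conjmap S g \<circ> inv_into Q \<phi>) P \<in> HomS S P P}
         in \<exists>\<psi> \<in> F N (carrier S). restrict \<psi> Q = \<phi>))"

text \<open>Saturation (Roberts--Shpectorov / Aschbacher--Kessar--Oliver form).\<close>
definition saturated_fusion_system :: "nat \<Rightarrow> ('a,'b) monoid_scheme \<Rightarrow> ('a set \<Rightarrow> 'a set \<Rightarrow> ('a \<Rightarrow> 'a) set) \<Rightarrow> bool" where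
  "saturated_fusion_system p S F \<longleftrightarrow> fusion_system S F \<and>
     (\<forall>P. subgroup P S \<longrightarrow> (\<exists>Q \<in> Fclass F S P. fully_automized p S F Q \<and> receptive S F Q))"

definition essential :: "nat \<Rightarrow> ('a,'b) monoid_scheme \<Rightarrow> ('a set \<Rightarrow> 'a set \<Rightarrow> ('a \<Rightarrow> 'a) set) \<Rightarrow> 'a set \<Rightarrow> bool" where
  "essential p S F E \<longleftrightarrow> subgroup E S \<and>
     (\<forall>P \<in> Fclass F S E. centS S P \<subseteq> P \<and> card (normS S E) \<ge> card (normS S P)) \<and>
     (\<exists>H. strongly_p_embedded (OutGrp S F E) p H)"

definition F_characteristic :: "('a,'b) monoid_scheme \<Rightarrow> ('a set \<Rightarrow> 'a set \<Rightarrow> ('a \<Rightarrow> 'a) set) \<Rightarrow> 'a set \<Rightarrow> bool" where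
  "F_characteristic S F E \<longleftrightarrow> (\<forall>\<alpha> \<in> F (carrier S) (carrier S). \<alpha> ` E = E)"

definition grank :: "('a,'b) monoid_scheme \<Rightarrow> 'a set \<Rightarrow> nat" where
  "grank S P = (LEAST n. \<exists>A. A \<subseteq> P \<and> finite A \<and> card A = n \<and> generate S A = P)"

definition maximal_subgroup :: "('a,'b) monoid_scheme \<Rightarrow> 'a set \<Rightarrow> 'a set \<Rightarrow> bool" where
  "maximal_subgroup S P M \<longleftrightarrow> subgroup M S \<and> M \<subset> P \<and>
     (\<forall>K. subgroup K S \<and> M \<subseteq> K \<and> K \<subseteq> P \<longrightarrow> K = M \<or> K = P)"

text \<open>Frattini subgroup of P: intersection of its maximal subgroups (P if there are none).\<close>
definition frattini :: "('a,'b) monoid_scheme \<Rightarrow> 'a set \<Rightarrow> 'a set" where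
  "frattini S P = P \<inter> \<Inter> {M. maximal_subgroup S P M}"

definition pearl :: "nat \<Rightarrow> ('a,'b) monoid_scheme \<Rightarrow> ('a set \<Rightarrow> 'a set \<Rightarrow> ('a \<Rightarrow> 'a) set) \<Rightarrow> 'a set \<Rightarrow> bool" where
  "pearl p S F E \<longleftrightarrow> essential p S F E \<and>
     ((card E = p ^ 2 \<and> (\<forall>x\<in>E. \<forall>y\<in>E. x \<otimes>\<^bsub>S\<^esub> y = y \<otimes>\<^bsub>S\<^esub> x) \<and> (\<forall>x\<in>E. x [^]\<^bsub>S\<^esub> p = \<one>\<^bsub>S\<^esub>))
      \<or> (card E = p ^ 3 \<and> \<not> (\<forall>x\<in>E. \<forall>y\<in>E. x \<otimes>\<^bsub>S\<^esub> y = y \<otimes>\<^bsub>S\<^esub> x)))"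

end

theory Submission
  imports Defs
begin

text \<open>
  Let \<open>T = N_S(E)\<close>, \<open>Q = \<Phi>(E)\<close>, \<open>A = Aut_F(E)\<close>. A strongly p-embedded subgroup of \<open>Out_F(E)\<close> excludes
  nontrivial normal p-subgroups, and automorphisms stabilising a chain \<open>Q \<le> B \<le> E\<close> form a p-group;
  hence \<open>|T : E| = p\<close>, \<open>T\<close> acts nontrivially on \<open>E/Q\<close> and \<open>A\<close> acts irreducibly on it. As \<open>E\<close> is not
  F-characteristic, some \<open>\<alpha> \<in> Aut(T)\<close> moves \<open>E\<close>, so \<open>T = E E\<alpha>\<close>.

  First \<open>Q\<alpha> = Q\<close>: otherwise some \<open>f \<in> E\<alpha>\<close> has \<open>f^p \<notin> Q\<close>. The p-power map embeds \<open>E/Q\<close> into the abelian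
  group \<open>E/[E,E]Q^p\<close>, on which \<open>f\<close> acts with order p because \<open>f^p \<in> E\<close>; expanding
  \<open>e^(f^p) = e [e,f]^p [e,f,f]^(p choose 2)\<close> for odd p shows that \<open>f\<close> centralises \<open>E/Q\<close>.

  Next \<open>T\<close> centralises \<open>Q/\<Phi>(Q)\<close>, which has order at most \<open>p^3\<close>: otherwise \<open>E\<close> acts on it with kernel \<open>Q\<close>,
  while comparing the fixed points of \<open>E\<close> and \<open>E\<alpha>\<close> yields a subgroup \<open>B\<close> such that \<open>T\<close> centralises
  \<open>Q/B\<close> and \<open>B/\<Phi>(Q)\<close>, so that \<open>[T,T]\<close> acts trivially. It follows that \<open>E^p \<le> \<Phi>(Q)\<close>, so \<open>Q\<close> is cyclic,
  generated by a commutator \<open>[a,b]\<close> of generators of \<open>E\<close>. Finally \<open>E\<close> centralises \<open>Q/Q^(p^2)\<close>, whence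
  \<open>[a,b]^p = [a^p,b] \<in> Q^(p^2)\<close> and \<open>|Q| \<le> p\<close>.
\<close>

text \<open>The group-theoretic core knows no fusion system. The locale
  \<open>irreducible_pair\<close> keeps a p-group, a normal subgroup \<open>E\<close> of index p, a
  family of automorphisms of \<open>E\<close> acting irreducibly on \<open>E/Q\<close>, and an
  automorphism \<open>\<alpha>\<close> of the whole group that moves \<open>E\<close>. The two kinds
  of automorphisms do not interact: irreducibility speaks of subgroups of \<open>E\<close> only, and
  \<open>\<alpha>\<close> need not preserve what it yields. Hence a recurring pattern: a kernel or
  centralizer is invariant and so equals \<open>Q\<close> or \<open>E\<close>; the outcome is
  carried by \<open>\<alpha>\<close> from \<open>E\<close> to its image; and since \<open>E\<close>
  and its image generate the group, it holds for the whole group. Such a transport needs sections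
  fixed by \<open>\<alpha>\<close>, which is why the invariance of \<open>Q\<close> under
  \<open>\<alpha>\<close> comes before any study of the action on \<open>Q\<close>. The bound 3 on
  the rank of \<open>Q\<close> is spent on a dichotomy: in a section of order at most p^3 the fixed
  points of \<open>E\<close> have index at most p or order at most p.\<close>

subsection \<open>Finite group actions\<close>

text \<open>Conjugation and multiplication of right cosets are right actions, whereas
  \<open>group_action\<close> asks for a homomorphism into \<open>BijGroup\<close>, which is a left
  action. Inverting the group element turns one into the other.\<close>

lemma right_action_imp_group_action:
  assumes "group H"
    and closed: "\<And>g w. g \<in> carrier H \<Longrightarrow> w \<in> \<Omega> \<Longrightarrow> act g w \<in> \<Omega>"
    and one: "\<And>w. w \<in> \<Omega> \<Longrightarrow> act \<one>\<^bsub>H\<^esub> w = w"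
    and mult: "\<And>g h w. g \<in> carrier H \<Longrightarrow> h \<in> carrier H \<Longrightarrow> w \<in> \<Omega> \<Longrightarrow>
      act (g \<otimes>\<^bsub>H\<^esub> h) w = act h (act g w)"
  shows "group_action H \<Omega> (\<lambda>g. restrict (act (inv\<^bsub>H\<^esub> g)) \<Omega>)"
proof -
  interpret H: group H by fact
  have bij: "bij_betw (act g) \<Omega> \<Omega>" if "g \<in> carrier H" for g
    by (rule bij_betw_byWitness[where f' = "act (inv\<^bsub>H\<^esub> g)"])
      (use that closed in \<open>auto simp: mult[symmetric] one\<close>)
  show ?thesis
    unfolding group_action_def group_hom_def group_hom_axioms_def
  proof (intro conjI homI)
    fix g h assume "g \<in> carrier H" "h \<in> carrier H"
    then show "restrict (act (inv\<^bsub>H\<^esub> (g \<otimes>\<^bsub>H\<^esub> h))) \<Omega> =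
      restrict (act (inv\<^bsub>H\<^esub> g)) \<Omega> \<otimes>\<^bsub>BijGroup \<Omega>\<^esub> restrict (act (inv\<^bsub>H\<^esub> h)) \<Omega>"
      using bij[of "inv\<^bsub>H\<^esub> g"] bij[of "inv\<^bsub>H\<^esub> h"] closed
      by (auto simp: BijGroup_def Bij_def compose_def H.inv_mult_group mult fun_eq_iff
          cong: bij_betw_cong)
  qed (use bij group_BijGroup[of \<Omega>] in \<open>auto simp: BijGroup_def Bij_def cong: bij_betw_cong\<close>)
qed

lemma orbit_right_action:
  assumes "group H" "w \<in> \<Omega>"
  shows "orbit H (\<lambda>g. restrict (act (inv\<^bsub>H\<^esub> g)) \<Omega>) w = (\<lambda>g. act g w) ` carrier H"
proof -
  interpret H: group H by fact
  show ?thesis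
  proof
    show "orbit H (\<lambda>g. restrict (act (inv\<^bsub>H\<^esub> g)) \<Omega>) w \<subseteq> (\<lambda>g. act g w) ` carrier H"
      unfolding orbit_def using assms(2) by auto
    show "(\<lambda>g. act g w) ` carrier H \<subseteq> orbit H (\<lambda>g. restrict (act (inv\<^bsub>H\<^esub> g)) \<Omega>) w"
    proof clarify
      fix g assume "g \<in> carrier H"
      then show "act g w \<in> orbit H (\<lambda>g. restrict (act (inv\<^bsub>H\<^esub> g)) \<Omega>) w"
        unfolding orbit_def using assms(2) by (intro CollectI exI[of _ "inv\<^bsub>H\<^esub> g"]) simp
    qed
  qed
qed

text \<open>Orbit lengths divide p^n, so an orbit of length prime to p is a single fixed point, and
  all other orbits together contribute a multiple of p.\<close>

lemma p_dvd_card_fixed_points: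
  assumes "group H" "card (carrier H) = p ^ n" "Factorial_Ring.prime p" "finite \<Omega>"
    and closed: "\<And>g w. g \<in> carrier H \<Longrightarrow> w \<in> \<Omega> \<Longrightarrow> act g w \<in> \<Omega>"
    and one: "\<And>w. w \<in> \<Omega> \<Longrightarrow> act \<one>\<^bsub>H\<^esub> w = w"
    and mult: "\<And>g h w. g \<in> carrier H \<Longrightarrow> h \<in> carrier H \<Longrightarrow> w \<in> \<Omega> \<Longrightarrow>
      act (g \<otimes>\<^bsub>H\<^esub> h) w = act h (act g w)"
    and "p dvd card \<Omega>"
  shows "p dvd card {w \<in> \<Omega>. \<forall>g\<in>carrier H. act g w = w}"
proof -
  let ?\<phi> = "\<lambda>g. restrict (act (inv\<^bsub>H\<^esub> g)) \<Omega>"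
  let ?Fix = "{w \<in> \<Omega>. \<forall>g\<in>carrier H. act g w = w}"
  interpret group_action H \<Omega> ?\<phi>
    by (rule right_action_imp_group_action) (use assms in auto)
  interpret H: group H by fact
  let ?O = "orbits H \<Omega> ?\<phi>"
  have disj: "pairwise disjnt ?O"
    using disjoint_union unfolding pairwise_def disjnt_def by blast
  have fin: "finite B" if "B \<in> ?O" for B
    using finite_subset[OF Sup_upper[OF that]] assms(4) unfolding orbits_coverture .
  have finO: "finite ?O"
    using assms(4) by (simp add: orbits_def)
  have cov: "\<Union> ?O = \<Omega>" by (rule orbits_coverture)
  have single: "\<exists>w\<in>?Fix. B = {w}" if B: "B \<in> ?O" and np: "\<not> p dvd card B" for B
  proof -
    obtain w where w: "w \<in> \<Omega>" "B = orbit H ?\<phi> w"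
      using B by (auto simp: orbits_def)
    then have "card B dvd p ^ n"
      using orbit_stabilizer_theorem[OF w(1)] assms(2) by (metis dvd_triv_left order_def)
    then obtain k where k: "card B = p ^ k"
      using assms(3) divides_primepow_nat by blast
    then have "k = 0" using np by (cases k) auto
    then have "card B = 1" using k by simp
    moreover have B': "B = (\<lambda>g. act g w) ` carrier H"
      using w orbit_right_action[OF assms(1) w(1)] by simp
    moreover have "w \<in> B"
      unfolding B' using one[OF w(1)] H.one_closed by force
    ultimately have Bw: "B = {w}"
      using card_1_singletonE[of B] by (metis singletonD)
    have "act g w = w" if "g \<in> carrier H" for g
    proof -
      have "act g w \<in> B" unfolding B' using that by (rule imageI)
      then show ?thesis unfolding Bw by simp
    qed
    then show ?thesis using w(1) Bw by blast
  qed
  let ?A = "{B \<in> ?O. p dvd card B}" and ?B = "{B \<in> ?O. \<not> p dvd card B}"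
  have Fix: "\<Union> ?B = ?Fix"
  proof
    show "\<Union> ?B \<subseteq> ?Fix" using single by blast
    show "?Fix \<subseteq> \<Union> ?B"
    proof
      fix w assume w: "w \<in> ?Fix"
      have "orbit H ?\<phi> w = {w}"
        using w orbit_right_action[OF assms(1), of w \<Omega> act] H.one_closed by auto
      then have "{w} \<in> ?O" using w unfolding orbits_def by blast
      moreover have "\<not> p dvd card {w}"
        using assms(3) by (simp add: prime_nat_iff)
      ultimately show "w \<in> \<Union> ?B" by blast
    qed
  qed
  have "card (\<Union> ?B) + card (\<Union> ?A) = card \<Omega>"
  proof -
    have un: "\<Union> ?B \<union> \<Union> ?A = \<Omega>"
      by (rule trans[OF _ cov]) blast
    have "\<Union> ?B \<inter> \<Union> ?A = {}" using disjoint_union by blast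
    moreover have "finite (\<Union> ?B)" "finite (\<Union> ?A)" 
      by (rule finite_subset[OF _ assms(4)], use un in blast)+
    ultimately show ?thesis
      using card_Un_disjoint[of "\<Union> ?B" "\<Union> ?A"] un by (simp only:)
  qed
  then have "p dvd card (\<Union> ?B) + card (\<Union> ?A)" using assms(8) by (simp only:)
  moreover have "p dvd card (\<Union> ?A)"
  proof -
    have "card (\<Union> ?A) = sum card ?A"
      by (rule card_Union_disjoint) (use disj fin in \<open>auto intro: pairwise_subset\<close>)
    then show ?thesis by (auto intro: dvd_sum)
  qed
  ultimately have "p dvd card (\<Union> ?B)"
    by (simp only: dvd_add_left_iff)
  then show ?thesis unfolding Fix .
qed

text \<open>All orbits of a free action have length \<open>card (carrier H)\<close>. In
  \<open>card_stab\<close> this controls the order of an automorphism group about whose structure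
  nothing is known.\<close>

lemma card_dvd_card_free_action:
  assumes "group H" "finite (carrier H)" "finite \<Omega>"
    and closed: "\<And>g w. g \<in> carrier H \<Longrightarrow> w \<in> \<Omega> \<Longrightarrow> act g w \<in> \<Omega>"
    and one: "\<And>w. w \<in> \<Omega> \<Longrightarrow> act \<one>\<^bsub>H\<^esub> w = w"
    and mult: "\<And>g h w. g \<in> carrier H \<Longrightarrow> h \<in> carrier H \<Longrightarrow> w \<in> \<Omega> \<Longrightarrow>
      act (g \<otimes>\<^bsub>H\<^esub> h) w = act h (act g w)"
    and free: "\<And>g w. g \<in> carrier H \<Longrightarrow> w \<in> \<Omega> \<Longrightarrow> act g w = w \<Longrightarrow> g = \<one>\<^bsub>H\<^esub>"
  shows "card (carrier H) dvd card \<Omega>"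
proof -
  let ?\<phi> = "\<lambda>g. restrict (act (inv\<^bsub>H\<^esub> g)) \<Omega>"
  interpret group_action H \<Omega> ?\<phi>
    by (rule right_action_imp_group_action) (use assms in auto)
  interpret H: group H by fact
  have "card B = card (carrier H)" if B: "B \<in> orbits H \<Omega> ?\<phi>" for B
  proof -
    obtain w where w: "w \<in> \<Omega>" "B = orbit H ?\<phi> w"
      using B by (auto simp: orbits_def)
    have "stabilizer H ?\<phi> w = {\<one>\<^bsub>H\<^esub>}"
      using w free[OF H.inv_closed w(1)] one by (auto simp: stabilizer_def)
    then show ?thesis
      using orbit_stabilizer_theorem[OF w(1)] w by (simp add: order_def)
  qed
  moreover have "card \<Omega> = sum card (orbits H \<Omega> ?\<phi>)"
  proof -
    have "pairwise disjnt (orbits H \<Omega> ?\<phi>)"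
      using disjoint_union unfolding pairwise_def disjnt_def by blast
    moreover have "finite B" if "B \<in> orbits H \<Omega> ?\<phi>" for B
      using finite_subset[OF Sup_upper[OF that]] assms(3) unfolding orbits_coverture .
    ultimately have "card (\<Union> (orbits H \<Omega> ?\<phi>)) = sum card (orbits H \<Omega> ?\<phi>)"
      by (rule card_Union_disjoint)
    then show ?thesis unfolding orbits_coverture .
  qed
  ultimately show ?thesis by (simp add: dvd_sum)
qed

subsection \<open>Commutators, power subgroups and partial automorphisms\<close>

definition commr :: "('a,'b) monoid_scheme \<Rightarrow> 'a \<Rightarrow> 'a \<Rightarrow> 'a" where
  "commr G x y = inv\<^bsub>G\<^esub> x \<otimes>\<^bsub>G\<^esub> inv\<^bsub>G\<^esub> y \<otimes>\<^bsub>G\<^esub> x \<otimes>\<^bsub>G\<^esub> y"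

text \<open>The subgroup [A, A] B^p. Commutators and powers have separate arguments because the
  mixed subgroup [E, E] Q^p is needed in \<open>Q2_eq_Q\<close>.\<close>

definition compow :: "('a,'b) monoid_scheme \<Rightarrow> nat \<Rightarrow> 'a set \<Rightarrow> 'a set \<Rightarrow> 'a set" where
  "compow G p A B = generate G ({commr G x y | x y. x \<in> A \<and> y \<in> A} \<union> {x [^]\<^bsub>G\<^esub> p | x. x \<in> B})"

text \<open>For a finite p-group \<open>M\<close> the subgroup \<open>[M, M] M^p\<close> is the Frattini subgroup; unlike \<^const>\<open>frattini\<close> it
  comes with generators.\<close>
abbreviation frat :: "('a,'b) monoid_scheme \<Rightarrow> nat \<Rightarrow> 'a set \<Rightarrow> 'a set" where
  "frat G p M \<equiv> compow G p M M"

text \<open>For normal \<open>N\<close> this is the preimage in \<open>M\<close> of the centralizer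
  of \<open>A\<close> modulo \<open>N\<close>. Working with preimages keeps most arguments outside
  quotient groups.\<close>

definition cenmod :: "('a,'b) monoid_scheme \<Rightarrow> 'a set \<Rightarrow> 'a set \<Rightarrow> 'a set \<Rightarrow> 'a set" where
  "cenmod G N M A = {x \<in> M. \<forall>a\<in>A. commr G x a \<in> N}"

text \<open>Values outside \<open>M\<close> are left free, so that the predicate covers both the
  extensional morphisms of a fusion system and plain conjugation maps.\<close>

definition sub_aut :: "('a,'b) monoid_scheme \<Rightarrow> 'a set \<Rightarrow> ('a \<Rightarrow> 'a) \<Rightarrow> bool" where
  "sub_aut G M \<phi> \<longleftrightarrow> bij_betw \<phi> M M \<and> (\<forall>x\<in>M. \<forall>y\<in>M. \<phi> (x \<otimes>\<^bsub>G\<^esub> y) = \<phi> x \<otimes>\<^bsub>G\<^esub> \<phi> y)"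

context group
begin

lemma mult_inv_cancel:
  assumes "x \<in> carrier G" "y \<in> carrier G"
  shows "x \<otimes> (inv x \<otimes> y) = y" "inv x \<otimes> (x \<otimes> y) = y"
  using assms by (simp_all add: m_assoc[symmetric])

text \<open>These rules reduce products to right-nested reduced words, which decides the commutator
  identities that hold in a free group.\<close>

lemmas free_normalize = m_assoc inv_mult_group mult_inv_cancel

lemma commr_closed [simp, intro]:
  "x \<in> carrier G \<Longrightarrow> y \<in> carrier G \<Longrightarrow> commr G x y \<in> carrier G"
  by (simp add: commr_def)

lemma inv_commr:
  "x \<in> carrier G \<Longrightarrow> y \<in> carrier G \<Longrightarrow> inv (commr G x y) = commr G y x"
  by (simp add: commr_def free_normalize)

lemma commr_self: "x \<in> carrier G \<Longrightarrow> commr G x x = \<one>"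
  by (simp add: commr_def free_normalize)

lemma commr_one_left: "x \<in> carrier G \<Longrightarrow> commr G \<one> x = \<one>"
  by (simp add: commr_def free_normalize)

lemma commr_mult:
  "x \<in> carrier G \<Longrightarrow> y \<in> carrier G \<Longrightarrow> z \<in> carrier G \<Longrightarrow>
    commr G (x \<otimes> y) z = inv y \<otimes> commr G x z \<otimes> y \<otimes> commr G y z"
  by (simp add: commr_def free_normalize)

lemma commr_inv:
  "x \<in> carrier G \<Longrightarrow> z \<in> carrier G \<Longrightarrow> commr G (inv x) z = inv (inv x) \<otimes> inv (commr G x z) \<otimes> inv x"
  by (simp add: commr_def free_normalize)

lemma commr_mem_iff:
  assumes "subgroup N G" "x \<in> carrier G" "y \<in> carrier G"
  shows "commr G x y \<in> N \<longleftrightarrow> commr G y x \<in> N"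
  using inv_commr[OF assms(2,3)] inv_commr[OF assms(3,2)]
    subgroup.m_inv_closed[OF assms(1), of "commr G x y"] subgroup.m_inv_closed[OF assms(1), of "commr G y x"]
  by auto

lemma commr_eq_one_iff:
  assumes "x \<in> carrier G" "y \<in> carrier G"
  shows "commr G x y = \<one> \<longleftrightarrow> x \<otimes> y = y \<otimes> x"
proof
  have "y \<otimes> x \<otimes> commr G x y = x \<otimes> y"
    using assms by (simp add: commr_def free_normalize)
  then show "commr G x y = \<one> \<Longrightarrow> x \<otimes> y = y \<otimes> x" using assms by simp
  have "commr G x y = inv (y \<otimes> x) \<otimes> (x \<otimes> y)"
    using assms by (simp add: commr_def free_normalize)
  then show "x \<otimes> y = y \<otimes> x \<Longrightarrow> commr G x y = \<one>"
    using l_inv[of "y \<otimes> x"] assms by simp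
qed

lemma commr_mem_normal:
  assumes "N \<lhd> G" "x \<in> N" "y \<in> carrier G"
  shows "commr G x y \<in> N" "commr G y x \<in> N"
proof -
  interpret normal N G by fact
  have x: "x \<in> carrier G" by (rule mem_carrier[OF assms(2)])
  have "commr G x y = inv x \<otimes> (inv y \<otimes> x \<otimes> y)"
    using x assms(3) by (simp add: commr_def m_assoc)
  then show 1: "commr G x y \<in> N"
    using assms inv_op_closed1 by simp
  show "commr G y x \<in> N"
    using m_inv_closed[OF 1] inv_commr[OF x assms(3)] by simp
qed

text \<open>The identity [x y, a] = [x, a]^y [y, a] only requires \<open>M\<close> to normalize
  \<open>N\<close>. This generality is used in \<open>Q2_eq_Q\<close>, where \<open>A0\<close> is
  known to be normalized by \<open>E\<close> only.\<close>

lemma subgroup_cenmod: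
  assumes "subgroup M G" "subgroup N G" "A \<subseteq> carrier G"
    and conj: "\<And>m n. m \<in> M \<Longrightarrow> n \<in> N \<Longrightarrow> inv m \<otimes> n \<otimes> m \<in> N"
  shows "subgroup (cenmod G N M A) G"
proof -
  interpret M: subgroup M G by fact
  interpret N: subgroup N G by fact
  have A: "a \<in> carrier G" if "a \<in> A" for a using that assms by blast
  show ?thesis
  proof (rule subgroupI)
    have "\<one> \<in> cenmod G N M A"
      using A by (auto simp: cenmod_def commr_one_left)
    then show "cenmod G N M A \<noteq> {}" by blast
    show "inv a \<in> cenmod G N M A" if "a \<in> cenmod G N M A" for a
    proof -
      have "commr G (inv a) b \<in> N" if b: "b \<in> A" for b
      proof -
        have *: "a \<in> M" "commr G a b \<in> N" using \<open>a \<in> _\<close> b by (auto simp: cenmod_def)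
        show ?thesis
          using * A[OF b] conj[of "inv a" "inv (commr G a b)"]
          by (simp add: commr_inv)
      qed
      then show ?thesis using that by (auto simp: cenmod_def)
    qed
    show "a \<otimes> b \<in> cenmod G N M A" if "a \<in> cenmod G N M A" "b \<in> cenmod G N M A" for a b
    proof -
      have "commr G (a \<otimes> b) c \<in> N" if c: "c \<in> A" for c
      proof -
        have *: "a \<in> M" "commr G a c \<in> N" "b \<in> M" "commr G b c \<in> N"
          using \<open>a \<in> _\<close> \<open>b \<in> _\<close> c by (auto simp: cenmod_def)
        show ?thesis
          using * A[OF c] conj[of b "commr G a c"] by (simp add: commr_mult)
      qed
      then show ?thesis using that by (auto simp: cenmod_def)
    qed
  qed (auto simp: cenmod_def)
qed

lemma subgroup_cenmod_normal:
  assumes "subgroup M G" "N \<lhd> G" "A \<subseteq> carrier G"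
  shows "subgroup (cenmod G N M A) G"
  by (rule subgroup_cenmod[OF assms(1) normal_imp_subgroup[OF assms(2)] assms(3)])
    (use assms in \<open>auto intro: normal.inv_op_closed1 subgroup.mem_carrier\<close>)

lemma normal_cenmod:
  assumes "M \<lhd> G" "N \<lhd> G" "A \<lhd> G"
  shows "cenmod G N M A \<lhd> G"
proof (rule normal_invI)
  interpret M: normal M G by fact
  interpret N: normal N G by fact
  interpret A: normal A G by fact
  show "subgroup (cenmod G N M A) G"
    by (rule subgroup_cenmod_normal) (auto intro: M.subgroup_axioms assms)
  fix g x assume g: "g \<in> carrier G" and x: "x \<in> cenmod G N M A"
  have "commr G (g \<otimes> x \<otimes> inv g) a \<in> N" if a: "a \<in> A" for a
  proof -
    have xc: "x \<in> carrier G" using x by (auto simp: cenmod_def)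
    have "commr G x (inv g \<otimes> a \<otimes> g) \<in> N"
      using x A.inv_op_closed1[OF g a] by (auto simp: cenmod_def)
    then have "g \<otimes> commr G x (inv g \<otimes> a \<otimes> g) \<otimes> inv g \<in> N"
      by (rule N.inv_op_closed2[OF g])
    also have "g \<otimes> commr G x (inv g \<otimes> a \<otimes> g) \<otimes> inv g = commr G (g \<otimes> x \<otimes> inv g) a"
      using g xc A.mem_carrier[OF a] by (simp add: commr_def free_normalize)
    finally show ?thesis .
  qed
  then show "g \<otimes> x \<otimes> inv g \<in> cenmod G N M A"
    using x M.inv_op_closed2[OF g] by (auto simp: cenmod_def)
qed

lemma commr_mem: "subgroup M G \<Longrightarrow> x \<in> M \<Longrightarrow> y \<in> M \<Longrightarrow> commr G x y \<in> M"
  by (simp add: commr_def subgroup.m_closed subgroup.m_inv_closed)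

lemma pow_mem: "subgroup M G \<Longrightarrow> x \<in> M \<Longrightarrow> x [^] (n::nat) \<in> M"
  by (induction n) (auto simp: subgroup.one_closed subgroup.m_closed)

lemma compow_subset:
  assumes "subgroup L G" "\<And>x y. x \<in> A \<Longrightarrow> y \<in> A \<Longrightarrow> commr G x y \<in> L"
    "\<And>x. x \<in> B \<Longrightarrow> x [^] p \<in> L"
  shows "compow G p A B \<subseteq> L"
  unfolding compow_def by (rule generate_subgroup_incl) (use assms in auto)

lemma frat_subset: "subgroup M G \<Longrightarrow> frat G p M \<subseteq> M"
  by (rule compow_subset) (auto intro: commr_mem pow_mem)

lemma subgroup_compow: "A \<subseteq> carrier G \<Longrightarrow> B \<subseteq> carrier G \<Longrightarrow> subgroup (compow G p A B) G"
  unfolding compow_def by (rule generate_is_subgroup) auto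

lemma commr_in_compow: "x \<in> A \<Longrightarrow> y \<in> A \<Longrightarrow> commr G x y \<in> compow G p A B"
  unfolding compow_def by (rule generate.incl) auto

lemma pow_in_compow: "x \<in> B \<Longrightarrow> x [^] p \<in> compow G p A B"
  unfolding compow_def by (rule generate.incl) auto

lemma commr_conj:
  "\<lbrakk>g \<in> carrier G; x \<in> carrier G; y \<in> carrier G\<rbrakk> \<Longrightarrow>
    g \<otimes> commr G x y \<otimes> inv g = commr G (g \<otimes> x \<otimes> inv g) (g \<otimes> y \<otimes> inv g)"
  by (simp add: commr_def free_normalize)

lemma pow_conj:
  "\<lbrakk>g \<in> carrier G; x \<in> carrier G\<rbrakk> \<Longrightarrow> g \<otimes> x [^] (n::nat) \<otimes> inv g = (g \<otimes> x \<otimes> inv g) [^] n"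
proof (induction n)
  case (Suc n)
  have "g \<otimes> x [^] Suc n \<otimes> inv g = (g \<otimes> x [^] n \<otimes> inv g) \<otimes> (g \<otimes> x \<otimes> inv g)"
    using Suc.prems by (simp add: free_normalize)
  then show ?case using Suc by simp
qed simp

lemma normal_compow:
  assumes "A \<lhd> G" "B \<lhd> G"
  shows "compow G p A B \<lhd> G"
proof -
  interpret A: normal A G by fact
  interpret B: normal B G by fact
  show ?thesis
    unfolding compow_def
  proof (rule normal_generateI)
    fix h g assume h: "h \<in> {commr G x y |x y. x \<in> A \<and> y \<in> A} \<union> {x [^] p |x. x \<in> B}" and g: "g \<in> carrier G"
    then consider x y where "x \<in> A" "y \<in> A" "h = commr G x y" | x where "x \<in> B" "h = x [^] p"
      by blast
    then show "g \<otimes> h \<otimes> inv g \<in> {commr G x y |x y. x \<in> A \<and> y \<in> A} \<union> {x [^] p |x. x \<in> B}"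
    proof cases
      case 1
      then show ?thesis
        using commr_conj[OF g, of x y] A.inv_op_closed2[OF g] by auto
    next
      case 2
      then show ?thesis
        using pow_conj[OF g, of x p] B.inv_op_closed2[OF g] by auto
    qed
  qed auto
qed

lemma commr_consistent:
  assumes "subgroup H G" "x \<in> H" "y \<in> H"
  shows "commr (G\<lparr>carrier := H\<rparr>) x y = commr G x y"
  using assms by (simp add: commr_def m_inv_consistent)

text \<open>Results on the carrier of a p-group are applied to its subgroups by shrinking the
  carrier. This and the later consistency lemmas translate the outcome back.\<close>

lemma frat_consistent:
  assumes "subgroup H G" "M \<subseteq> H"
  shows "frat (G\<lparr>carrier := H\<rparr>) p M = frat G p M"
proof -
  have "{commr (G\<lparr>carrier := H\<rparr>) x y |x y. x \<in> M \<and> y \<in> M} = {commr G x y |x y. x \<in> M \<and> y \<in> M}"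
    using assms by (intro Collect_cong) (metis commr_consistent subsetD)
  moreover have "{x [^]\<^bsub>G\<lparr>carrier := H\<rparr>\<^esub> p |x. x \<in> M} = {x [^] p |x. x \<in> M}"
    by (simp add: nat_pow_consistent[symmetric])
  moreover have "{commr G x y |x y. x \<in> M \<and> y \<in> M} \<union> {x [^] p |x. x \<in> M} \<subseteq> H"
    using assms by (auto intro!: commr_mem pow_mem)
  ultimately show ?thesis
    unfolding compow_def using generate_consistent[OF _ assms(1)] by simp
qed

lemma sub_aut_group_hom:
  assumes "subgroup M G" "sub_aut G M \<phi>"
  shows "group_hom (G\<lparr>carrier := M\<rparr>) (G\<lparr>carrier := M\<rparr>) \<phi>"
  using assms subgroup_imp_group[OF assms(1)]
  by (auto simp: sub_aut_def group_hom_def group_hom_axioms_def hom_def bij_betw_def)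

lemma sub_aut_simps:
  assumes "subgroup M G" "sub_aut G M \<phi>" "x \<in> M"
  shows "\<phi> x \<in> M" "y \<in> M \<Longrightarrow> \<phi> (x \<otimes> y) = \<phi> x \<otimes> \<phi> y" "\<phi> (inv x) = inv (\<phi> x)"
    "\<phi> (x [^] (n::nat)) = \<phi> x [^] n"
    "y \<in> M \<Longrightarrow> \<phi> (commr G x y) = commr G (\<phi> x) (\<phi> y)"
proof -
  interpret M: subgroup M G by fact
  interpret h: group_hom "G\<lparr>carrier := M\<rparr>" "G\<lparr>carrier := M\<rparr>" \<phi>
    by (rule sub_aut_group_hom[OF assms(1,2)])
  have 1: "\<phi> z \<in> M" if "z \<in> M" for z using h.hom_closed[of z] that by simp
  have 2: "\<phi> (z \<otimes> y) = \<phi> z \<otimes> \<phi> y" if "z \<in> M" "y \<in> M" for z y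
    using assms that by (simp add: sub_aut_def)
  have 3: "\<phi> (inv z) = inv (\<phi> z)" if "z \<in> M" for z
    using h.hom_inv[of z] that assms by (simp add: m_inv_consistent 1)
  show "\<phi> x \<in> M" "y \<in> M \<Longrightarrow> \<phi> (x \<otimes> y) = \<phi> x \<otimes> \<phi> y" "\<phi> (inv x) = inv (\<phi> x)"
    using 1 2 3 assms by auto
  show "\<phi> (x [^] (n::nat)) = \<phi> x [^] n"
    using h.hom_nat_pow[of x n] assms by (simp add: nat_pow_consistent[symmetric])
  show "y \<in> M \<Longrightarrow> \<phi> (commr G x y) = commr G (\<phi> x) (\<phi> y)"
    using assms by (simp add: commr_def 2 3)
qed

lemma sub_aut_image_compow:
  assumes "subgroup M G" "sub_aut G M \<phi>" "A \<subseteq> M" "B \<subseteq> M"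
  shows "\<phi> ` compow G p A B = compow G p (\<phi> ` A) (\<phi> ` B)"
proof -
  let ?gens = "\<lambda>A B. {commr G x y |x y. x \<in> A \<and> y \<in> A} \<union> {x [^] p |x. x \<in> B}"
  interpret h: group_hom "G\<lparr>carrier := M\<rparr>" "G\<lparr>carrier := M\<rparr>" \<phi>
    by (rule sub_aut_group_hom[OF assms(1,2)])
  have sub: "?gens A B \<subseteq> M" if "A \<subseteq> M" "B \<subseteq> M" for A B
    using that commr_mem[OF assms(1)] pow_mem[OF assms(1)] by blast
  have im: "\<phi> ` A \<subseteq> M" "\<phi> ` B \<subseteq> M"
    using assms(3,4) sub_aut_simps(1)[OF assms(1,2)] by blast+
  have c: "\<phi> (commr G x y) = commr G (\<phi> x) (\<phi> y)" if "x \<in> A" "y \<in> A" for x y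
    using sub_aut_simps(5)[OF assms(1,2)] assms(3) that by blast
  have q: "\<phi> (x [^] p) = \<phi> x [^] p" if "x \<in> B" for x
    using sub_aut_simps(4)[OF assms(1,2)] assms(4) that by blast
  have "\<phi> ` ?gens A B = ?gens (\<phi> ` A) (\<phi> ` B)"
  proof -
    have "\<phi> ` {commr G x y |x y. x \<in> A \<and> y \<in> A} = {commr G x y |x y. x \<in> \<phi> ` A \<and> y \<in> \<phi> ` A}"
      using c by (force simp: image_iff)
    moreover have "\<phi> ` {x [^] p |x. x \<in> B} = {x [^] p |x. x \<in> \<phi> ` B}"
      using q by (force simp: image_iff)
    ultimately show ?thesis by (simp only: image_Un)
  qed
  then show ?thesis
    unfolding compow_def
    using h.generate_img[of "?gens A B"] generate_consistent[OF sub[OF assms(3,4)] assms(1)]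
      generate_consistent[OF sub[OF im] assms(1)] sub[OF assms(3,4)] by simp
qed

text \<open>When \<open>\<phi>\<close> fixes \<open>N\<close> and \<open>B\<close>, this makes the
  kernel of a power map invariant, so that irreducibility applies to it;
  \<open>sub_aut_image_cenmod\<close> does the same for centralizers.\<close>

lemma sub_aut_image_pow_mem:
  assumes "subgroup M G" "sub_aut G M \<phi>" "N \<subseteq> M" "B \<subseteq> M"
  shows "\<phi> ` {x \<in> B. x [^] (n::nat) \<in> N} = {x \<in> \<phi> ` B. x [^] n \<in> \<phi> ` N}"
proof -
  have inj: "inj_on \<phi> M" using assms by (simp add: sub_aut_def bij_betw_def)
  have "\<phi> x [^] n \<in> \<phi> ` N \<longleftrightarrow> x [^] n \<in> N" if "x \<in> B" for x
  proof -
    have "x \<in> M" using that assms by auto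
    then show ?thesis
      using sub_aut_simps(4)[OF assms(1,2), of x n] inj_on_image_mem_iff[OF inj, of "x [^] n" N]
        pow_mem[OF assms(1)] assms(3) by simp
  qed
  then show ?thesis by auto
qed

lemma sub_aut_image_cenmod:
  assumes "subgroup M G" "sub_aut G M \<phi>" "N \<subseteq> M" "B \<subseteq> M" "A \<subseteq> M"
  shows "\<phi> ` cenmod G N B A = cenmod G (\<phi> ` N) (\<phi> ` B) (\<phi> ` A)"
proof -
  have inj: "inj_on \<phi> M" using assms by (simp add: sub_aut_def bij_betw_def)
  have c: "commr G (\<phi> x) (\<phi> y) \<in> \<phi> ` N \<longleftrightarrow> commr G x y \<in> N" if "x \<in> B" "y \<in> A" for x y
  proof -
    have "x \<in> M" "y \<in> M" using that assms by auto
    then show ?thesis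
      using sub_aut_simps(5)[OF assms(1,2), of x y] inj_on_image_mem_iff[OF inj, of "commr G x y" N]
        commr_mem[OF assms(1)] assms(3) by simp
  qed
  then show ?thesis unfolding cenmod_def by auto
qed

lemma sub_aut_image_normal:
  assumes "sub_aut G (carrier G) \<phi>" "N \<lhd> G"
  shows "\<phi> ` N \<lhd> G"
  by (rule iso_normal_subgroup) (use assms in \<open>auto simp: iso_def sub_aut_def hom_def bij_betw_def\<close>)

lemma sub_aut_card_image:
  assumes "sub_aut G M \<phi>" "N \<subseteq> M"
  shows "card (\<phi> ` N) = card N"
  using assms by (auto simp: sub_aut_def bij_betw_def intro: card_image inj_on_subset)

end

subsection \<open>Normal sections of finite p-groups\<close>

lemma (in group) card_subgroup_dvd:
  assumes "subgroup H G" "subgroup K G" "H \<subseteq> K"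
  shows "card H dvd card K"
proof -
  interpret K: group "G\<lparr>carrier := K\<rparr>" by (rule subgroup_imp_group) fact
  show ?thesis
    using dvd_triv_right[of "card H" "card (rcosets\<^bsub>G\<lparr>carrier := K\<rparr>\<^esub> H)"]
      K.lagrange[OF subgroup_incl[OF assms]] by (simp add: order_def)
qed

locale finite_p_group = group +
  fixes p :: nat
  assumes prime_p: "Factorial_Ring.prime p" and odd_p: "odd p" and p_group: "p_group p G"
begin

lemma finite_carrier [simp]: "finite (carrier G)"
  using p_group by (simp add: p_group_def)

lemma finite_subgroup: "subgroup H G \<Longrightarrow> finite H"
  by (meson finite_carrier finite_subset subgroup.subset)

lemma p_gt_1: "p > 1"
  using prime_p prime_gt_1_nat by blast

lemma card_subgroup_power:
  assumes "subgroup H G"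
  obtains k where "card H = p ^ k"
proof -
  obtain n where "card (carrier G) = p ^ n" using p_group by (auto simp: p_group_def)
  then have "card H dvd p ^ n"
    using card_subgroup_dvd[OF assms subgroup_self subgroup.subset[OF assms]] by simp
  then show ?thesis using that prime_p divides_primepow_nat by blast
qed

lemma subgroup_card_pos: "subgroup H G \<Longrightarrow> 0 < card H"
  using finite_subgroup subgroup.one_closed by (fastforce simp: card_gt_0_iff)

lemma finite_p_group_subgroup:
  assumes "subgroup H G"
  shows "finite_p_group (G\<lparr>carrier := H\<rparr>) p"
proof -
  interpret H: group "G\<lparr>carrier := H\<rparr>" by (rule subgroup_imp_group) fact
  obtain k where k: "card H = p ^ k" using card_subgroup_power[OF assms] .
  show ?thesis
    using k finite_subgroup[OF assms] prime_p odd_p H.is_group by unfold_locales (auto simp: p_group_def)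
qed

lemma subgroup_card_step:
  assumes "subgroup N G" "subgroup M G" "N \<subset> M"
  shows "p * card N dvd card M" "p * card N \<le> card M"
proof -
  obtain k l where kl: "card N = p ^ k" "card M = p ^ l"
    using assms card_subgroup_power by metis
  have "card N < card M"
    using assms finite_subgroup psubset_card_mono by blast
  then have "k < l" using kl p_gt_1 by (metis power_less_imp_less_exp)
  then have "p ^ Suc k dvd p ^ l" by (intro le_imp_power_dvd) simp
  then show "p * card N dvd card M" using kl by simp
  then show "p * card N \<le> card M"
    using subgroup_card_pos[OF assms(2)] by (rule dvd_imp_le)
qed

text \<open>Proper inclusions of p-groups have index at least p, so nothing lies strictly between.
  Most proofs that a subgroup is everything end here.\<close>

lemma subgroup_eq_of_index_p:
  assumes "subgroup N G" "subgroup L G" "subgroup M G" "N \<subset> L" "L \<subseteq> M"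
    and "card M \<le> p * card N"
  shows "L = M"
proof (rule card_subset_eq)
  have "p * card N \<le> card L" by (rule subgroup_card_step) fact+
  then show "card L = card M"
    using assms card_mono[OF finite_subgroup[OF assms(3)] assms(5)] by linarith
qed (use assms finite_subgroup in auto)

text \<open>Conjugation permutes the cosets of \<open>N\<close> in \<open>M\<close>. The number of
  fixed cosets is divisible by p, and \<open>N\<close> itself is one of them, so there is another
  one.\<close>

lemma exists_central_mod:
  assumes "N \<lhd> G" "M \<lhd> G" "N \<subset> M"
  obtains m where "m \<in> M" "m \<notin> N" "\<And>t. t \<in> carrier G \<Longrightarrow> commr G m t \<in> N"
proof -
  interpret N: normal N G by fact
  interpret M: normal M G by fact
  interpret M': group "G\<lparr>carrier := M\<rparr>" by (rule subgroup_imp_group) (rule M.subgroup_axioms)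
  define \<Omega> where "\<Omega> = (\<lambda>m. N #> m) ` M"
  define act where "act = (\<lambda>t C. (\<lambda>x. inv t \<otimes> x \<otimes> t) ` C)"
  have act_coset: "act t (N #> m) = N #> (inv t \<otimes> m \<otimes> t)" if "t \<in> carrier G" "m \<in> carrier G" for t m
  proof
    show "act t (N #> m) \<subseteq> N #> (inv t \<otimes> m \<otimes> t)"
    proof (clarsimp simp: act_def r_coset_def)
      fix n assume n: "n \<in> N"
      have "inv t \<otimes> (n \<otimes> m) \<otimes> t = (inv t \<otimes> n \<otimes> t) \<otimes> (inv t \<otimes> m \<otimes> t)"
        using that n by (simp add: free_normalize)
      then show "\<exists>h\<in>N. inv t \<otimes> (n \<otimes> m) \<otimes> t = h \<otimes> (inv t \<otimes> m \<otimes> t)"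
        using N.inv_op_closed1[OF that(1) n] by blast
    qed
    show "N #> (inv t \<otimes> m \<otimes> t) \<subseteq> act t (N #> m)"
    proof (clarsimp simp: act_def r_coset_def image_iff)
      fix n assume n: "n \<in> N"
      have "n \<otimes> (inv t \<otimes> m \<otimes> t) = inv t \<otimes> ((t \<otimes> n \<otimes> inv t) \<otimes> m) \<otimes> t"
        using that n by (simp add: free_normalize)
      then show "\<exists>x\<in>N. n \<otimes> (inv t \<otimes> m \<otimes> t) = inv t \<otimes> (x \<otimes> m) \<otimes> t"
        using N.inv_op_closed2[OF that(1) n] by blast
    qed
  qed
  obtain n where n: "card (carrier G) = p ^ n" using p_group by (auto simp: p_group_def)
  have rc: "\<Omega> = rcosets\<^bsub>G\<lparr>carrier := M\<rparr>\<^esub> N"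
    unfolding \<Omega>_def RCOSETS_def by auto
  have "card \<Omega> * card N = card M"
    using M'.lagrange[OF subgroup_incl[OF N.subgroup_axioms M.subgroup_axioms]] assms(3)
    unfolding rc by (simp add: order_def)
  moreover have "p * card N dvd card M"
    by (rule subgroup_card_step) (use assms N.subgroup_axioms M.subgroup_axioms in auto)
  ultimately have "p dvd card \<Omega>"
    using subgroup_card_pos[OF N.subgroup_axioms]
    by (metis dvd_times_right_cancel_iff less_numeral_extra(3))
  then have "p dvd card {C \<in> \<Omega>. \<forall>t\<in>carrier G. act t C = C}"
  proof (rule p_dvd_card_fixed_points[OF is_group n prime_p, rotated -1])
    show "finite \<Omega>" unfolding \<Omega>_def using finite_subgroup[OF M.subgroup_axioms] by simp
    show "act t C \<in> \<Omega>" if "t \<in> carrier G" "C \<in> \<Omega>" for t C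
      using that act_coset[OF that(1)] M.inv_op_closed1[OF that(1)] unfolding \<Omega>_def by auto
    show "act \<one> C = C" if "C \<in> \<Omega>" for C
      using that act_coset[OF one_closed] unfolding \<Omega>_def by auto
    show "act (s \<otimes> t) C = act t (act s C)" if "s \<in> carrier G" "t \<in> carrier G" "C \<in> \<Omega>" for s t C
      using that act_coset unfolding \<Omega>_def by (auto simp: free_normalize)
  qed
  moreover have "N \<in> {C \<in> \<Omega>. \<forall>t\<in>carrier G. act t C = C}" (is "_ \<in> ?Fix")
  proof -
    have "N #> \<one> = N" using N.subset by simp
    then show ?thesis
      using act_coset[of _ \<one>] unfolding \<Omega>_def by (auto simp: image_iff intro!: bexI[of _ \<one>])
  qed
  moreover have "finite ?Fix" unfolding \<Omega>_def using finite_subgroup[OF M.subgroup_axioms] by simp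
  ultimately have "?Fix \<noteq> {N}" using p_gt_1 by auto
  then obtain C where C: "C \<in> ?Fix" "C \<noteq> N" using \<open>N \<in> ?Fix\<close> by blast
  then obtain m where m: "m \<in> M" "C = N #> m" unfolding \<Omega>_def by auto
  show ?thesis
  proof (rule that[of m])
    show "m \<in> M" by fact
    show "m \<notin> N" using C m N.rcos_const by auto
    show "commr G m t \<in> N" if t: "t \<in> carrier G" for t
    proof -
      have mc: "m \<in> carrier G" using m by simp
      have "N #> (inv t \<otimes> m \<otimes> t) = N #> m"
        using C t m act_coset[OF t mc] by auto
      then have "inv t \<otimes> m \<otimes> t \<in> N #> m"
          using t mc rcos_self[OF _ N.subgroup_axioms, of "inv t \<otimes> m \<otimes> t"] by simp
      then have "inv t \<otimes> m \<otimes> t \<otimes> inv m \<in> N"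
        using N.rcos_module[OF is_group mc, of "inv t \<otimes> m \<otimes> t"] t mc by simp
      then have "inv m \<otimes> (inv t \<otimes> m \<otimes> t \<otimes> inv m) \<otimes> m \<in> N"
        by (rule N.inv_op_closed1[OF mc])
      then show ?thesis using t mc by (simp add: commr_def free_normalize)
    qed
  qed
qed

text \<open>The part of \<open>M/N\<close> that is central in \<open>G/N\<close> is nontrivial by
  \<open>exists_central_mod\<close>, and a section of order p has no proper nontrivial
  subgroup.\<close>

lemma commr_of_index_p:
  assumes "N \<lhd> G" "M \<lhd> G" "N \<subseteq> M" "card M \<le> p * card N" "m \<in> M" "t \<in> carrier G"
  shows "commr G m t \<in> N"
proof (cases "N = M")
  case True
  then show ?thesis using assms commr_mem_normal by blast
next
  case False
  have sub: "subgroup N G" "subgroup M G" using assms normal_imp_subgroup by auto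
  define Z where "Z = cenmod G N M (carrier G)"
  have Z: "subgroup Z G" unfolding Z_def by (rule subgroup_cenmod_normal) (use sub assms in auto)
  obtain m' where "m' \<in> M" "m' \<notin> N" "\<And>t. t \<in> carrier G \<Longrightarrow> commr G m' t \<in> N"
    using exists_central_mod[OF assms(1,2)] False assms(3) by blast
  then have "m' \<in> Z" "m' \<notin> N" by (auto simp: Z_def cenmod_def)
  moreover have "N \<subseteq> Z" using assms commr_mem_normal[OF assms(1)] by (auto simp: Z_def cenmod_def)
  ultimately have "Z = M"
    by (intro subgroup_eq_of_index_p[OF sub(1) Z sub(2) _ _ assms(4)]) (auto simp: Z_def cenmod_def)
  then show ?thesis using assms by (auto simp: Z_def cenmod_def)
qed

text \<open>The model is that Sylow p-subgroups of GL_2(p) have order p. If the fixed points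
  \<open>B/N\<close> are not all of \<open>M/N\<close>, then both \<open>M/B\<close> and
  \<open>B/N\<close> have order p. The action of \<open>t\<close> is then determined by [t, e]
  modulo \<open>N\<close> for a single \<open>e\<close> outside \<open>B\<close>, and this
  commutator lies in \<open>B\<close>, which leaves p possible values.\<close>

lemma card_centralizer_mod:
  assumes "N \<lhd> G" "M \<lhd> G" "N \<subseteq> M" "card M \<le> p\<^sup>2 * card N" "subgroup P G"
  shows "card P \<le> p * card (cenmod G N P M)"
proof -
  interpret N: normal N G by fact
  interpret M: normal M G by fact
  interpret P: subgroup P G by fact
  interpret P': group "G\<lparr>carrier := P\<rparr>" by (rule subgroup_imp_group) fact
  define B where "B = cenmod G N M (carrier G)"
  have B: "B \<lhd> G" unfolding B_def by (rule normal_cenmod) (use assms normal_self in auto)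
  have Bs: "subgroup B G" using B by (rule normal_imp_subgroup)
  have NB: "N \<subseteq> B" using assms commr_mem_normal[OF assms(1)] by (auto simp: B_def cenmod_def)
  have BM: "B \<subseteq> M" by (auto simp: B_def cenmod_def)
  show ?thesis
  proof (cases "B = M")
    case True
    have "commr G t m \<in> N" if "t \<in> P" "m \<in> M" for t m
    proof -
      have "m \<in> B" using that True by simp
      then have "commr G m t \<in> N" using that by (simp add: B_def cenmod_def)
      then show ?thesis using commr_mem_iff[OF N.subgroup_axioms, of m t] that by simp
    qed
    then have "cenmod G N P M = P" by (auto simp: cenmod_def)
    then show ?thesis using p_gt_1 by simp
  next
    case False
    then have "N \<noteq> M" using NB BM by blast
    then obtain m' where "m' \<in> M" "m' \<notin> N" "\<And>t. t \<in> carrier G \<Longrightarrow> commr G m' t \<in> N"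
      using exists_central_mod[OF assms(1,2)] assms(3) by blast
    then have "m' \<in> B" "m' \<notin> N" by (auto simp: B_def cenmod_def)
    then have pN: "p * card N \<le> card B" "p * card N dvd card B"
      by (auto intro!: subgroup_card_step N.subgroup_axioms Bs NB)
    have pB: "p * card B \<le> card M"
      by (rule subgroup_card_step) (use Bs M.subgroup_axioms BM False in auto)
    have cM: "card M \<le> p * card B"
      using order.trans[OF assms(4)] mult_le_mono2[OF pN(1), of p] by (simp add: power2_eq_square mult.assoc)
    have cB: "card B = p * card N"
    proof (rule antisym)
      have "p * card B \<le> p * (p * card N)"
        using order.trans[OF pB assms(4)] by (simp add: power2_eq_square mult.assoc)
      then show "card B \<le> p * card N" using p_gt_1 by simp
    qed (rule pN(1))
    obtain e where e: "e \<in> M" "e \<notin> B" using False BM by blast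
    have ec: "e \<in> carrier G" using e by simp
    define K where "K = cenmod G N P {e}"
    have K: "subgroup K G" unfolding K_def by (rule subgroup_cenmod_normal) (use assms ec in auto)
    have KP: "K \<subseteq> P" by (auto simp: K_def cenmod_def)
    \<comment> \<open>Centralizing \<open>e\<close> modulo \<open>N\<close> is enough, because
      \<open>B\<close> is centralized anyway and \<open>M\<close> is generated by \<open>B\<close>
      and \<open>e\<close>.\<close>
    have Kcen: "K = cenmod G N P M"
    proof
      show "cenmod G N P M \<subseteq> K" using e by (auto simp: K_def cenmod_def)
      show "K \<subseteq> cenmod G N P M"
      proof
        fix k assume k: "k \<in> K"
        then have kP: "k \<in> P" and kc: "k \<in> carrier G" by (auto simp: K_def cenmod_def)
        define C where "C = cenmod G N M {k}"
        have C: "subgroup C G" unfolding C_def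
          by (rule subgroup_cenmod_normal) (use assms kc M.subgroup_axioms in auto)
        have "B \<subseteq> C" using kc by (auto simp: B_def C_def cenmod_def)
        moreover have "e \<in> C"
          using k e commr_mem_iff[OF N.subgroup_axioms ec kc] by (auto simp: K_def C_def cenmod_def)
        ultimately have "C = M"
          using e by (intro subgroup_eq_of_index_p[OF Bs C M.subgroup_axioms _ _ cM])
            (auto simp: C_def cenmod_def)
        then have "commr G m k \<in> N" if "m \<in> M" for m using that by (auto simp: C_def cenmod_def)
        then show "k \<in> cenmod G N P M"
          using kP commr_mem_iff[OF N.subgroup_axioms _ kc] by (auto simp: cenmod_def)
      qed
    qed
    define f where "f = (\<lambda>t. N #> commr G t e)"
    have "f ` P \<subseteq> (\<lambda>b. N #> b) ` B"
    proof clarify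
      fix t assume "t \<in> P"
      then have "commr G e t \<in> B"
        by (intro commr_of_index_p[OF B M.normal_axioms BM cM e(1)]) simp
      then show "f t \<in> (\<lambda>b. N #> b) ` B"
        using commr_mem_iff[OF Bs ec, of t] \<open>t \<in> P\<close> by (auto simp: f_def)
    qed
    moreover have "card ((\<lambda>b. N #> b) ` B) = p"
    proof -
      interpret B': group "G\<lparr>carrier := B\<rparr>" by (rule subgroup_imp_group) (rule Bs)
      have "(\<lambda>b. N #> b) ` B = rcosets\<^bsub>G\<lparr>carrier := B\<rparr>\<^esub> N"
        unfolding RCOSETS_def by auto
      then have "card ((\<lambda>b. N #> b) ` B) * card N = p * card N"
        using B'.lagrange[OF subgroup_incl[OF N.subgroup_axioms Bs NB]] cB by (simp add: order_def)
      then show ?thesis using subgroup_card_pos[OF N.subgroup_axioms] by simp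
    qed
    moreover have "finite ((\<lambda>b. N #> b) ` B)" using finite_subgroup[OF Bs] by simp
    ultimately have fP: "card (f ` P) \<le> p" using card_mono by metis
    have fib: "K #> s = K #> t" if "s \<in> P" "t \<in> P" "f s = f t" for s t
    proof -
      have st: "s \<in> carrier G" "t \<in> carrier G" using that by auto
      have "commr G s e \<otimes> inv (commr G t e) \<in> N"
        using that(3) st ec N.rcos_module[OF is_group, of "commr G t e" "commr G s e"]
          rcos_self[OF _ N.subgroup_axioms, of "commr G s e"] by (auto simp: f_def)
      then have "t \<otimes> (commr G s e \<otimes> inv (commr G t e)) \<otimes> inv t \<in> N"
        by (rule N.inv_op_closed2[OF st(2)])
      also have "t \<otimes> (commr G s e \<otimes> inv (commr G t e)) \<otimes> inv t = commr G (s \<otimes> inv t) e"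
        using st ec by (simp add: commr_def free_normalize)
      finally have "s \<otimes> inv t \<in> K" using that by (simp add: K_def cenmod_def)
      then have "s \<in> K #> t"
        using subgroup.rcos_module[OF K is_group st(2,1)] by simp
      then show ?thesis using repr_independence[OF _ st(2) K] by simp
    qed
    \<comment> \<open>By \<open>fib\<close> a coset of \<open>K\<close> can be recovered from the
      value of \<open>f\<close> on it, so there are at most as many cosets as values.\<close>
    have "rcosets\<^bsub>G\<lparr>carrier := P\<rparr>\<^esub> K = (\<lambda>c. K #> (SOME t. t \<in> P \<and> f t = c)) ` f ` P"
    proof -
      have "K #> (SOME s. s \<in> P \<and> f s = f t) = K #> t" if "t \<in> P" for t
        using that someI[of "\<lambda>s. s \<in> P \<and> f s = f t" t] by (intro fib) auto
      then show ?thesis unfolding RCOSETS_def by auto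
    qed
    then have "card (rcosets\<^bsub>G\<lparr>carrier := P\<rparr>\<^esub> K) \<le> card (f ` P)"
      using card_image_le[of "f ` P"] finite_subgroup[OF assms(5)] by simp
    then have "card (rcosets\<^bsub>G\<lparr>carrier := P\<rparr>\<^esub> K) \<le> p" using fP by (rule order.trans)
    moreover have "card (rcosets\<^bsub>G\<lparr>carrier := P\<rparr>\<^esub> K) * card K = card P"
      using P'.lagrange[OF subgroup_incl[OF K assms(5) KP]] by (simp add: order_def)
    ultimately show ?thesis
      unfolding Kcen[symmetric] using mult_le_mono1[of "card (rcosets\<^bsub>G\<lparr>carrier := P\<rparr>\<^esub> K)" p "card K"] by simp
  qed
qed

end

subsection \<open>Frattini subgroups and ranks of finite p-groups\<close>

lemma (in group_hom) hom_commr: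
  "x \<in> carrier G \<Longrightarrow> y \<in> carrier G \<Longrightarrow> h (commr G x y) = commr H (h x) (h y)"
  by (simp add: commr_def)

lemma (in normal) group_hom_Mod: "group_hom G (G Mod H) (\<lambda>x. H #> x)"
  by (simp add: group_hom_def group_hom_axioms_def is_group factorgroup_is_group r_coset_hom_Mod)

lemma (in normal) coset_eq_one_iff:
  assumes "x \<in> carrier G"
  shows "H #> x = \<one>\<^bsub>G Mod H\<^esub> \<longleftrightarrow> x \<in> H"
  using assms coset_join1[OF _ assms subgroup_axioms] rcos_const[OF is_group] by auto

lemma (in group) pow_comm_commute:
  assumes "x \<in> carrier G" "y \<in> carrier G" "x \<otimes> y = y \<otimes> x"
  shows "x [^] (n::nat) \<otimes> y = y \<otimes> x [^] n"
proof (induction n)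
  case (Suc n)
  have "x [^] Suc n \<otimes> y = x [^] n \<otimes> (x \<otimes> y)" using assms by (simp add: m_assoc)
  also have "\<dots> = (x [^] n \<otimes> y) \<otimes> x" using assms by (simp add: m_assoc)
  finally show ?case using Suc assms by (simp add: m_assoc)
qed (use assms in simp)

text \<open>Collection in class 2: moving the next \<open>x\<close> to the left past
  \<open>y [^] n\<close> produces \<open>c [^] n\<close>, and the exponents 1 + ... + (n - 1) add up
  to the binomial coefficient.\<close>

lemma (in group) mult_pow_class2:
  assumes [simp]: "x \<in> carrier G" "y \<in> carrier G" "c \<in> carrier G"
    and yx: "y \<otimes> x = x \<otimes> y \<otimes> c" and cx: "c \<otimes> x = x \<otimes> c" and cy: "c \<otimes> y = y \<otimes> c"
  shows "(x \<otimes> y) [^] (n::nat) = x [^] n \<otimes> y [^] n \<otimes> c [^] (n choose 2)"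
proof (induction n)
  case (Suc n)
  have yn: "y [^] (n::nat) \<otimes> x = x \<otimes> y [^] n \<otimes> c [^] n" for n
  proof (induction n)
    case (Suc n)
    have "y [^] Suc n \<otimes> x = y [^] n \<otimes> (y \<otimes> x)" by (simp add: m_assoc)
    also have "\<dots> = (y [^] n \<otimes> x) \<otimes> y \<otimes> c" by (simp add: yx m_assoc)
    also have "\<dots> = x \<otimes> y [^] n \<otimes> (c [^] n \<otimes> y) \<otimes> c" unfolding Suc by (simp add: m_assoc)
    also have "\<dots> = x \<otimes> y [^] Suc n \<otimes> c [^] Suc n"
      using pow_comm_commute[OF _ _ cy, of n] by (simp add: m_assoc)
    finally show ?case .
  qed simp
  let ?m = "n choose 2"
  have cxm: "c [^] ?m \<otimes> x = x \<otimes> c [^] ?m" and cym: "c [^] k \<otimes> y = y \<otimes> c [^] k" for k :: nat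
    using pow_comm_commute[OF _ _ cx] pow_comm_commute[OF _ _ cy] by auto
  have "(x \<otimes> y) [^] Suc n = x [^] n \<otimes> y [^] n \<otimes> (c [^] ?m \<otimes> x) \<otimes> y"
    using Suc by (simp add: m_assoc)
  also have "\<dots> = x [^] n \<otimes> (y [^] n \<otimes> x) \<otimes> (c [^] ?m \<otimes> y)" unfolding cxm by (simp add: m_assoc)
  also have "\<dots> = x [^] Suc n \<otimes> y [^] n \<otimes> (c [^] n \<otimes> y) \<otimes> c [^] ?m"
    unfolding yn cym[of ?m] by (simp add: m_assoc)
  also have "\<dots> = x [^] Suc n \<otimes> y [^] Suc n \<otimes> (c [^] n \<otimes> c [^] ?m)"
    unfolding cym by (simp add: m_assoc)
  also have "c [^] n \<otimes> c [^] ?m = c [^] (Suc n choose 2)"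
    by (simp add: nat_pow_mult numeral_2_eq_2)
  finally show ?case .
qed (simp add: numeral_2_eq_2)

context finite_p_group
begin

text \<open>Oddness of p enters the argument through this divisibility: it kills the binomial terms
  of \<open>mult_pow_class2\<close> and \<open>conj_by_pow\<close>.\<close>

lemma p_dvd_choose_2: "p dvd (p choose 2)"
proof -
  obtain k where k: "p = 2 * k + 1" using odd_p by (auto elim: oddE)
  then have "p choose 2 = p * k" by (simp add: choose_two)
  then show ?thesis by simp
qed

text \<open>Modulo \<open>N\<close> the commutator of \<open>b\<close> and \<open>a\<close> is
  central in the group they generate and has order dividing p, so its power with exponent
  \<open>p choose 2\<close> disappears.\<close>

lemma coset_pow_mult_class2:
  assumes "N \<lhd> G" "a \<in> carrier G" "b \<in> carrier G"
    and cl2: "\<And>z. z \<in> {a, b} \<Longrightarrow> commr G (commr G b a) z \<in> N"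
    and cp: "commr G b a [^] p \<in> N"
  shows "N #> (a \<otimes> b) [^] p = N #> (a [^] p \<otimes> b [^] p)"
proof -
  interpret N: normal N G by fact
  interpret q: group_hom G "G Mod N" "\<lambda>x. N #> x" by (rule N.group_hom_Mod)
  note [simp] = assms(2,3)
  let ?q = "\<lambda>x. N #> x"
  let ?c = "commr G b a"
  have com: "?q ?c \<otimes>\<^bsub>G Mod N\<^esub> ?q z = ?q z \<otimes>\<^bsub>G Mod N\<^esub> ?q ?c" if "z \<in> {a, b}" for z
  proof -
    have z: "z \<in> carrier G" using that by auto
    have "?q (commr G ?c z) = \<one>\<^bsub>G Mod N\<^esub>"
      using cl2[OF that] N.coset_eq_one_iff z by simp
    then have "commr (G Mod N) (?q ?c) (?q z) = \<one>\<^bsub>G Mod N\<^esub>" using q.hom_commr z by simp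
    then show ?thesis using q.H.commr_eq_one_iff z by simp
  qed
  have ba: "?q b \<otimes>\<^bsub>G Mod N\<^esub> ?q a = ?q a \<otimes>\<^bsub>G Mod N\<^esub> ?q b \<otimes>\<^bsub>G Mod N\<^esub> ?q ?c"
  proof -
    have "b \<otimes> a = a \<otimes> b \<otimes> ?c" by (simp add: commr_def free_normalize)
    then show ?thesis by (metis assms(2,3) commr_closed m_closed q.hom_mult)
  qed
  obtain k where k: "p choose 2 = p * k" using p_dvd_choose_2 by auto
  have "?q ?c [^]\<^bsub>G Mod N\<^esub> p = \<one>\<^bsub>G Mod N\<^esub>"
    using cp N.coset_eq_one_iff[of "?c [^] p"] q.hom_nat_pow[of ?c p] by simp
  then have 1: "?q ?c [^]\<^bsub>G Mod N\<^esub> (p choose 2) = \<one>\<^bsub>G Mod N\<^esub>"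
    unfolding k by (simp only: q.H.nat_pow_pow[symmetric] q.H.nat_pow_one q.hom_closed commr_closed assms(2,3))
  have "?q ((a \<otimes> b) [^] p) = (?q a \<otimes>\<^bsub>G Mod N\<^esub> ?q b) [^]\<^bsub>G Mod N\<^esub> p"
    by (simp add: q.hom_nat_pow)
  also have "\<dots> = ?q a [^]\<^bsub>G Mod N\<^esub> p \<otimes>\<^bsub>G Mod N\<^esub> ?q b [^]\<^bsub>G Mod N\<^esub> p
     \<otimes>\<^bsub>G Mod N\<^esub> ?q ?c [^]\<^bsub>G Mod N\<^esub> (p choose 2)"
    by (rule q.H.mult_pow_class2) (use ba com in auto)
  also have "\<dots> = ?q a [^]\<^bsub>G Mod N\<^esub> p \<otimes>\<^bsub>G Mod N\<^esub> ?q b [^]\<^bsub>G Mod N\<^esub> p"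
    unfolding 1 by (intro q.H.r_one q.H.m_closed q.H.nat_pow_closed q.hom_closed assms)
  also have "\<dots> = ?q (a [^] p \<otimes> b [^] p)"
    by (simp only: q.hom_nat_pow[symmetric] q.hom_mult nat_pow_closed assms(2,3))
  finally show ?thesis .
qed

text \<open>The kernel of a power map that is multiplicative modulo \<open>N\<close>. Such kernels
  are the invariant subgroups between \<open>Q\<close> and \<open>E\<close> to which irreducibility
  will be applied.\<close>

lemma subgroup_pow_mem_class2:
  assumes "subgroup M G" "N \<lhd> G"
    and cl2: "\<And>x y z. x \<in> M \<Longrightarrow> y \<in> M \<Longrightarrow> z \<in> M \<Longrightarrow> commr G (commr G x y) z \<in> N"
    and cp: "\<And>x y. x \<in> M \<Longrightarrow> y \<in> M \<Longrightarrow> commr G x y [^] p \<in> N"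
  shows "subgroup {x \<in> M. x [^] p \<in> N} G"
proof (rule subgroupI)
  interpret M: subgroup M G by fact
  interpret N: normal N G by fact
  show "{x \<in> M. x [^] p \<in> N} \<subseteq> carrier G" by auto
  show "{x \<in> M. x [^] p \<in> N} \<noteq> {}" using M.one_closed by (auto intro!: exI[of _ \<one>])
  show "inv a \<in> {x \<in> M. x [^] p \<in> N}" if "a \<in> {x \<in> M. x [^] p \<in> N}" for a
    using that by (auto simp: nat_pow_inv)
  fix a b assume ab: "a \<in> {x \<in> M. x [^] p \<in> N}" "b \<in> {x \<in> M. x [^] p \<in> N}"
  have "N #> (a \<otimes> b) [^] p = N #> (a [^] p \<otimes> b [^] p)"
    by (rule coset_pow_mult_class2[OF assms(2)]) (use ab cl2 cp in auto)
  also have "\<dots> = N"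
    using ab by (intro N.rcos_const[OF is_group]) auto
  finally have "(a \<otimes> b) [^] p \<in> N" using N.coset_eq_one_iff[of "(a \<otimes> b) [^] p"] ab by simp
  then show "a \<otimes> b \<in> {x \<in> M. x [^] p \<in> N}" using ab by simp
qed

lemma subgroup_pow_mem:
  assumes "subgroup M G" "N \<lhd> G" "\<And>x y. x \<in> M \<Longrightarrow> y \<in> M \<Longrightarrow> commr G x y \<in> N"
  shows "subgroup {x \<in> M. x [^] p \<in> N} G"
proof (rule subgroup_pow_mem_class2[OF assms(1,2)])
  fix x y z assume "x \<in> M" "y \<in> M" "z \<in> M"
  then show "commr G (commr G x y) z \<in> N" "commr G x y [^] p \<in> N"
    using assms(3)[of x y] commr_mem_normal(1)[OF assms(2)] pow_mem[OF normal_imp_subgroup[OF assms(2)]]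
      subgroup.mem_carrier[OF assms(1)] by auto
qed

text \<open>\<open>H\<close> acts on its right cosets by right multiplication. Their number is
  divisible by p and \<open>H\<close> is fixed, so some other coset \<open>H #> g\<close> is fixed
  too, and H g h = H g means that g h g^-1 lies in \<open>H\<close>. The element required is
  therefore the inverse of \<open>g\<close>.\<close>

lemma normalizer_grows:
  assumes "subgroup H G" "H \<noteq> carrier G"
  obtains g where "g \<in> carrier G" "g \<notin> H" "\<And>h. h \<in> H \<Longrightarrow> inv g \<otimes> h \<otimes> g \<in> H"
proof -
  interpret H: subgroup H G by fact
  interpret H': group "G\<lparr>carrier := H\<rparr>" by (rule subgroup_imp_group) fact
  obtain k where k: "card H = p ^ k" using card_subgroup_power[OF assms(1)] .
  have "p * card H dvd card (carrier G)"
    by (rule subgroup_card_step) (use assms subgroup_self H.subset in auto)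
  moreover have "card (rcosets H) * card H = card (carrier G)"
    using lagrange[OF assms(1)] by (simp add: order_def)
  ultimately have "p * card H dvd card (rcosets H) * card H" by simp
  then have "p dvd card (rcosets H)" using subgroup_card_pos[OF assms(1)] by simp
  then have "p dvd card {C \<in> rcosets H. \<forall>h\<in>carrier (G\<lparr>carrier := H\<rparr>). C #> h = C}"
  proof (rule p_dvd_card_fixed_points[OF H'.is_group _ prime_p, rotated -1])
    show "card (carrier (G\<lparr>carrier := H\<rparr>)) = p ^ k" using k by simp
    show "finite (rcosets H)" by (simp add: RCOSETS_def)
    show "C #> h \<in> rcosets H" if "h \<in> carrier (G\<lparr>carrier := H\<rparr>)" "C \<in> rcosets H" for h C
      using that H.subset by (auto simp: RCOSETS_def coset_mult_assoc)
    show "C #> \<one>\<^bsub>G\<lparr>carrier := H\<rparr>\<^esub> = C" if "C \<in> rcosets H" for C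
      using that H.rcosets_carrier[OF is_group that] by simp
    show "C #> (g \<otimes>\<^bsub>G\<lparr>carrier := H\<rparr>\<^esub> h) = C #> g #> h"
      if "g \<in> carrier (G\<lparr>carrier := H\<rparr>)" "h \<in> carrier (G\<lparr>carrier := H\<rparr>)" "C \<in> rcosets H" for g h C
      using that H.rcosets_carrier[OF is_group that(3)] by (simp add: coset_mult_assoc)
  qed
  moreover have "H \<in> {C \<in> rcosets H. \<forall>h\<in>carrier (G\<lparr>carrier := H\<rparr>). C #> h = C}" (is "_ \<in> ?Fix")
    using H.subgroup_in_rcosets[OF is_group] H.rcos_const[OF is_group] by simp
  moreover have "finite ?Fix" by (simp add: RCOSETS_def)
  ultimately have "?Fix \<noteq> {H}" using p_gt_1 by auto
  then obtain C where C: "C \<in> ?Fix" "C \<noteq> H" using \<open>H \<in> ?Fix\<close> by blast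
  then obtain g where g: "g \<in> carrier G" "C = H #> g" by (auto simp: RCOSETS_def)
  show ?thesis
  proof (rule that[of "inv g"])
    show "inv g \<notin> H"
    proof
      assume "inv g \<in> H"
      then have "g \<in> H" using g H.m_inv_closed by fastforce
      then show False using C g H.rcos_const[OF is_group] by simp
    qed
    fix h assume h: "h \<in> H"
    have "H #> (g \<otimes> h) = H #> g"
      using C g h by (auto simp: coset_mult_assoc H.subset)
    then have "g \<otimes> h \<in> H #> g"
      using rcos_self[OF _ assms(1), of "g \<otimes> h"] g h by simp
    then show "inv (inv g) \<otimes> h \<otimes> inv g \<in> H"
      using H.rcos_module[OF is_group g(1), of "g \<otimes> h"] g h by simp
  qed (use g in simp)
qed

text \<open>Three subgroups containing \<open>L\<close> are shown in turn to be larger than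
  \<open>L\<close>, hence everything: the normalizer of \<open>L\<close>, the centre modulo
  \<open>L\<close>, and the set \<open>D\<close> of elements whose p-th power lies in
  \<open>L\<close>.\<close>

lemma maximal_contains_frat:
  assumes "subgroup L G" "L \<noteq> carrier G"
    and max: "\<And>K. subgroup K G \<Longrightarrow> L \<subseteq> K \<Longrightarrow> K = L \<or> K = carrier G"
  shows "frat G p (carrier G) \<subseteq> L"
proof -
  interpret L: subgroup L G by fact
  define N where "N = {g \<in> carrier G. (\<lambda>h. inv g \<otimes> h \<otimes> g) ` L = L}"
  have N: "subgroup N G"
  proof (rule subgroupI)
    have "\<one> \<in> N" by (auto simp: N_def)
    then show "N \<noteq> {}" by blast
    fix a b assume a: "a \<in> N" and b: "b \<in> N"
    then have c: "a \<in> carrier G" "b \<in> carrier G" by (auto simp: N_def)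
    have aL: "(\<lambda>h. inv a \<otimes> h \<otimes> a) ` L = L" and bL: "(\<lambda>h. inv b \<otimes> h \<otimes> b) ` L = L"
      using a b by (auto simp: N_def)
    have "(\<lambda>h. inv (inv a) \<otimes> h \<otimes> inv a) ` (\<lambda>h. inv a \<otimes> h \<otimes> a) ` L = L"
      unfolding image_image using c by (auto simp: free_normalize image_def)
    then show "inv a \<in> N" unfolding aL using c by (simp add: N_def)
    have "(\<lambda>h. inv (a \<otimes> b) \<otimes> h \<otimes> (a \<otimes> b)) ` L = (\<lambda>h. inv b \<otimes> h \<otimes> b) ` (\<lambda>h. inv a \<otimes> h \<otimes> a) ` L"
      unfolding image_image using c by (intro image_cong) (auto simp: free_normalize)
    then show "a \<otimes> b \<in> N" unfolding aL bL using c by (simp add: N_def)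
  qed (auto simp: N_def)
  have inN: "g \<in> N" if "g \<in> carrier G" "\<And>h. h \<in> L \<Longrightarrow> inv g \<otimes> h \<otimes> g \<in> L" for g
  proof -
    have "inj_on (\<lambda>h. inv g \<otimes> h \<otimes> g) L"
      using that(1) by (auto intro!: inj_onI)
    then have "(\<lambda>h. inv g \<otimes> h \<otimes> g) ` L = L"
      by (intro endo_inj_surj) (use that finite_subgroup[OF assms(1)] in auto)
    then show ?thesis using that by (simp add: N_def)
  qed
  obtain g where "g \<in> carrier G" "g \<notin> L" "\<And>h. h \<in> L \<Longrightarrow> inv g \<otimes> h \<otimes> g \<in> L"
    using normalizer_grows[OF assms(1,2)] by blast
  then have "g \<in> N" "g \<notin> L" using inN by auto
  moreover have "L \<subseteq> N" by (auto intro: inN)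
  ultimately have "N = carrier G" using max[OF N] by blast
  have norm: "L \<lhd> G"
  proof (rule normal_invI[OF assms(1)])
    fix x h assume x: "x \<in> carrier G" and h: "h \<in> L"
    have "inv x \<in> N" using x \<open>N = carrier G\<close> by simp
    then have "inv (inv x) \<otimes> h \<otimes> inv x \<in> L" using h by (auto simp: N_def)
    then show "x \<otimes> h \<otimes> inv x \<in> L" using x by simp
  qed
  obtain m where m: "m \<in> carrier G" "m \<notin> L" "\<And>t. t \<in> carrier G \<Longrightarrow> commr G m t \<in> L"
    using exists_central_mod[OF norm normal_self] assms L.subset by blast
  have "cenmod G L (carrier G) (carrier G) = carrier G"
  proof -
    have "subgroup (cenmod G L (carrier G) (carrier G)) G"
      by (rule subgroup_cenmod_normal) (use norm subgroup_self in auto)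
    moreover have "L \<subseteq> cenmod G L (carrier G) (carrier G)"
      using commr_mem_normal[OF norm] by (auto simp: cenmod_def)
    moreover have "m \<in> cenmod G L (carrier G) (carrier G)" using m by (auto simp: cenmod_def)
    ultimately show ?thesis using max m(2) by blast
  qed
  then have comm: "commr G x y \<in> L" if "x \<in> carrier G" "y \<in> carrier G" for x y
    using that by (auto simp: cenmod_def)
  define D where "D = {x \<in> carrier G. x [^] p \<in> L}"
  have D: "subgroup D G" unfolding D_def
    by (rule subgroup_pow_mem) (use subgroup_self norm comm in auto)
  obtain n where n: "card (carrier G) = p ^ n" using p_group by (auto simp: p_group_def)
  have "m [^] (p ^ n) \<in> L"
    using pow_order_eq_1[OF m(1)] n by (simp add: order_def)
  \<comment> \<open>The order of \<open>m\<close> modulo \<open>L\<close> is p^j with j > 0. Its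
    power with exponent p^(j-1) is outside \<open>L\<close> but has its p-th power inside, so it
    separates \<open>D\<close> from \<open>L\<close>.\<close>
  define j where "j = (LEAST j. m [^] (p ^ j) \<in> L)"
  have j: "m [^] (p ^ j) \<in> L" unfolding j_def by (rule LeastI) fact
  have "j \<noteq> 0" using j m by (intro notI) simp
  then obtain i where i: "j = Suc i" by (cases j) auto
  have "m [^] (p ^ i) \<notin> L" using not_less_Least[of i "\<lambda>j. m [^] (p ^ j) \<in> L"] i by (simp add: j_def)
  moreover have "m [^] (p ^ i) \<in> D"
    using j m i by (simp add: D_def nat_pow_pow mult.commute)
  moreover have "L \<subseteq> D" using pow_mem[OF assms(1)] by (auto simp: D_def)
  ultimately have "D = carrier G" using max[OF D] by blast
  then show ?thesis using comm by (intro compow_subset[OF assms(1)]) (auto simp: D_def)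
qed

lemma exists_maximal:
  assumes "subgroup M G" "M \<noteq> carrier G"
  obtains L where "subgroup L G" "M \<subseteq> L" "L \<noteq> carrier G"
    "\<And>K. subgroup K G \<Longrightarrow> L \<subseteq> K \<Longrightarrow> K = L \<or> K = carrier G"
proof -
  let ?A = "{L. subgroup L G \<and> M \<subseteq> L \<and> L \<noteq> carrier G}"
  have "finite ?A"
    by (rule finite_subset[of _ "Pow (carrier G)"]) (auto dest: subgroup.subset)
  then obtain L where "L \<in> ?A" "M \<subseteq> L" "\<forall>K\<in>?A. L \<subseteq> K \<longrightarrow> L = K"
    using finite_has_maximal2[of ?A M] assms by auto
  then show ?thesis by (intro that[of L]) auto
qed

text \<open>A proper subgroup generated by \<open>A\<close> would lie in a maximal one, which also
  contains \<open>frat\<close>.\<close>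

lemma frat_nongenerating:
  assumes "A \<subseteq> carrier G" "carrier G \<subseteq> generate G (A \<union> frat G p (carrier G))"
  shows "generate G A = carrier G"
proof (rule ccontr)
  assume ne: "generate G A \<noteq> carrier G"
  obtain L where L: "subgroup L G" "generate G A \<subseteq> L" "L \<noteq> carrier G"
    "\<And>K. subgroup K G \<Longrightarrow> L \<subseteq> K \<Longrightarrow> K = L \<or> K = carrier G"
    using exists_maximal[OF generate_is_subgroup[OF assms(1)] ne] by blast
  have "frat G p (carrier G) \<subseteq> L" by (rule maximal_contains_frat) (use L in auto)
  moreover have "A \<subseteq> L" using L(2) generate.incl by (metis subset_iff)
  ultimately have "generate G (A \<union> frat G p (carrier G)) \<subseteq> L"
    by (intro generate_subgroup_incl[OF _ L(1)]) simp
  then show False using assms(2) L(3) subgroup.subset[OF L(1)] by blast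
qed

text \<open>A subgroup above \<open>frat\<close> is normal and contains all p-th powers, so the
  subgroup generated by \<open>N\<close> and \<open>x\<close> is covered by the p cosets of the
  powers of \<open>x\<close> with exponent below p.\<close>

lemma adjoin_mod_frat:
  assumes N: "subgroup N G" "frat G p (carrier G) \<subseteq> N" and x: "x \<in> carrier G"
  obtains N' where "subgroup N' G" "N \<subseteq> N'" "x \<in> N'" "card N' \<le> p * card N"
proof -
  interpret N: subgroup N G by (rule N(1))
  have comm: "commr G y z \<in> N" if "y \<in> carrier G" "z \<in> carrier G" for y z
    using commr_in_compow[OF that] N(2) by blast
  have norm: "N \<lhd> G"
  proof (rule normal_invI[OF N(1)])
    fix y h assume "y \<in> carrier G" "h \<in> N"
    then have "commr G (inv y) (inv h) \<otimes> h \<in> N" using comm[of "inv y" "inv h"] by simp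
    then show "y \<otimes> h \<otimes> inv y \<in> N"
      using \<open>y \<in> carrier G\<close> \<open>h \<in> N\<close> by (simp add: commr_def free_normalize)
  qed
  let ?N' = "N <#> generate G {x}"
  have gx: "subgroup (generate G {x}) G" using x by (intro generate_is_subgroup) simp
  have sub: "?N' \<subseteq> (\<Union>j<p. N #> x [^] j)"
  proof
    fix y assume "y \<in> ?N'"
    then obtain n i where n: "n \<in> N" and y: "y = n \<otimes> x [^] (i::int)"
      using generate_pow[OF x] by (auto simp: set_mult_def)
    define j where "j = nat (i mod int p)"
    have "i mod int p < int p" "i mod int p \<ge> 0" using p_gt_1 by auto
    then have jp: "j < p" and ij: "i = int p * (i div int p) + int j" by (auto simp: j_def)
    have "x [^] i = (x [^] p) [^] (i div int p) \<otimes> x [^] j"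
      using x by (subst ij) (simp add: int_pow_mult int_pow_pow[symmetric] int_pow_int)
    moreover have "(x [^] p) [^] (i div int p) \<in> N"
      by (rule subgroup_int_pow_closed[OF N(1)]) (use pow_in_compow[OF x] N(2) in blast)
    ultimately have "y = (n \<otimes> (x [^] p) [^] (i div int p)) \<otimes> x [^] j"
      "n \<otimes> (x [^] p) [^] (i div int p) \<in> N"
      using n x y by (auto simp: m_assoc)
    then show "y \<in> (\<Union>j<p. N #> x [^] j)" using jp by (auto simp: r_coset_def)
  qed
  show ?thesis
  proof (rule that[of ?N'])
    show "subgroup ?N' G" by (rule mult_norm_subgroup[OF norm gx])
    have mem: "n \<otimes> y \<in> ?N'" if "n \<in> N" "y \<in> generate G {x}" for n y
      using that by (auto simp: set_mult_def)
    show "N \<subseteq> ?N'"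
      using mem[OF _ generate.one] by auto
    show "x \<in> ?N'"
      using mem[OF N.one_closed generate.incl[of x]] x by simp
    have "card ?N' \<le> card (\<Union>j<p. N #> x [^] j)"
      by (rule card_mono) (use sub x N.subset in \<open>auto intro!: finite_subset[OF r_coset_subset_G finite_carrier]\<close>)
    also have "\<dots> \<le> (\<Sum>j<p. card (N #> x [^] j))" by (rule card_UN_le) simp
    also have "\<dots> = (\<Sum>j<p. card N)"
      using x N.subset by (intro sum.cong refl card_rcosets_equal[symmetric]) (auto intro: rcosetsI)
    finally show "card ?N' \<le> p * card N" by simp
  qed
qed

lemma card_le_of_generators:
  assumes "finite A" "A \<subseteq> carrier G"
  obtains N where "subgroup N G" "frat G p (carrier G) \<subseteq> N" "A \<subseteq> N"
    "card N \<le> p ^ card A * card (frat G p (carrier G))"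
  using assms
proof (induction A arbitrary: thesis rule: finite_induct)
  case empty
  show ?case by (rule empty(1)[of "frat G p (carrier G)"]) (auto intro: subgroup_compow)
next
  case (insert x A)
  obtain N where N: "subgroup N G" "frat G p (carrier G) \<subseteq> N" "A \<subseteq> N"
    "card N \<le> p ^ card A * card (frat G p (carrier G))"
    using insert by auto
  obtain N' where N': "subgroup N' G" "N \<subseteq> N'" "x \<in> N'" "card N' \<le> p * card N"
    using adjoin_mod_frat[OF N(1,2), of x] insert.prems by auto
  have "card N' \<le> p * (p ^ card A * card (frat G p (carrier G)))"
    using N'(4) N(4) by (meson le_trans mult_le_mono2)
  then show ?case
    using N N' insert.hyps by (intro insert.prems(1)[of N']) (auto simp: mult.assoc)
qed

text \<open>One half of Burnside's basis theorem: the subgroup given by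
  \<open>card_le_of_generators\<close> contains the generators and is therefore everything.\<close>

lemma card_le_power_rank:
  assumes "finite A" "A \<subseteq> carrier G" "generate G A = carrier G"
  shows "card (carrier G) \<le> p ^ card A * card (frat G p (carrier G))"
proof -
  obtain N where N: "subgroup N G" "A \<subseteq> N" "card N \<le> p ^ card A * card (frat G p (carrier G))"
    using card_le_of_generators[OF assms(1,2)] .
  then have "N = carrier G"
    using assms(3) generate_subgroup_incl[OF N(2,1)] subgroup.subset[OF N(1)] by blast
  then show ?thesis using N by simp
qed

lemma grank_generators:
  obtains A where "A \<subseteq> carrier G" "finite A" "card A = grank G (carrier G)" "generate G A = carrier G"
proof -
  have "\<exists>n A. A \<subseteq> carrier G \<and> finite A \<and> card A = n \<and> generate G A = carrier G"
    using generate_subgroup_incl[OF _ subgroup_self] generate.incl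
    by (intro exI[of _ "card (carrier G)"] exI[of _ "carrier G"]) (auto intro: generate.incl)
  from LeastI_ex[OF this] show ?thesis
    using that unfolding grank_def by blast
qed

lemma grank_le:
  assumes "A \<subseteq> carrier G" "finite A" "generate G A = carrier G"
  shows "grank G (carrier G) \<le> card A"
  unfolding grank_def by (rule Least_le) (use assms in auto)

lemma card_le_grank: "card (carrier G) \<le> p ^ grank G (carrier G) * card (frat G p (carrier G))"
proof -
  obtain A where "A \<subseteq> carrier G" "finite A" "card A = grank G (carrier G)" "generate G A = carrier G"
    using grank_generators .
  then show ?thesis using card_le_power_rank[of A] by simp
qed

lemma subgroup_frattini: "subgroup (frattini G (carrier G)) G"
proof -
  have "frattini G (carrier G) = \<Inter> (insert (carrier G) {M. maximal_subgroup G (carrier G) M})"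
    by (auto simp: frattini_def)
  moreover have "subgroup \<dots> G"
    by (rule subgroups_Inter) (auto simp: maximal_subgroup_def subgroup_self)
  ultimately show ?thesis by simp
qed

text \<open>A squeeze of orders: \<open>frat\<close> lies in \<open>frattini\<close> and has index
  at most p^2 by the rank, while \<open>frattini\<close> has index at least p^2, since a smaller
  index would let one element generate the group.\<close>

lemma frattini_rank_2:
  assumes "grank G (carrier G) = 2"
  shows "frattini G (carrier G) = frat G p (carrier G)"
    and "card (carrier G) = p\<^sup>2 * card (frat G p (carrier G))"
proof -
  let ?\<Phi> = "frattini G (carrier G)" and ?R = "frat G p (carrier G)"
  have sub: "?R \<subseteq> ?\<Phi>"
  proof -
    have "?R \<subseteq> M" if "maximal_subgroup G (carrier G) M" for M
      using that subgroup.subset unfolding maximal_subgroup_def by (intro maximal_contains_frat) blast+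
    then show ?thesis using frat_subset[OF subgroup_self] by (auto simp: frattini_def)
  qed
  have upper: "card (carrier G) \<le> p\<^sup>2 * card ?R" using card_le_grank assms by simp
  have large: "\<not> card (carrier G) \<le> p * card ?\<Phi>"
  proof
    assume small: "card (carrier G) \<le> p * card ?\<Phi>"
    have "\<exists>A. A \<subseteq> carrier G \<and> finite A \<and> card A \<le> 1 \<and> generate G A = carrier G"
    proof (cases "?\<Phi> = carrier G")
      case True
      have "generate G {} = carrier G"
      proof (rule ccontr)
        assume ne: "generate G {} \<noteq> carrier G"
        obtain L where L: "subgroup L G" "L \<noteq> carrier G"
          "\<And>K. subgroup K G \<Longrightarrow> L \<subseteq> K \<Longrightarrow> K = L \<or> K = carrier G"
          using exists_maximal[OF generate_is_subgroup ne] by (metis empty_subsetI)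
        then have "maximal_subgroup G (carrier G) L"
          using subgroup.subset[OF L(1)] by (auto simp: maximal_subgroup_def)
        then show False using True L subgroup.subset[OF L(1)] by (auto simp: frattini_def)
      qed
      then show ?thesis by (intro exI[of _ "{}"]) simp
    next
      case False
      then obtain x where x: "x \<in> carrier G" "x \<notin> ?\<Phi>" by (auto simp: frattini_def)
      have "generate G {x} = carrier G"
      proof (rule ccontr)
        assume ne: "generate G {x} \<noteq> carrier G"
        obtain L where L: "subgroup L G" "generate G {x} \<subseteq> L" "L \<noteq> carrier G"
          "\<And>K. subgroup K G \<Longrightarrow> L \<subseteq> K \<Longrightarrow> K = L \<or> K = carrier G"
          using exists_maximal[OF generate_is_subgroup ne] x by auto
        then have "maximal_subgroup G (carrier G) L"
          using subgroup.subset[OF L(1)] by (auto simp: maximal_subgroup_def)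
        then have "?\<Phi> \<subseteq> L" by (auto simp: frattini_def)
        moreover have "x \<in> L" using L(2) generate.incl[of x "{x}" G] by blast
        ultimately have "L = carrier G"
          using x by (intro subgroup_eq_of_index_p[OF subgroup_frattini L(1) subgroup_self _ _ small])
            (auto dest: subgroup.mem_carrier[OF L(1)])
        then show False using L by simp
      qed
      then show ?thesis using x by (intro exI[of _ "{x}"]) simp
    qed
    then obtain A where "A \<subseteq> carrier G" "finite A" "card A \<le> 1" "generate G A = carrier G" by blast
    then show False using grank_le[of A] assms by simp
  qed
  obtain k l where kl: "card (carrier G) = p ^ k" "card ?\<Phi> = p ^ l"
    using card_subgroup_power[OF subgroup_self] card_subgroup_power[OF subgroup_frattini] by metis
  have "\<not> k \<le> Suc l"
    using large kl power_increasing[of k "Suc l" p] p_gt_1 by auto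
  then have "p ^ (2 + l) \<le> p ^ k" using p_gt_1 by (intro power_increasing) auto
  then have lower: "p\<^sup>2 * card ?\<Phi> \<le> card (carrier G)" using kl by (simp add: power2_eq_square mult.assoc)
  have "card ?R \<le> card ?\<Phi>" using sub finite_subgroup[OF subgroup_frattini] by (rule card_mono[rotated])
  moreover have "card ?\<Phi> \<le> card ?R"
  proof -
    have "p\<^sup>2 * card ?\<Phi> \<le> p\<^sup>2 * card ?R" using lower upper by linarith
    then show ?thesis using p_gt_1 by simp
  qed
  ultimately have eq: "card ?R = card ?\<Phi>" by simp
  show "?\<Phi> = ?R" using card_subset_eq[OF finite_subgroup[OF subgroup_frattini] sub eq] by simp
  show "card (carrier G) = p\<^sup>2 * card ?R" using lower upper eq by simp
qed

end

subsection \<open>A maximal subgroup with an irreducible Frattini quotient\<close>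

text \<open>Here c = [e, f] and k = [e, f, f]. One more conjugation by \<open>f\<close> sends
  \<open>c [^] n\<close> to \<open>c [^] n \<otimes> k [^] n\<close>, which raises the exponent of
  \<open>k\<close> from n choose 2 to n + 1 choose 2.\<close>

lemma (in group) conj_by_pow:
  assumes [simp]: "e \<in> carrier G" "c \<in> carrier G" "k \<in> carrier G" "f \<in> carrier G"
    and e: "inv f \<otimes> e \<otimes> f = e \<otimes> c" and c: "inv f \<otimes> c \<otimes> f = c \<otimes> k"
    and k: "inv f \<otimes> k \<otimes> f = k" and ck: "c \<otimes> k = k \<otimes> c"
  shows "inv (f [^] (n::nat)) \<otimes> e \<otimes> f [^] n = e \<otimes> c [^] n \<otimes> k [^] (n choose 2)"
proof (induction n)
  case (Suc n)
  have cn: "inv f \<otimes> c [^] n \<otimes> f = c [^] n \<otimes> k [^] n"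
    using pow_conj[of "inv f" c n] c pow_mult_distrib[OF ck] by simp
  have kn: "inv f \<otimes> k [^] m \<otimes> f = k [^] m" for m :: nat
    using pow_conj[of "inv f" k m] k by simp
  have "inv (f [^] Suc n) \<otimes> e \<otimes> f [^] Suc n = inv f \<otimes> (inv (f [^] n) \<otimes> e \<otimes> f [^] n) \<otimes> f"
    by (simp add: free_normalize)
  also have "\<dots> = (inv f \<otimes> e \<otimes> f) \<otimes> (inv f \<otimes> c [^] n \<otimes> f) \<otimes> (inv f \<otimes> k [^] (n choose 2) \<otimes> f)"
    unfolding Suc by (simp add: free_normalize)
  also have "\<dots> = e \<otimes> (c \<otimes> c [^] n) \<otimes> (k [^] n \<otimes> k [^] (n choose 2))"
    unfolding e cn kn by (simp add: m_assoc)
  also have "c \<otimes> c [^] n = c [^] Suc n"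
    using pow_comm_commute[of c c n] by simp
  also have "k [^] n \<otimes> k [^] (n choose 2) = k [^] (Suc n choose 2)"
    by (simp add: nat_pow_mult numeral_2_eq_2)
  finally show ?case .
qed (simp add: numeral_2_eq_2)

lemma (in normal) coset_eq_mem:
  assumes "x \<in> carrier G" "y \<in> carrier G" "H #> x = H #> y" "subgroup L G" "H \<subseteq> L" "y \<in> L"
  shows "x \<in> L"
proof -
  have "x \<in> H #> y" using rcos_self[OF assms(1) subgroup_axioms] assms(3) by simp
  then show ?thesis using assms(4,5,6) subgroup.m_closed[OF assms(4)] by (auto simp: r_coset_def)
qed

context finite_p_group
begin

text \<open>Conjugating u^n by \<open>f\<close> gives (u [u, f])^n, and modulo \<open>N\<close> the
  two factors commute, so the power splits.\<close>

lemma coset_commr_pow: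
  assumes "N \<lhd> G" "u \<in> carrier G" "f \<in> carrier G" "commr G u (commr G u f) \<in> N"
  shows "N #> commr G (u [^] (n::nat)) f = N #> commr G u f [^] n"
proof -
  interpret N: normal N G by fact
  interpret q: group_hom G "G Mod N" "\<lambda>x. N #> x" by (rule N.group_hom_Mod)
  let ?q = "\<lambda>x. N #> x" and ?c = "commr G u f"
  note [simp] = assms(2,3)
  have "?q (commr G u ?c) = \<one>\<^bsub>G Mod N\<^esub>" using assms N.coset_eq_one_iff by simp
  then have "commr (G Mod N) (?q u) (?q ?c) = \<one>\<^bsub>G Mod N\<^esub>" using q.hom_commr by simp
  then have com: "?q u \<otimes>\<^bsub>G Mod N\<^esub> ?q ?c = ?q ?c \<otimes>\<^bsub>G Mod N\<^esub> ?q u"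
    using q.H.commr_eq_one_iff by simp
  have "u [^] n \<otimes> commr G (u [^] n) f = inv f \<otimes> u [^] n \<otimes> f"
    by (simp add: commr_def free_normalize)
  also have "\<dots> = (u \<otimes> ?c) [^] n"
    using pow_conj[of "inv f" u n] by (simp add: commr_def free_normalize)
  finally have "?q (u [^] n \<otimes> commr G (u [^] n) f) = ?q ((u \<otimes> ?c) [^] n)" by simp
  then have "?q (u [^] n) \<otimes>\<^bsub>G Mod N\<^esub> ?q (commr G (u [^] n) f) = (?q u \<otimes>\<^bsub>G Mod N\<^esub> ?q ?c) [^]\<^bsub>G Mod N\<^esub> n"
    by (simp only: q.hom_nat_pow q.hom_mult nat_pow_closed commr_closed m_closed assms(2,3))
  also have "\<dots> = ?q (u [^] n) \<otimes>\<^bsub>G Mod N\<^esub> ?q (?c [^] n)"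
    using q.H.pow_mult_distrib[OF com, of n] by (simp only: q.hom_nat_pow q.hom_closed commr_closed assms(2,3))
  finally show ?thesis
    by (simp only: q.H.l_cancel q.hom_closed nat_pow_closed commr_closed assms(2,3))
qed

text \<open>The relative form of the fact that groups of order p^2 are abelian: by
  \<open>card_centralizer_mod\<close> the centre modulo \<open>N\<close> has index at most p in
  \<open>M\<close>, so \<open>M\<close> is generated over it by one element.\<close>

lemma commr_of_index_p2:
  assumes "N \<lhd> G" "M \<lhd> G" "N \<subseteq> M" "card M \<le> p\<^sup>2 * card N" "x \<in> M" "y \<in> M"
  shows "commr G x y \<in> N"
proof -
  interpret N: normal N G by fact
  interpret M: normal M G by fact
  define C where "C = cenmod G N M M"
  have C: "subgroup C G" unfolding C_def
    by (rule subgroup_cenmod_normal) (use assms M.subgroup_axioms in auto)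
  have cM: "card M \<le> p * card C"
    unfolding C_def by (rule card_centralizer_mod) (use assms M.subgroup_axioms in auto)
  have "C = M"
  proof (rule ccontr)
    assume "C \<noteq> M"
    then obtain e where e: "e \<in> M" "e \<notin> C" by (auto simp: C_def cenmod_def)
    define L where "L = cenmod G N M {e}"
    have L: "subgroup L G" unfolding L_def
      by (rule subgroup_cenmod_normal) (use assms e M.subgroup_axioms in auto)
    have "C \<subseteq> L" using e by (auto simp: C_def L_def cenmod_def)
    moreover have "e \<in> L" using e by (auto simp: L_def cenmod_def commr_self)
    ultimately have "L = M"
      using e by (intro subgroup_eq_of_index_p[OF C L M.subgroup_axioms _ _ cM]) (auto simp: L_def cenmod_def)
    then have "commr G z e \<in> N" if "z \<in> M" for z using that by (auto simp: L_def cenmod_def)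
    then have "commr G e z \<in> N" if "z \<in> M" for z
      using that commr_mem_iff[OF N.subgroup_axioms, of z e] e by simp
    then show False using e by (auto simp: C_def cenmod_def)
  qed
  then show ?thesis using assms by (auto simp: C_def cenmod_def)
qed

lemma pow_of_index_p:
  assumes "N \<lhd> G" "card (carrier G) = p * card N" "x \<in> carrier G"
  shows "x [^] p \<in> N"
proof -
  interpret N: normal N G by fact
  interpret q: group "G Mod N" by (rule N.factorgroup_is_group)
  have "card (rcosets N) * card N = p * card N"
    using lagrange[OF N.subgroup_axioms] assms by (simp add: order_def)
  then have "order (G Mod N) = p"
    using subgroup_card_pos[OF N.subgroup_axioms] by (simp add: order_def FactGroup_def)
  then have "(N #> x) [^]\<^bsub>G Mod N\<^esub> p = \<one>\<^bsub>G Mod N\<^esub>"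
    using q.pow_order_eq_1[of "N #> x"] assms by (auto simp: FactGroup_def RCOSETS_def)
  then show ?thesis using N.FactGroup_pow[OF assms(3)] N.coset_eq_one_iff[of "x [^] p"] assms by simp
qed

end

text \<open>\<open>G\<close> stands for the normalizer of \<open>E\<close>, and \<open>A\<close> for
  the automorphisms of \<open>E\<close> in the fusion system; \<open>\<alpha>\<close> is any
  automorphism of \<open>G\<close>. The rank of the Frattini subgroup of \<open>E\<close> enters as
  the index bound \<open>card_frat\<close>. The contradictions in \<open>Q2_eq_Q\<close>,
  \<open>no_central_chain\<close> and \<open>pow_E_in_R\<close> are all reached at
  \<open>nontriv\<close>.\<close>

locale irreducible_pair = finite_p_group +
  fixes E :: "'a set" and A :: "('a \<Rightarrow> 'a) set" and \<alpha> :: "'a \<Rightarrow> 'a" and a b :: 'a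
  assumes E: "E \<lhd> G" and card_G: "card (carrier G) = p * card E"
    and card_E: "card E = p\<^sup>2 * card (frat G p E)"
    and ab: "a \<in> E" "b \<in> E" "generate G {a, b} = E"
    and A: "\<And>\<phi>. \<phi> \<in> A \<Longrightarrow> sub_aut G E \<phi>"
    and irr: "\<And>B. subgroup B G \<Longrightarrow> frat G p E \<subseteq> B \<Longrightarrow> B \<subseteq> E \<Longrightarrow> (\<And>\<phi>. \<phi> \<in> A \<Longrightarrow> \<phi> ` B = B) \<Longrightarrow>
      B = frat G p E \<or> B = E"
    and nontriv: "\<exists>e\<in>E. \<exists>t\<in>carrier G. commr G e t \<notin> frat G p E"
    and \<alpha>: "sub_aut G (carrier G) \<alpha>" and \<alpha>E: "\<alpha> ` E \<noteq> E"
    and card_frat: "card (frat G p E) \<le> p ^ 3 * card (frat G p (frat G p E))"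
begin

abbreviation "Q \<equiv> frat G p E"
abbreviation "E2 \<equiv> \<alpha> ` E"
abbreviation "Q2 \<equiv> frat G p E2"

lemma E_subgroup: "subgroup E G" and E_carrier: "E \<subseteq> carrier G"
  using E normal_imp_subgroup subgroup.subset by blast+

lemma Q_normal: "Q \<lhd> G" using E by (intro normal_compow)
lemma Q_subgroup: "subgroup Q G" using Q_normal by (rule normal_imp_subgroup)
lemma Q_sub_E: "Q \<subseteq> E" by (rule frat_subset[OF E_subgroup])

lemma E2_normal: "E2 \<lhd> G" by (rule sub_aut_image_normal[OF \<alpha> E])
lemma E2_subgroup: "subgroup E2 G" using E2_normal by (rule normal_imp_subgroup)
lemma card_E2: "card E2 = card E" by (rule sub_aut_card_image[OF \<alpha> E_carrier])

lemma Q2_eq: "\<alpha> ` Q = Q2"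
  by (rule sub_aut_image_compow[OF subgroup_self \<alpha> E_carrier E_carrier])
lemma Q2_normal: "Q2 \<lhd> G" using E2_normal by (intro normal_compow)
lemma Q2_subgroup: "subgroup Q2 G" using Q2_normal by (rule normal_imp_subgroup)
lemma card_Q2: "card Q2 = card Q"
  unfolding Q2_eq[symmetric] using Q_sub_E E_carrier by (intro sub_aut_card_image[OF \<alpha>]) auto

lemma elem_carrier [simp]: "x \<in> E \<Longrightarrow> x \<in> carrier G" "x \<in> E2 \<Longrightarrow> x \<in> carrier G" "x \<in> Q \<Longrightarrow> x \<in> carrier G"
  using E_carrier E2_subgroup Q_sub_E subgroup.subset by blast+

lemma A_image:
  assumes "\<phi> \<in> A"
  shows "\<phi> ` E = E" "\<phi> ` Q = Q"
proof -
  show 1: "\<phi> ` E = E" using A[OF assms] by (auto simp: sub_aut_def bij_betw_def)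
  show "\<phi> ` Q = Q"
    using sub_aut_image_compow[OF E_subgroup A[OF assms], of E E] 1 by simp
qed

lemma generated_by_E_E2:
  assumes "subgroup L G" "E \<subseteq> L" "E2 \<subseteq> L"
  shows "L = carrier G"
proof (rule subgroup_eq_of_index_p[OF E_subgroup assms(1) subgroup_self])
  have "\<not> E2 \<subseteq> E"
    using card_subset_eq[OF finite_subgroup[OF E_subgroup], of E2] card_E2 \<alpha>E by blast
  then show "E \<subset> L" using assms by blast
qed (use assms card_G subgroup.subset[OF assms(1)] in auto)

text \<open>The quotient by \<open>E\<close> has order p, so \<open>E\<close> contains all
  commutators and p-th powers of \<open>G\<close>, in particular those of \<open>E2\<close>. The
  lemma after this one exchanges the roles.\<close>

lemma Q2_sub_E: "Q2 \<subseteq> E"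
proof (rule compow_subset[OF E_subgroup])
  show "commr G x y \<in> E" if "x \<in> E2" "y \<in> E2" for x y
    by (rule commr_of_index_p[OF E normal_self]) (use that E_carrier card_G in auto)
  show "x [^] p \<in> E" if "x \<in> E2" for x
    by (rule pow_of_index_p[OF E card_G]) (use that in auto)
qed

lemma Q_sub_E2: "Q \<subseteq> E2"
proof (rule compow_subset[OF E2_subgroup])
  show "commr G x y \<in> E2" if "x \<in> E" "y \<in> E" for x y
    by (rule commr_of_index_p[OF E2_normal normal_self])
      (use that subgroup.subset[OF E2_subgroup] card_G card_E2 in auto)
  show "x [^] p \<in> E2" if "x \<in> E" for x
    by (rule pow_of_index_p[OF E2_normal]) (use that card_G card_E2 in auto)
qed

section \<open>Invariance of the Frattini subgroup of \<open>E\<close> under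
  \<open>\<alpha>\<close>\<close>

lemma Q2_eq_Q: "Q2 = Q"
proof (rule ccontr)
  assume neq: "Q2 \<noteq> Q"
  have notsub: "\<not> Q \<subseteq> Q2" "\<not> Q2 \<subseteq> Q"
    using neq card_subset_eq[OF finite_subgroup[OF Q2_subgroup], of Q]
      card_subset_eq[OF finite_subgroup[OF Q_subgroup], of Q2] card_Q2 by auto
  \<comment> \<open>\<open>Q2\<close> is normal of index p^2 in \<open>E\<close>, so the quotient is
    abelian; likewise for \<open>Q\<close> in \<open>E2\<close>.\<close>
  have commE: "commr G x y \<in> Q2" if "x \<in> E" "y \<in> E" for x y
    by (rule commr_of_index_p2[OF Q2_normal E Q2_sub_E]) (use that card_E card_Q2 in auto)
  have commE2: "commr G x y \<in> Q" if "x \<in> E2" "y \<in> E2" for x y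
    by (rule commr_of_index_p2[OF Q_normal E2_normal Q_sub_E2]) (use that card_E card_E2 in auto)
  \<comment> \<open>W = [E, E] Q^p lies in \<open>Q\<close> and in \<open>Q2\<close>, and
    \<open>E/W\<close> is abelian. The computations below take place modulo
    \<open>W\<close>.\<close>
  define W where "W = compow G p E Q"
  have W: "W \<lhd> G" unfolding W_def by (rule normal_compow[OF E Q_normal])
  have Ws: "subgroup W G" using W by (rule normal_imp_subgroup)
  have WQ2: "W \<subseteq> Q2"
    unfolding W_def by (rule compow_subset[OF Q2_subgroup commE]) (use Q_sub_E2 in \<open>auto intro: pow_in_compow\<close>)
  have WQ: "W \<subseteq> Q"
    unfolding W_def by (rule compow_subset[OF Q_subgroup])
      (use Q_sub_E in \<open>auto intro: commr_in_compow pow_in_compow\<close>)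
  have commW: "commr G x y \<in> W" if "x \<in> E" "y \<in> E" for x y
    unfolding W_def using that by (rule commr_in_compow)
  have powW: "x [^] p \<in> W" if "x \<in> Q" for x
    unfolding W_def using that by (rule pow_in_compow)
  \<comment> \<open>The p-power map embeds \<open>E/Q\<close> into \<open>E/W\<close>: its kernel is
    invariant, and if the kernel were \<open>E\<close>, then E^p and [E, E] would lie in
    \<open>Q2\<close>, hence so would \<open>Q\<close>.\<close>
  have powW_imp: "x \<in> Q" if "x \<in> E" "x [^] p \<in> W" for x
  proof -
    let ?B = "{x \<in> E. x [^] p \<in> W}"
    have "?B = Q \<or> ?B = E"
    proof (rule irr)
      show "subgroup ?B G" by (rule subgroup_pow_mem[OF E_subgroup W commW])
      show "\<phi> ` ?B = ?B" if "\<phi> \<in> A" for \<phi>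
      proof -
        have "\<phi> ` W = W"
          unfolding W_def using sub_aut_image_compow[OF E_subgroup A[OF that], of E Q] A_image[OF that] Q_sub_E
          by simp
        then show ?thesis
          using sub_aut_image_pow_mem[OF E_subgroup A[OF that], of W E p] A_image[OF that] WQ Q_sub_E by simp
      qed
    qed (use Q_sub_E powW in auto)
    moreover have "?B \<noteq> E"
    proof
      assume "?B = E"
      then have "Q \<subseteq> Q2"
        using WQ2 commE by (intro compow_subset[OF Q2_subgroup]) auto
      then show False using notsub by blast
    qed
    ultimately show ?thesis using that by blast
  qed
  \<comment> \<open>\<open>Q2\<close> is generated by commutators of \<open>E2\<close>, which lie in
    \<open>Q\<close>, and by p-th powers of elements of \<open>E2\<close>; since \<open>Q2\<close>
    is not inside \<open>Q\<close>, some power escapes.\<close>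
  have "\<exists>f\<in>E2. f [^] p \<notin> Q"
    using notsub compow_subset[OF Q_subgroup, of E2 E2 p] commE2 by blast
  then obtain f where f: "f \<in> E2" "f [^] p \<notin> Q" by blast
  then have fE: "f \<notin> E" using pow_in_compow[of f E p E] by blast
  define d where "d = f [^] p"
  have fc: "f \<in> carrier G" using f by simp
  define D where "D = E \<inter> E2"
  have D: "D \<lhd> G" unfolding D_def by (rule normal_subgroup_intersect[OF E E2_normal])
  have Ds: "subgroup D G" using D by (rule normal_imp_subgroup)
  have dD: "d \<in> D"
    unfolding D_def d_def using pow_of_index_p[OF E card_G fc] pow_mem[OF E2_subgroup f(1)] by simp
  have QD: "Q \<subseteq> D" unfolding D_def using Q_sub_E Q_sub_E2 by blast
  have cD: "card D \<le> p * card Q"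
  proof -
    have "D \<noteq> E"
    proof
      assume "D = E"
      then have "E \<subseteq> E2" unfolding D_def by blast
      then show False
        using card_subset_eq[OF finite_subgroup[OF E2_subgroup], of E] card_E2 \<alpha>E by simp
    qed
    then have "p * card D \<le> card E"
      by (intro subgroup_card_step[OF Ds E_subgroup]) (auto simp: D_def)
    then have "p * card D \<le> p * (p * card Q)"
      unfolding card_E by (simp add: power2_eq_square mult.assoc)
    then show ?thesis using p_gt_1 by simp
  qed
  \<comment> \<open>\<open>D/Q\<close> has order at most p and \<open>d\<close> lies outside
    \<open>Q\<close>, so \<open>D\<close> is generated by \<open>Q\<close> and
    \<open>d\<close>.\<close>
  have DL: "D \<subseteq> L" if "subgroup L G" "Q \<subseteq> L" "d \<in> L" for L
  proof -
    have "L \<inter> D = D"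
      by (rule subgroup_eq_of_index_p[OF Q_subgroup subgroups_Inter_pair[OF that(1) Ds] Ds _ _ cD])
        (use that QD dD f in \<open>auto simp: d_def\<close>)
    then show ?thesis by blast
  qed
  have commD: "commr G u f \<in> D" if "u \<in> E" for u
    unfolding D_def using commr_mem_normal[OF E that fc] commr_mem_normal[OF E2_normal f(1), of u] that by simp
  have commDQ: "commr G u f \<in> Q" if "u \<in> D" for u
    by (rule commr_of_index_p[OF Q_normal D QD cD that fc])
  have DE: "D \<subseteq> E" by (simp add: D_def)
  \<comment> \<open>\<open>A0\<close> and \<open>Z\<close> encode the claim [D, f, f] \<le> W
    together with [D, f] \<le> Q. As [E, f] \<le> D, it makes k = [e, f, f] an element of
    \<open>Q\<close> fixed by \<open>f\<close> modulo \<open>W\<close>, as the expansion of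
    \<open>conj_by_pow\<close> requires.\<close>
  define A0 where "A0 = cenmod G W Q {f}"
  have A0: "subgroup A0 G" unfolding A0_def
    by (rule subgroup_cenmod_normal[OF Q_subgroup W]) (use fc in auto)
  have WA0: "W \<subseteq> A0" unfolding A0_def cenmod_def using WQ commr_mem_normal(1)[OF W _ fc] by auto
  have A0Q: "A0 \<subseteq> Q" by (auto simp: A0_def cenmod_def)
  \<comment> \<open>In the abelian group \<open>E/W\<close> the commutator with \<open>f\<close> is
    additive, so [u^p, f] = [u, f]^p. This is used with \<open>W\<close> and with \<open>A0\<close>
    for \<open>L\<close>.\<close>
  have powf: "commr G (u [^] p) f \<in> L"
    if "u \<in> E" "subgroup L G" "W \<subseteq> L" "commr G u f [^] p \<in> L" for u L
  proof (rule normal.coset_eq_mem[OF W _ _ _ that(2-4)])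
    show "W #> commr G (u [^] p) f = W #> commr G u f [^] p"
      by (rule coset_commr_pow[OF W _ fc]) (use that commW[OF that(1) subsetD[OF DE commD[OF that(1)]]] in auto)
  qed (use that fc in auto)
  define Z where "Z = cenmod G A0 E {f}"
  have Z: "subgroup Z G" unfolding Z_def
  proof (rule subgroup_cenmod[OF E_subgroup A0])
    fix m n assume mn: "m \<in> E" "n \<in> A0"
    then have "n \<otimes> commr G n m \<in> A0"
      using commW[of n m] WA0 A0Q Q_sub_E subgroup.m_closed[OF A0] by blast
    moreover have "n \<in> carrier G" using mn A0Q by auto
    ultimately show "inv m \<otimes> n \<otimes> m \<in> A0" using mn by (simp add: commr_def free_normalize)
  qed (use fc in auto)
  \<comment> \<open>Commutators of \<open>E\<close> already lie in \<open>W\<close>. For x^p, one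
    commutator with \<open>f\<close> gives [x, f]^p modulo \<open>W\<close>, and a second one gives
    [x, f, f]^p, the p-th power of an element of \<open>Q\<close>, which lies in
    \<open>W\<close>.\<close>
  have "Q \<subseteq> Z"
  proof (rule compow_subset[OF Z])
    fix x y assume xy: "x \<in> E" "y \<in> E"
    then show "commr G x y \<in> Z"
      using commr_mem_normal(1)[OF W commW[OF xy] fc] WA0 commr_mem[OF E_subgroup xy]
      by (auto simp: Z_def cenmod_def)
  next
    fix x assume x: "x \<in> E"
    have d': "commr G x f \<in> D" by (rule commD[OF x])
    have "commr G (commr G x f [^] p) f \<in> W"
      by (rule powf) (use d' DE commDQ powW Ws in auto)
    then have "commr G x f [^] p \<in> A0"
      using d' DE by (auto simp: A0_def cenmod_def intro: pow_in_compow)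
    then have "commr G (x [^] p) f \<in> A0" by (intro powf x A0 WA0)
    then show "x [^] p \<in> Z" using pow_mem[OF E_subgroup x] by (auto simp: Z_def cenmod_def)
  qed
  \<comment> \<open>\<open>d\<close> is a power of \<open>f\<close> and commutes with it.\<close>
  moreover have "d \<in> Z"
  proof -
    have "commr G d f = \<one>"
      unfolding d_def using fc pow_comm_commute[of f f p] by (simp add: commr_eq_one_iff)
    then show ?thesis using dD DE subgroup.one_closed[OF A0] by (auto simp: Z_def cenmod_def)
  qed
  ultimately have DZ: "D \<subseteq> Z" by (rule DL[OF Z])
  have commQ: "commr G e f \<in> Q" if e: "e \<in> E" for e
  proof -
    define c where "c = commr G e f"
    define k where "k = commr G c f"
    have c: "c \<in> D" unfolding c_def by (rule commD[OF e])
    then have kA0: "k \<in> A0" using DZ by (auto simp: k_def Z_def cenmod_def)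
    then have kQ: "k \<in> Q" and kf: "commr G k f \<in> W" by (auto simp: A0_def cenmod_def)
    have cE: "c \<in> E" using c DE by blast
    have kE: "k \<in> E" using kQ Q_sub_E by blast
    note carr [simp] = elem_carrier(1)[OF e] elem_carrier(1)[OF cE] elem_carrier(1)[OF kE] fc
    interpret W: normal W G by (rule W)
    interpret q: group_hom G "G Mod W" "\<lambda>x. W #> x" by (rule W.group_hom_Mod)
    let ?q = "\<lambda>x. W #> x"
    let ?G = "G Mod W"
    have q1: "?q x = \<one>\<^bsub>?G\<^esub>" if "x \<in> W" for x
      using that W.coset_eq_one_iff[of x] by simp
    have one: "?q f [^]\<^bsub>?G\<^esub> p = ?q d" using q.hom_nat_pow[OF fc, of p] by (simp add: d_def)
    have e1: "inv\<^bsub>?G\<^esub> (?q f) \<otimes>\<^bsub>?G\<^esub> ?q e \<otimes>\<^bsub>?G\<^esub> ?q f = ?q e \<otimes>\<^bsub>?G\<^esub> ?q c"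
    proof -
      have "inv f \<otimes> e \<otimes> f = e \<otimes> c" by (simp add: c_def commr_def free_normalize)
      then have "?q (inv f \<otimes> e \<otimes> f) = ?q (e \<otimes> c)" by simp
      then show ?thesis by (simp only: q.hom_mult q.hom_inv m_closed inv_closed carr)
    qed
    have c1: "inv\<^bsub>?G\<^esub> (?q f) \<otimes>\<^bsub>?G\<^esub> ?q c \<otimes>\<^bsub>?G\<^esub> ?q f = ?q c \<otimes>\<^bsub>?G\<^esub> ?q k"
    proof -
      have "inv f \<otimes> c \<otimes> f = c \<otimes> k" by (simp add: k_def commr_def free_normalize)
      then have "?q (inv f \<otimes> c \<otimes> f) = ?q (c \<otimes> k)" by simp
      then show ?thesis by (simp only: q.hom_mult q.hom_inv m_closed inv_closed carr)
    qed
    have k1: "inv\<^bsub>?G\<^esub> (?q f) \<otimes>\<^bsub>?G\<^esub> ?q k \<otimes>\<^bsub>?G\<^esub> ?q f = ?q k"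
    proof -
      have "inv f \<otimes> k \<otimes> f = k \<otimes> commr G k f" by (simp add: commr_def free_normalize)
      then have "?q (inv f \<otimes> k \<otimes> f) = ?q (k \<otimes> commr G k f)" by simp
      then have "inv\<^bsub>?G\<^esub> (?q f) \<otimes>\<^bsub>?G\<^esub> ?q k \<otimes>\<^bsub>?G\<^esub> ?q f = ?q k \<otimes>\<^bsub>?G\<^esub> \<one>\<^bsub>?G\<^esub>"
        by (simp only: q.hom_mult q.hom_inv m_closed inv_closed commr_closed carr q1[OF kf])
      then show ?thesis by (simp only: q.H.r_one q.hom_closed carr)
    qed
    have comq: "?q x \<otimes>\<^bsub>?G\<^esub> ?q y = ?q y \<otimes>\<^bsub>?G\<^esub> ?q x" if "x \<in> E" "y \<in> E" for x y
    proof -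
      have "commr ?G (?q x) (?q y) = \<one>\<^bsub>?G\<^esub>"
        using q.hom_commr[of x y] q1[OF commW[OF that]] that by simp
      then show ?thesis using q.H.commr_eq_one_iff[of "?q x" "?q y"] that by simp
    qed
    have dE: "d \<in> E" using dD DE by blast
    \<comment> \<open>Conjugation by d = f^p is computed twice. It is trivial because
      \<open>d\<close> and \<open>e\<close> lie in \<open>E\<close>, which is abelian modulo
      \<open>W\<close>; in the expansion the \<open>k\<close>-term vanishes because k^p lies in
      \<open>W\<close>. What remains is that c^p lies in \<open>W\<close>, so
      \<open>powW_imp\<close> applies.\<close>
    have "inv\<^bsub>?G\<^esub> (?q d) \<otimes>\<^bsub>?G\<^esub> ?q e \<otimes>\<^bsub>?G\<^esub> ?q d
      = ?q e \<otimes>\<^bsub>?G\<^esub> ?q c [^]\<^bsub>?G\<^esub> p \<otimes>\<^bsub>?G\<^esub> ?q k [^]\<^bsub>?G\<^esub> (p choose 2)"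
      unfolding one[symmetric]
      by (rule q.H.conj_by_pow) (use e1 c1 k1 comq[OF cE kE] in auto)
    also have "?q k [^]\<^bsub>?G\<^esub> (p choose 2) = \<one>\<^bsub>?G\<^esub>"
    proof -
      obtain r where r: "p choose 2 = p * r" using p_dvd_choose_2 by auto
      have "?q k [^]\<^bsub>?G\<^esub> p = \<one>\<^bsub>?G\<^esub>"
        using q1[OF powW[OF kQ]] q.hom_nat_pow[of k p] by simp
      then show ?thesis
        unfolding r by (simp only: q.H.nat_pow_pow[symmetric] q.H.nat_pow_one q.hom_closed carr)
    qed
    also have "inv\<^bsub>?G\<^esub> (?q d) \<otimes>\<^bsub>?G\<^esub> ?q e \<otimes>\<^bsub>?G\<^esub> ?q d = ?q e"
    proof -
      have "inv\<^bsub>?G\<^esub> (?q d) \<otimes>\<^bsub>?G\<^esub> ?q e \<otimes>\<^bsub>?G\<^esub> ?q d = inv\<^bsub>?G\<^esub> (?q d) \<otimes>\<^bsub>?G\<^esub> (?q d \<otimes>\<^bsub>?G\<^esub> ?q e)"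
        using comq[OF e dE] dE by (simp add: q.H.m_assoc del: mult_FactGroup)
      then show ?thesis using dE by (simp add: q.H.mult_inv_cancel del: mult_FactGroup)
    qed
    finally have "?q e = ?q e \<otimes>\<^bsub>?G\<^esub> ?q c [^]\<^bsub>?G\<^esub> p"
      by (simp only: q.H.r_one q.H.m_closed q.H.nat_pow_closed q.hom_closed carr)
    then have "?q c [^]\<^bsub>?G\<^esub> p = \<one>\<^bsub>?G\<^esub>"
      using q.H.l_cancel_one'[of "?q c [^]\<^bsub>?G\<^esub> p" "?q e"] by (simp del: mult_FactGroup one_FactGroup)
    then have "c [^] p \<in> W"
      using W.coset_eq_one_iff[of "c [^] p"] q.hom_nat_pow[of c p] by simp
    then show ?thesis using powW_imp[OF cE] by (simp add: c_def)
  qed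
  \<comment> \<open>\<open>E\<close> and \<open>f\<close> generate the group, as \<open>f\<close> is
    outside the subgroup \<open>E\<close> of index p; so [E, f] \<le> Q extends to all of
    \<open>G\<close>.\<close>
  define L where "L = cenmod G Q (carrier G) E"
  have L: "subgroup L G" unfolding L_def by (rule subgroup_cenmod_normal[OF subgroup_self Q_normal E_carrier])
  have EL: "E \<subseteq> L" by (auto simp: L_def cenmod_def intro: commr_in_compow)
  have fL: "f \<in> L"
    using commQ commr_mem_iff[OF Q_subgroup _ fc] fc by (auto simp: L_def cenmod_def)
  have "L = carrier G"
    by (rule subgroup_eq_of_index_p[OF E_subgroup L subgroup_self])
      (use EL fL fE card_G subgroup.subset[OF L] in auto)
  then have "commr G t e \<in> Q" if "t \<in> carrier G" "e \<in> E" for t e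
    using that by (auto simp: L_def cenmod_def)
  then have "commr G e t \<in> Q" if "t \<in> carrier G" "e \<in> E" for t e
    using that commr_mem_iff[OF Q_subgroup, of t e] by simp
  then show False using nontriv by blast
qed

end

section \<open>The action on \<open>Q\<close> modulo its Frattini subgroup\<close>

context group
begin

text \<open>The hypotheses make \<open>s \<otimes> t\<close> and \<open>t \<otimes> s\<close>
  conjugate \<open>y\<close> in the same way, where \<open>y\<close> is the element that
  \<open>t \<otimes> s\<close> conjugates to \<open>x\<close>. Since [s, t] = (t s)^-1 (s t), the
  commutator fixes \<open>x\<close>.\<close>

lemma commr_commr_eq_one:
  assumes [simp]: "s \<in> carrier G" "t \<in> carrier G" "x \<in> carrier G"
    and central: "\<And>y g. y \<in> {x, (t \<otimes> s) \<otimes> x \<otimes> inv (t \<otimes> s)} \<Longrightarrow> g \<in> {s, t} \<Longrightarrow>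
      commr G y g \<otimes> s = s \<otimes> commr G y g \<and> commr G y g \<otimes> t = t \<otimes> commr G y g"
    and comm: "\<And>y. y \<in> {x, (t \<otimes> s) \<otimes> x \<otimes> inv (t \<otimes> s)} \<Longrightarrow>
      commr G y s \<otimes> commr G y t = commr G y t \<otimes> commr G y s"
  shows "commr G x (commr G s t) = \<one>"
proof -
  have conj: "inv (g \<otimes> h) \<otimes> y \<otimes> (g \<otimes> h) = y \<otimes> commr G y h \<otimes> commr G y g"
    if [simp]: "y \<in> carrier G" "g \<in> carrier G" "h \<in> carrier G" and "commr G y g \<otimes> h = h \<otimes> commr G y g" for y g h
  proof -
    have "inv (g \<otimes> h) \<otimes> y \<otimes> (g \<otimes> h) = inv h \<otimes> (inv g \<otimes> y \<otimes> g) \<otimes> h"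
      by (simp add: free_normalize)
    also have "inv g \<otimes> y \<otimes> g = y \<otimes> commr G y g" by (simp add: commr_def free_normalize)
    also have "inv h \<otimes> (y \<otimes> commr G y g) \<otimes> h = inv h \<otimes> y \<otimes> (commr G y g \<otimes> h)"
      by (simp add: m_assoc)
    also have "\<dots> = inv h \<otimes> y \<otimes> h \<otimes> commr G y g" unfolding that(4) by (simp add: m_assoc)
    also have "inv h \<otimes> y \<otimes> h = y \<otimes> commr G y h" by (simp add: commr_def free_normalize)
    finally show ?thesis .
  qed
  define y where "y = (t \<otimes> s) \<otimes> x \<otimes> inv (t \<otimes> s)"
  have yc [simp]: "y \<in> carrier G" by (simp add: y_def)
  have y: "y \<in> {x, (t \<otimes> s) \<otimes> x \<otimes> inv (t \<otimes> s)}" by (simp add: y_def)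
  have "inv (s \<otimes> t) \<otimes> y \<otimes> (s \<otimes> t) = y \<otimes> (commr G y t \<otimes> commr G y s)"
    using central[OF y, of s] by (subst conj) (auto simp: m_assoc)
  also have "\<dots> = y \<otimes> commr G y s \<otimes> commr G y t"
    using comm[OF y] by (simp add: m_assoc)
  also have "\<dots> = inv (t \<otimes> s) \<otimes> y \<otimes> (t \<otimes> s)"
    using central[OF y, of t] by (subst conj) auto
  also have "\<dots> = x" by (simp add: y_def free_normalize)
  finally have "inv (s \<otimes> t) \<otimes> y \<otimes> (s \<otimes> t) = x" .
  then have "inv (commr G s t) \<otimes> x \<otimes> commr G s t = x"
    by (simp add: y_def commr_def free_normalize)
  then have "x \<otimes> commr G s t = commr G s t \<otimes> x"
    by (metis assms(1,2,3) commr_closed inv_closed inv_solve_left m_assoc m_closed)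
  then show ?thesis by (simp add: commr_eq_one_iff)
qed

end

context irreducible_pair
begin

abbreviation "R \<equiv> frat G p Q"

lemma R_normal: "R \<lhd> G" by (rule normal_compow[OF Q_normal Q_normal])
lemma R_subgroup: "subgroup R G" using R_normal by (rule normal_imp_subgroup)
lemma R_sub_Q: "R \<subseteq> Q" by (rule frat_subset[OF Q_subgroup])

lemma \<alpha>_image: "\<alpha> ` Q = Q" "\<alpha> ` R = R"
proof -
  show 1: "\<alpha> ` Q = Q" using Q2_eq Q2_eq_Q by simp
  show "\<alpha> ` R = R"
    using sub_aut_image_compow[OF subgroup_self \<alpha>, of Q Q] 1 subgroup.subset[OF Q_subgroup] by simp
qed

lemma A_image_R: "\<phi> \<in> A \<Longrightarrow> \<phi> ` R = R"
  using sub_aut_image_compow[OF E_subgroup A, of \<phi> Q Q] A_image[of \<phi>] Q_sub_E by simp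

lemma Q_neq_E: "Q \<noteq> E"
proof
  assume *: "Q = E"
  have "p\<^sup>2 > 1" by (rule one_less_power[OF p_gt_1]) simp
  moreover have "card E > 0" by (rule subgroup_card_pos[OF E_subgroup])
  ultimately show False using card_E unfolding * by simp
qed

lemma cenmod_eq:
  assumes "N \<lhd> G" "N \<subseteq> E" "M \<subseteq> E" "\<And>\<phi>. \<phi> \<in> A \<Longrightarrow> \<phi> ` N = N" "\<And>\<phi>. \<phi> \<in> A \<Longrightarrow> \<phi> ` M = M"
    and "\<And>x y. x \<in> Q \<Longrightarrow> y \<in> M \<Longrightarrow> commr G x y \<in> N"
  shows "cenmod G N E M = Q \<or> cenmod G N E M = E"
proof (rule irr)
  show "subgroup (cenmod G N E M) G"
    by (rule subgroup_cenmod_normal) (use assms E_subgroup in auto)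
  show "\<phi> ` cenmod G N E M = cenmod G N E M" if "\<phi> \<in> A" for \<phi>
    using sub_aut_image_cenmod[OF E_subgroup A[OF that] assms(2) _ assms(3), of E] assms(4,5)[OF that] A_image[OF that]
    by simp
qed (use Q_sub_E assms in \<open>auto simp: cenmod_def\<close>)

text \<open>The kernel of the action of \<open>E\<close> on a section of order at most p^2 has index
  at most p in \<open>E\<close>, whereas \<open>Q\<close> has index p^2; of the two possibilities in
  \<open>cenmod_eq\<close> only \<open>E\<close> remains.\<close>

lemma cenmod_eq_E:
  assumes "N \<lhd> G" "M \<lhd> G" "N \<subseteq> M" "M \<subseteq> E" "\<And>\<phi>. \<phi> \<in> A \<Longrightarrow> \<phi> ` N = N" "\<And>\<phi>. \<phi> \<in> A \<Longrightarrow> \<phi> ` M = M"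
    and "\<And>x y. x \<in> Q \<Longrightarrow> y \<in> M \<Longrightarrow> commr G x y \<in> N"
    and "card M \<le> p\<^sup>2 * card N"
  shows "cenmod G N E M = E"
proof -
  have "cenmod G N E M \<noteq> Q"
  proof
    assume *: "cenmod G N E M = Q"
    have "p\<^sup>2 * card Q \<le> p * card Q"
      using card_centralizer_mod[OF assms(1-3,8) E_subgroup] * card_E by simp
    then show False
      using p_gt_1 subgroup_card_pos[OF Q_subgroup] by (simp add: power2_eq_square)
  qed
  then show ?thesis using cenmod_eq[of N M] assms by blast
qed

text \<open>The conjugate of a relation \<open>[M, E] \<subseteq> N\<close> under \<open>\<alpha>\<close> is \<open>[M, E2] \<subseteq> N\<close>, and \<open>E\<close>, \<open>E2\<close> generate the group.\<close>
lemma centralizes_mod: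
  assumes "N \<lhd> G" "M \<subseteq> carrier G" "\<alpha> ` N = N" "\<alpha> ` M = M"
    and comm: "\<And>e x. e \<in> E \<Longrightarrow> x \<in> M \<Longrightarrow> commr G e x \<in> N" and "t \<in> carrier G" "x \<in> M"
  shows "commr G x t \<in> N"
proof -
  have Ns: "subgroup N G" using assms(1) by (rule normal_imp_subgroup)
  let ?L = "cenmod G N (carrier G) M"
  have "cenmod G N E M = E" using comm by (auto simp: cenmod_def)
  then have "cenmod G N E2 M = E2"
    using sub_aut_image_cenmod[OF subgroup_self \<alpha> subgroup.subset[OF Ns] E_carrier assms(2)] assms by simp
  then have "E2 \<subseteq> ?L" by (auto simp: cenmod_def)
  moreover have "E \<subseteq> ?L" using comm by (auto simp: cenmod_def)
  ultimately have "?L = carrier G"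
    by (intro generated_by_E_E2 subgroup_cenmod_normal[OF subgroup_self assms(1,2)])
  then have "commr G t x \<in> N" using assms by (auto simp: cenmod_def)
  then show ?thesis using commr_mem_iff[OF Ns, of t x] assms by auto
qed

text \<open>Automorphisms of \<open>Q/R\<close> that centralize \<open>Q/B\<close> and
  \<open>B/R\<close> commute with each other, being given by homomorphisms from \<open>Q/B\<close>
  to \<open>B/R\<close>. So [G, G] centralizes \<open>Q/R\<close>; in particular [E, G] lies in the
  kernel \<open>Q\<close> of \<open>E\<close>, against \<open>nontriv\<close>.\<close>

lemma no_central_chain:
  assumes B: "B \<lhd> G" "R \<subseteq> B" "B \<subseteq> Q"
    and 1: "\<And>x t. x \<in> Q \<Longrightarrow> t \<in> carrier G \<Longrightarrow> commr G x t \<in> B"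
    and 2: "\<And>x t. x \<in> B \<Longrightarrow> t \<in> carrier G \<Longrightarrow> commr G x t \<in> R"
    and cen: "cenmod G R E Q = Q"
  shows False
proof -
  interpret R: normal R G by (rule R_normal)
  interpret q: group_hom G "G Mod R" "\<lambda>x. R #> x" by (rule R.group_hom_Mod)
  let ?q = "\<lambda>x. R #> x" and ?G = "G Mod R"
  have c: "?q x \<otimes>\<^bsub>?G\<^esub> ?q y = ?q y \<otimes>\<^bsub>?G\<^esub> ?q x" if "x \<in> B" "y \<in> carrier G" for x y
  proof -
    have "x \<in> carrier G" using that B by auto
    moreover have "?q (commr G x y) = \<one>\<^bsub>?G\<^esub>"
      using 2[OF that] R.coset_eq_one_iff[of "commr G x y"] \<open>x \<in> carrier G\<close> that by simp
    ultimately have "commr ?G (?q x) (?q y) = \<one>\<^bsub>?G\<^esub>" using q.hom_commr[of x y] that by simp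
    then show ?thesis using q.H.commr_eq_one_iff[of "?q x" "?q y"] that \<open>x \<in> carrier G\<close> by simp
  qed
  have triple: "commr G x (commr G s t) \<in> R" if "x \<in> Q" "s \<in> carrier G" "t \<in> carrier G" for x s t
  proof -
    have xc: "x \<in> carrier G" using that by simp
    have comm_q: "commr ?G (?q y) (?q g) = ?q (commr G y g)" if "y \<in> carrier G" "g \<in> carrier G" for y g
      using that q.hom_commr by simp
    \<comment> \<open>The second element at which \<open>commr_commr_eq_one\<close> wants its
      hypotheses; it stays in the normal subgroup \<open>Q\<close>.\<close>
    define y where "y = (t \<otimes> s) \<otimes> x \<otimes> inv (t \<otimes> s)"
    have yQ: "y \<in> Q" unfolding y_def using that by (intro normal.inv_op_closed2[OF Q_normal]) auto
    have qy: "?q y = (?q t \<otimes>\<^bsub>?G\<^esub> ?q s) \<otimes>\<^bsub>?G\<^esub> ?q x \<otimes>\<^bsub>?G\<^esub> inv\<^bsub>?G\<^esub> (?q t \<otimes>\<^bsub>?G\<^esub> ?q s)"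
      unfolding y_def using that xc by (simp only: q.hom_mult q.hom_inv m_closed inv_closed)
    have "commr ?G (?q x) (commr ?G (?q s) (?q t)) = \<one>\<^bsub>?G\<^esub>"
    proof (rule q.H.commr_commr_eq_one)
      fix y' assume "y' \<in> {?q x, ?q t \<otimes>\<^bsub>?G\<^esub> ?q s \<otimes>\<^bsub>?G\<^esub> ?q x \<otimes>\<^bsub>?G\<^esub> inv\<^bsub>?G\<^esub> (?q t \<otimes>\<^bsub>?G\<^esub> ?q s)}"
      then have "y' = ?q x \<or> y' = ?q y" unfolding qy by blast
      then obtain z where z: "z \<in> Q" "y' = ?q z"
        by (elim disjE) (rule that, rule \<open>x \<in> Q\<close> yQ, assumption)+
      have zc: "z \<in> carrier G" using z by simp
      show "commr ?G y' (?q s) \<otimes>\<^bsub>?G\<^esub> commr ?G y' (?q t) = commr ?G y' (?q t) \<otimes>\<^bsub>?G\<^esub> commr ?G y' (?q s)"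
        unfolding z(2) comm_q[OF zc that(2)] comm_q[OF zc that(3)] 
        by (rule c[OF 1[OF z(1) that(2)] commr_closed[OF zc that(3)]])
      fix g' assume "g' \<in> {?q s, ?q t}"
      then have "g' = ?q s \<or> g' = ?q t" by (simp only: insert_iff empty_iff simp_thms)
      then obtain g where g: "g \<in> carrier G" "g' = ?q g"
        by (elim disjE) (rule that, rule \<open>s \<in> carrier G\<close> \<open>t \<in> carrier G\<close>, assumption)+
      show "commr ?G y' g' \<otimes>\<^bsub>?G\<^esub> ?q s = ?q s \<otimes>\<^bsub>?G\<^esub> commr ?G y' g' \<and>
        commr ?G y' g' \<otimes>\<^bsub>?G\<^esub> ?q t = ?q t \<otimes>\<^bsub>?G\<^esub> commr ?G y' g'"
        unfolding z(2) g(2) comm_q[OF zc g(1)] 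
        by (intro conjI c 1 z g that)
    qed (use that xc in auto)
    then have "?q (commr G x (commr G s t)) = \<one>\<^bsub>?G\<^esub>"
      using comm_q[OF that(2,3)] comm_q[OF xc, of "commr G s t"] that by simp
    then show ?thesis using R.coset_eq_one_iff xc that by simp
  qed
  have "commr G e t \<in> Q" if "e \<in> E" "t \<in> carrier G" for e t
  proof -
    have eE: "commr G e t \<in> E" by (rule commr_mem_normal(1)[OF E that])
    have "commr G (commr G e t) x \<in> R" if "x \<in> Q" for x
      using triple[OF that, of e t] commr_mem_iff[OF R_subgroup, of x "commr G e t"] that \<open>e \<in> E\<close> \<open>t \<in> carrier G\<close>
      by simp
    then have "commr G e t \<in> cenmod G R E Q" using eE by (simp add: cenmod_def)
    then show ?thesis unfolding cen .
  qed
  then show False using nontriv by blast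
qed

lemma central_mod_R:
  assumes "x \<in> Q" "t \<in> carrier G"
  shows "commr G x t \<in> R"
proof -
  have Qc: "Q \<subseteq> carrier G" using subgroup.subset[OF Q_subgroup] .
  have "cenmod G R E Q = E"
  proof (rule ccontr)
    assume "cenmod G R E Q \<noteq> E"
    then have cen: "cenmod G R E Q = Q"
      using cenmod_eq[OF R_normal _ Q_sub_E A_image_R A_image(2)] R_sub_Q Q_sub_E
      by (blast intro: commr_in_compow)
    have neE: "\<not> (\<forall>e\<in>E. \<forall>x\<in>Q. commr G e x \<in> R)"
      using cen Q_neq_E by (auto simp: cenmod_def)
    have "R \<noteq> Q" using neE commr_mem_normal(2)[OF Q_normal] by auto
    \<comment> \<open>\<open>Z1\<close> and \<open>Z2\<close> are the preimages of the fixed points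
      of \<open>E\<close> and \<open>E2\<close> on \<open>Q/R\<close>; \<open>\<alpha>\<close> maps
      one onto the other, so their orders agree.\<close>
    define Z1 where "Z1 = cenmod G R Q E"
    define Z2 where "Z2 = \<alpha> ` Z1"
    have Z1: "Z1 \<lhd> G" unfolding Z1_def by (rule normal_cenmod[OF Q_normal R_normal E])
    have Z1s: "subgroup Z1 G" using Z1 by (rule normal_imp_subgroup)
    have Z1Q: "Z1 \<subseteq> Q" by (auto simp: Z1_def cenmod_def)
    have Z2: "Z2 \<lhd> G" unfolding Z2_def by (rule sub_aut_image_normal[OF \<alpha> Z1])
    have Z2_eq: "Z2 = cenmod G R Q E2"
      unfolding Z2_def Z1_def
      using sub_aut_image_cenmod[OF subgroup_self \<alpha>, of R Q E] \<alpha>_image subgroup.subset[OF R_subgroup] Qc E_carrier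
      by simp
    have card_Z2: "card Z2 = card Z1"
      unfolding Z2_def by (rule sub_aut_card_image[OF \<alpha>]) (use Z1Q Qc in auto)
    have RZ1: "R \<subseteq> Z1"
      using R_sub_Q commr_mem_normal(1)[OF R_normal] by (auto simp: Z1_def cenmod_def)
    have RZ2: "R \<subseteq> Z2"
      using R_sub_Q commr_mem_normal(1)[OF R_normal] by (auto simp: Z2_eq cenmod_def)
    have "Z1 \<noteq> Q"
    proof
      assume "Z1 = Q"
      then have *: "commr G x e \<in> R" if "x \<in> Q" "e \<in> E" for x e using that by (auto simp: Z1_def cenmod_def)
      have "commr G e x \<in> R" if "x \<in> Q" "e \<in> E" for x e
        using *[OF that] commr_mem_iff[OF R_subgroup, of x e] that by simp
      then show False using neE by blast
    qed
    have "Z1 \<noteq> R"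
    proof -
      obtain m where "m \<in> Q" "m \<notin> R" "\<And>t. t \<in> carrier G \<Longrightarrow> commr G m t \<in> R"
        using exists_central_mod[OF R_normal Q_normal] R_sub_Q \<open>R \<noteq> Q\<close> by blast
      then show ?thesis by (auto simp: Z1_def cenmod_def)
    qed
    \<comment> \<open>The bound p^3 on \<open>Q/R\<close> gives the dichotomy: if
      \<open>Z1/R\<close> has order at least p^2, only one factor p is left for
      \<open>Q/Z1\<close>.\<close>
    consider "card Q \<le> p * card Z1" | "card Z1 \<le> p * card R"
    proof -
      obtain r where r: "card R = p ^ r" using card_subgroup_power[OF R_subgroup] .
      obtain z where z: "card Z1 = p ^ z" using card_subgroup_power[OF Z1s] .
      obtain k where k: "card Q = p ^ k" using card_subgroup_power[OF Q_subgroup] .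
      have "p ^ k \<le> p ^ (3 + r)" using card_frat r k by (simp add: power_add)
      then have "k \<le> 3 + r" by (simp only: power_increasing_iff[OF p_gt_1])
      then have "k \<le> Suc z \<or> z \<le> Suc r" by linarith
      then have "p ^ k \<le> p ^ Suc z \<or> p ^ z \<le> p ^ Suc r" by (simp only: power_increasing_iff[OF p_gt_1])
      then show ?thesis using that r z k by auto
    qed
    then show False
    proof cases
      case 1
      \<comment> \<open>\<open>Q/Z1\<close> and \<open>Q/Z2\<close> have order at most p and are
        central, so [Q, G] lies in the intersection. Its elements are fixed modulo \<open>R\<close>
        by \<open>E\<close> and by \<open>E2\<close>, hence by \<open>G\<close>.\<close>
      let ?B = "Z1 \<inter> Z2"
      show False
      proof (rule no_central_chain[OF _ _ _ _ _ cen, of ?B])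
        show "?B \<lhd> G" by (rule normal_subgroup_intersect[OF Z1 Z2])
        show "commr G x t \<in> ?B" if "x \<in> Q" "t \<in> carrier G" for x t
          using commr_of_index_p[OF Z1 Q_normal Z1Q _ that] commr_of_index_p[OF Z2 Q_normal _ _ that] 1 card_Z2
          by (auto simp: Z2_eq cenmod_def)
        show "commr G x t \<in> R" if "x \<in> ?B" "t \<in> carrier G" for x t
        proof -
          have *: "x \<in> Q" "\<And>e. e \<in> E \<Longrightarrow> commr G x e \<in> R" "\<And>e. e \<in> E2 \<Longrightarrow> commr G x e \<in> R"
            using that by (auto simp: Z1_def Z2_eq cenmod_def)
          have "cenmod G R (carrier G) {x} = carrier G"
            using * commr_mem_iff[OF R_subgroup, of x]
            by (intro generated_by_E_E2 subgroup_cenmod_normal[OF subgroup_self R_normal]) (auto simp: cenmod_def)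
          then have "commr G t x \<in> R" using that by (auto simp: cenmod_def)
          then show ?thesis using commr_mem_iff[OF R_subgroup, of t x] that * by simp
        qed
      qed (use RZ1 RZ2 Z1Q in auto)
    next
      case 2
      \<comment> \<open>Now \<open>Z1/R\<close> has order at most p and is central, so
        \<open>E2\<close> fixes it too. Then \<open>Z1\<close> lies in \<open>Z2\<close>, and equal
        orders make \<open>Z1\<close> invariant under \<open>\<alpha>\<close>; it can serve as the
        middle term of the chain.\<close>
      have cR: "commr G x t \<in> R" if "x \<in> Z1" "t \<in> carrier G" for x t
        by (rule commr_of_index_p[OF R_normal Z1 RZ1 2 that])
      have "Z1 \<subseteq> Z2" using cR Z1Q by (auto simp: Z2_eq cenmod_def)
      then have "Z1 = Z2"
        using card_subset_eq[OF finite_subgroup[OF normal_imp_subgroup[OF Z2]]] card_Z2 by simp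
      have AZ1: "\<phi> ` Z1 = Z1" if "\<phi> \<in> A" for \<phi>
        unfolding Z1_def
        using sub_aut_image_cenmod[OF E_subgroup A[OF that], of R Q E] A_image[OF that] A_image_R[OF that]
          R_sub_Q Q_sub_E by simp
      \<comment> \<open>As \<open>Z1 \<noteq> R\<close> uses up a factor p, at most p^2 remains.
        Irreducibility then makes \<open>E\<close> centralize \<open>Q/Z1\<close>, and
        \<open>\<alpha>\<close> extends this to \<open>G\<close>.\<close>
      have "card Q \<le> p\<^sup>2 * card Z1"
      proof -
        have "p * card R \<le> card Z1"
          by (rule subgroup_card_step(2)[OF R_subgroup Z1s]) (use RZ1 \<open>Z1 \<noteq> R\<close> in auto)
        then have "p\<^sup>2 * (p * card R) \<le> p\<^sup>2 * card Z1" by (rule mult_le_mono2)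
        moreover have "p ^ 3 * card R = p\<^sup>2 * (p * card R)"
          by (simp add: power2_eq_square power3_eq_cube mult.assoc)
        ultimately show ?thesis using card_frat by linarith
      qed
      then have "cenmod G Z1 E Q = E"
        using RZ1 commr_in_compow[of _ Q _ p Q]
        by (intro cenmod_eq_E[OF Z1 Q_normal Z1Q Q_sub_E AZ1 A_image(2)]) auto
      then have EZ1: "commr G e x \<in> Z1" if "e \<in> E" "x \<in> Q" for e x using that by (auto simp: cenmod_def)
      have "\<alpha> ` Z1 = Z1" unfolding Z2_def[symmetric] using \<open>Z1 = Z2\<close> by (rule sym)
      then have "commr G x t \<in> Z1" if "x \<in> Q" "t \<in> carrier G" for x t
        by (rule centralizes_mod[OF Z1 Qc _ \<alpha>_image(1) EZ1 that(2,1)])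
      then show False by (intro no_central_chain[OF Z1 RZ1 Z1Q _ cR cen]) auto
    qed
  qed
  then have "commr G e x \<in> R" if "e \<in> E" "x \<in> Q" for e x using that by (auto simp: cenmod_def)
  then show ?thesis
    using centralizes_mod[OF R_normal Qc \<alpha>_image(2,1)] assms by blast
qed

text \<open>Since \<open>Q/R\<close> is central and of exponent p, the power map on
  \<open>E/R\<close> is multiplicative and its kernel is \<open>Q\<close> or \<open>E\<close>. A
  kernel equal to \<open>Q\<close> is impossible: modulo \<open>R\<close> the p-th power of [e, t]
  is [e^p, t], which is trivial because e^p lies in \<open>Q\<close>, so [E, G] would lie in
  \<open>Q\<close>.\<close>

lemma pow_E_in_R:
  assumes "x \<in> E"
  shows "x [^] p \<in> R"
proof -
  let ?B = "{x \<in> E. x [^] p \<in> R}"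
  have cl2: "commr G (commr G x y) z \<in> R" if "x \<in> E" "y \<in> E" "z \<in> carrier G" for x y z
    using that by (intro central_mod_R commr_in_compow) auto
  have cp: "commr G x y [^] p \<in> R" if "x \<in> E" "y \<in> E" for x y
    using that by (intro pow_in_compow commr_in_compow) auto
  have B: "subgroup ?B G"
    by (rule subgroup_pow_mem_class2[OF E_subgroup R_normal]) (use cl2 cp in auto)
  have "?B = Q \<or> ?B = E"
  proof (rule irr[OF B])
    show "\<phi> ` ?B = ?B" if "\<phi> \<in> A" for \<phi>
      using sub_aut_image_pow_mem[OF E_subgroup A[OF that], of R E p] A_image[OF that] A_image_R[OF that]
        R_sub_Q Q_sub_E by simp
  qed (use Q_sub_E in \<open>auto intro: pow_in_compow\<close>)
  moreover have "?B \<noteq> Q"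
  proof
    assume *: "?B = Q"
    have "commr G e t \<in> Q" if "e \<in> E" "t \<in> carrier G" for e t
    proof -
      define u where "u = inv t \<otimes> e \<otimes> t"
      have uE: "u \<in> E" unfolding u_def using that normal.inv_op_closed1[OF E] by blast
      have ieE: "inv e \<in> E" using that subgroup.m_inv_closed[OF E_subgroup] by blast
      have ceq: "commr G e t = inv e \<otimes> u" using that by (simp add: u_def commr_def m_assoc)
      have "R #> (inv e \<otimes> u) [^] p = R #> (inv e [^] p \<otimes> u [^] p)"
        by (rule coset_pow_mult_class2[OF R_normal]) (use uE ieE cl2 cp in auto)
      moreover have "inv e [^] p \<otimes> u [^] p = commr G (e [^] p) t"
        using pow_conj[of "inv t" e p] that by (simp add: u_def commr_def nat_pow_inv m_assoc)
      moreover have "commr G (e [^] p) t \<in> R"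
        using that by (intro central_mod_R pow_in_compow) auto
      ultimately have "(inv e \<otimes> u) [^] p \<in> R"
        using normal.coset_eq_mem[OF R_normal _ _ _ R_subgroup order.refl,
            of "(inv e \<otimes> u) [^] p" "commr G (e [^] p) t"] elem_carrier(1)[OF uE] that by simp
      then have "commr G e t \<in> ?B"
        using commr_mem_normal(1)[OF E that] ceq by simp
      then show ?thesis unfolding * .
    qed
    then show False using nontriv by blast
  qed
  ultimately show ?thesis using assms by blast
qed

section \<open>Cyclicity and order of the Frattini subgroup of \<open>E\<close>\<close>

theorem frattini_small:
  "card Q = 1 \<or> card Q = p \<and> (\<exists>x\<in>E. \<exists>y\<in>E. commr G x y \<noteq> \<one>)"
proof -
  define c where "c = commr G a b"
  have cQ: "c \<in> Q" unfolding c_def using ab by (intro commr_in_compow)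
  have cc: "c \<in> carrier G" using cQ by simp
  \<comment> \<open>The aim is \<open>Q = L\<close>. \<open>L\<close> is normal because
    \<open>G\<close> centralizes \<open>Q/R\<close>.\<close>
  define L where "L = generate G ({c} \<union> R)"
  have gens: "{c} \<union> R \<subseteq> Q" using cQ R_sub_Q by blast
  have L: "subgroup L G"
    unfolding L_def by (rule generate_is_subgroup) (use gens subgroup.subset[OF Q_subgroup] in blast)
  have LQ: "L \<subseteq> Q" unfolding L_def by (rule generate_subgroup_incl[OF gens Q_subgroup])
  have RL: "R \<subseteq> L" and cL: "c \<in> L" by (auto simp: L_def intro: generate.incl)
  have Ln: "L \<lhd> G"
  proof (rule normal_invI[OF L])
    fix x h assume x: "x \<in> carrier G" and h: "h \<in> L"
    then have "h \<otimes> commr G h (inv x) \<in> L"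
      using central_mod_R[of h "inv x"] LQ RL subgroup.m_closed[OF L] by blast
    then show "x \<otimes> h \<otimes> inv x \<in> L"
      using x h subgroup.mem_carrier[OF L] by (simp add: commr_def free_normalize)
  qed
  have commL: "commr G x y \<in> L" if "x \<in> E" "y \<in> E" for x y
  proof -
    \<comment> \<open>It suffices to test the generators \<open>a\<close> and \<open>b\<close>.
      Applied first with \<open>{a, b}\<close> and then with \<open>E\<close> for \<open>M\<close>,
      this reduces all commutators of \<open>E\<close> to [a, b].\<close>
    have cen: "E \<subseteq> cenmod G L (carrier G) M" if "M \<subseteq> carrier G" "\<And>m. m \<in> M \<Longrightarrow> commr G a m \<in> L \<and> commr G b m \<in> L" for M
      unfolding ab(3)[symmetric]
      by (rule generate_subgroup_incl[OF _ subgroup_cenmod_normal[OF subgroup_self Ln that(1)]])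
        (use that ab in \<open>auto simp: cenmod_def\<close>)
    have one: "\<one> \<in> L" using subgroup.one_closed[OF L] .
    have ba: "commr G b a \<in> L"
      using commr_mem_iff[OF L, of a b] cL ab by (simp add: c_def)
    have "E \<subseteq> cenmod G L (carrier G) {a, b}"
      using ab one ba cL by (intro cen) (auto simp: commr_self c_def)
    then have 1: "commr G x a \<in> L" "commr G x b \<in> L" if "x \<in> E" for x using that by (auto simp: cenmod_def)
    have "E \<subseteq> cenmod G L (carrier G) E"
      using 1 commr_mem_iff[OF L] ab by (intro cen E_carrier) auto
    then show ?thesis using that by (auto simp: cenmod_def)
  qed
  have "Q \<subseteq> L"
    by (rule compow_subset[OF L commL]) (use pow_E_in_R RL in auto)
  then have "Q = L" using LQ by blast
  interpret Qg: finite_p_group "G\<lparr>carrier := Q\<rparr>" p by (rule finite_p_group_subgroup[OF Q_subgroup])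
  have frQ: "frat (G\<lparr>carrier := Q\<rparr>) p Q = R" by (rule frat_consistent[OF Q_subgroup order.refl])
  \<comment> \<open>\<open>R\<close> is the Frattini subgroup of \<open>Q\<close>, so it may be
    dropped from the generators: \<open>Q\<close> is cyclic.\<close>
  have "Q \<subseteq> generate (G\<lparr>carrier := Q\<rparr>) ({c} \<union> R)"
    unfolding generate_consistent[OF gens Q_subgroup] using \<open>Q \<subseteq> L\<close> by (simp only: L_def)
  then have "generate (G\<lparr>carrier := Q\<rparr>) {c} = carrier (G\<lparr>carrier := Q\<rparr>)"
    using cQ by (intro Qg.frat_nongenerating) (simp_all add: frQ)
  then have Qc: "generate G {c} = Q"
    using generate_consistent[of "{c}" Q] cQ Q_subgroup by simp
  then have Qpow: "\<exists>i::int. x = c [^] i" if "x \<in> Q" for x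
    using that generate_pow[OF cc] by auto
  have Qab: "commr G x y = \<one>" if xy: "x \<in> Q" "y \<in> Q" for x y
  proof -
    obtain i :: int where "x = c [^] i" using Qpow[OF xy(1)] by blast
    moreover obtain j :: int where "y = c [^] j" using Qpow[OF xy(2)] by blast
    moreover have "c [^] i \<otimes> c [^] j = c [^] j \<otimes> c [^] i"
      using cc by (simp only: int_pow_mult[symmetric] add.commute)
    ultimately show ?thesis using cc by (simp add: commr_eq_one_iff)
  qed
  have card_Q: "card Q \<le> p * card R"
    using Qg.card_le_power_rank[of "{c}"] cQ \<open>generate (G\<lparr>carrier := Q\<rparr>) {c} = _\<close>
    by (simp add: frQ)
  have cpR: "c [^] p \<in> R" using cQ by (rule pow_in_compow)
  have Rc: "generate G {c [^] p} = R"
  proof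
    have s: "subgroup (generate G {c [^] p}) G" using cc by (intro generate_is_subgroup) simp
    show "generate G {c [^] p} \<subseteq> R" using cpR by (intro generate_subgroup_incl[OF _ R_subgroup]) simp
    show "R \<subseteq> generate G {c [^] p}"
    proof (rule compow_subset[OF s])
      show "commr G x y \<in> generate G {c [^] p}" if "x \<in> Q" "y \<in> Q" for x y
        using Qab[OF that] generate.one by simp
      show "x [^] p \<in> generate G {c [^] p}" if "x \<in> Q" for x
      proof -
        obtain i :: int where "x = c [^] i" using Qpow[OF \<open>x \<in> Q\<close>] by blast
        then have "x [^] p = (c [^] p) [^] i"
          using cc by (simp add: int_pow_int[symmetric] int_pow_pow mult.commute)
        then show ?thesis using cc generate_pow[of "c [^] p"] by auto
      qed
    qed
  qed
  \<comment> \<open>For the cyclic group \<open>Q\<close> this is the subgroup of p^2-th powers. The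
    section \<open>Q/R2\<close> has order at most p^2, so \<open>cenmod_eq_E\<close> lets
    \<open>E\<close> centralize it.\<close>
  define R2 where "R2 = frat G p R"
  have R2: "R2 \<lhd> G" unfolding R2_def by (rule normal_compow[OF R_normal R_normal])
  have R2R: "R2 \<subseteq> R" unfolding R2_def by (rule frat_subset[OF R_subgroup])
  interpret Rg: finite_p_group "G\<lparr>carrier := R\<rparr>" p by (rule finite_p_group_subgroup[OF R_subgroup])
  have frR: "frat (G\<lparr>carrier := R\<rparr>) p R = R2"
    unfolding R2_def by (rule frat_consistent[OF R_subgroup order.refl])
  have R_gen: "generate (G\<lparr>carrier := R\<rparr>) {c [^] p} = R"
    using generate_consistent[of "{c [^] p}" R] cpR R_subgroup Rc by simp
  have "card R \<le> p * card R2"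
    using Rg.card_le_power_rank[of "{c [^] p}"] cpR R_gen by (simp add: frR)
  then have "card Q \<le> p\<^sup>2 * card R2"
    using order.trans[OF card_Q mult_le_mono2[of "card R" "p * card R2" p]]
    by (simp add: power2_eq_square mult.assoc)
  then have "cenmod G R2 E Q = E"
  proof (rule cenmod_eq_E[OF R2 Q_normal _ Q_sub_E _ A_image(2), rotated -1])
    show "R2 \<subseteq> Q" using R2R R_sub_Q by blast
    show "\<phi> ` R2 = R2" if "\<phi> \<in> A" for \<phi>
      unfolding R2_def
      using sub_aut_image_compow[OF E_subgroup A[OF that], of R R] A_image_R[OF that] R_sub_Q Q_sub_E by simp
    show "commr G x y \<in> R2" if "x \<in> Q" "y \<in> Q" for x y
      using Qab[OF that] subgroup.one_closed[OF normal_imp_subgroup[OF R2]] by simp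
  qed
  then have cR2: "commr G e x \<in> R2" if "e \<in> E" "x \<in> Q" for e x using that by (auto simp: cenmod_def)
  \<comment> \<open>Two evaluations of [a^p, b] modulo \<open>R2\<close>: it is [a, b]^p because
    \<open>a\<close> commutes with \<open>c\<close>, and it is trivial because a^p lies in
    \<open>Q\<close>.\<close>
  have "R2 #> commr G (a [^] p) b = R2 #> c [^] p"
    unfolding c_def by (rule coset_commr_pow[OF R2]) (use ab cR2 cQ c_def in auto)
  moreover have "commr G (a [^] p) b \<in> R2"
  proof -
    have "a [^] p \<in> Q" using ab by (intro pow_in_compow)
    then show ?thesis
      using cR2[OF ab(2), of "a [^] p"] commr_mem_iff[OF normal_imp_subgroup[OF R2], of b "a [^] p"] ab by simp
  qed
  ultimately have "c [^] p \<in> R2"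
    using normal.coset_eq_mem[OF R2 _ _ _ normal_imp_subgroup[OF R2] order.refl, of "c [^] p" "commr G (a [^] p) b"]
      cc ab by simp
  then have "R \<subseteq> R2"
    using generate_subgroup_incl[OF _ normal_imp_subgroup[OF R2], of "{c [^] p}"] Rc by simp
  \<comment> \<open>\<open>R\<close> equals its own Frattini subgroup, so even the empty set
    generates it.\<close>
  then have "generate (G\<lparr>carrier := R\<rparr>) {} = R"
    using Rg.frat_nongenerating[of "{}"] by (simp add: frR subset_iff generate.incl)
  then have "R = {\<one>}" by (simp add: Rg.generate_empty)
  then have "card R = 1" by simp
  then have "card Q \<le> p" using card_Q by simp
  moreover obtain k where k: "card Q = p ^ k" using card_subgroup_power[OF Q_subgroup] .
  ultimately have "p ^ k \<le> p ^ 1" by simp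
  then have "k \<le> 1" by (simp only: power_increasing_iff[OF p_gt_1])
  then consider "card Q = 1" | "card Q = p" "c \<noteq> \<one>"
  proof (cases "c = \<one>")
    case True
    then have "Q = {\<one>}" using Qc generate_one by simp
    then show ?thesis using that by simp
  next
    case False
    then show ?thesis using that k \<open>k \<le> 1\<close> by (cases k) auto
  qed
  then show ?thesis using ab c_def by cases auto
qed

end

subsection \<open>Strongly p-embedded subgroups and fusion systems\<close>

text \<open>\<open>H\<close> contains every \<open>g\<close> that conjugates into \<open>H\<close>
  some subgroup of \<open>H\<close> of order divisible by p; this is \<open>fusion\<close>. It is
  applied to a subgroup \<open>P\<close> of order p and an element of \<open>N\<close> centralizing
  \<open>P\<close>, which makes \<open>N \<inter> H\<close> nontrivial; then to
  \<open>N \<inter> H\<close> and an element of \<open>N\<close> normalizing it, which forces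
  \<open>N \<subseteq> H\<close>; and last to \<open>N\<close> and an arbitrary element of
  \<open>G\<close>.\<close>

lemma (in group) strongly_p_embedded_normal_p_subgroup:
  assumes "finite (carrier G)" "Factorial_Ring.prime p" "odd p"
    and emb: "strongly_p_embedded G p H" and N: "N \<lhd> G" and card_N: "card N = p ^ n"
  shows "N = {\<one>}"
proof (rule ccontr)
  assume N1: "N \<noteq> {\<one>}"
  have H: "subgroup H G" "H \<noteq> carrier G" "p dvd card H"
    and emb': "\<And>g. g \<in> carrier G \<Longrightarrow> g \<notin> H \<Longrightarrow> \<not> p dvd card (H \<inter> (inv g <# H #> g))"
    using emb by (auto simp: strongly_p_embedded_def)
  interpret H: subgroup H G by (rule H(1))
  interpret N: normal N G by (rule N)
  interpret Hg: group "G\<lparr>carrier := H\<rparr>" by (rule subgroup_imp_group) (rule H(1))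
  interpret Ng: finite_p_group "G\<lparr>carrier := N\<rparr>" p
    using subgroup_imp_group[OF N.subgroup_axioms] assms N.subset card_N
    by (auto simp: finite_p_group_def finite_p_group_axioms_def p_group_def intro: finite_subset)
  have p1: "p > 1" using assms(2) prime_gt_1_nat by blast
  have fusion: "g \<in> H"
    if A: "subgroup A G" "A \<subseteq> H" "p dvd card A" "g \<in> carrier G" "\<And>x. x \<in> A \<Longrightarrow> g \<otimes> x \<otimes> inv g \<in> H" for A g
  proof (rule ccontr)
    assume "g \<notin> H"
    define C where "C = H \<inter> (inv g <# H #> g)"
    have C_eq: "C = {x \<in> H. g \<otimes> x \<otimes> inv g \<in> H}"
    proof -
      have "x \<in> inv g <# H #> g \<longleftrightarrow> g \<otimes> x \<otimes> inv g \<in> H" if "x \<in> H" for x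
      proof
        assume "x \<in> inv g <# H #> g"
        then obtain h where "h \<in> H" "x = inv g \<otimes> h \<otimes> g" by (auto simp: l_coset_def r_coset_def)
        then show "g \<otimes> x \<otimes> inv g \<in> H" using A(4) by (simp add: free_normalize)
      next
        assume *: "g \<otimes> x \<otimes> inv g \<in> H"
        have "x = inv g \<otimes> (g \<otimes> x \<otimes> inv g) \<otimes> g" using A(4) that by (simp add: free_normalize)
        then show "x \<in> inv g <# H #> g" using * by (auto simp: l_coset_def r_coset_def)
      qed
      then show ?thesis by (auto simp: C_def)
    qed
    have "subgroup C G"
    proof (rule subgroupI)
      show "C \<noteq> {}" using A(4) H.one_closed by (auto simp: C_eq intro!: exI[of _ \<one>])
      fix x assume x: "x \<in> C"
      then have "inv (g \<otimes> x \<otimes> inv g) \<in> H" by (simp add: C_eq)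
      then show "inv x \<in> C" using x A(4) by (simp add: C_eq free_normalize)
      fix y assume y: "y \<in> C"
      then have "(g \<otimes> x \<otimes> inv g) \<otimes> (g \<otimes> y \<otimes> inv g) \<in> H" using x by (simp add: C_eq)
      then show "x \<otimes> y \<in> C" using x y A(4) by (simp add: C_eq free_normalize)
    qed (auto simp: C_eq)
    moreover have "A \<subseteq> C" using A by (auto simp: C_eq)
    ultimately have "p dvd card C" using card_subgroup_dvd[OF A(1)] A(3) dvd_trans by blast
    then show False using emb' A(4) \<open>g \<notin> H\<close> by (simp add: C_def)
  qed
  have "n \<noteq> 0"
  proof
    assume "n = 0"
    then obtain z where "N = {z}" using card_N by (auto simp: card_1_singleton_iff)
    then show False using N1 N.one_closed by simp
  qed
  then have pN: "p dvd card N" using card_N by simp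
  \<comment> \<open>Sylow's theorem with exponent 1 serves as Cauchy's theorem: \<open>P\<close> has
    order exactly p.\<close>
  have "order (G\<lparr>carrier := H\<rparr>) = p ^ 1 * (card H div p)" using H(3) by (simp add: order_def)
  then obtain P where P: "subgroup P (G\<lparr>carrier := H\<rparr>)" "card P = p ^ 1"
    using sylow_thm[OF assms(2) Hg.is_group, of 1 "card H div p"] finite_subset[OF H.subset assms(1)]
    by auto
  have PH: "P \<subseteq> H" using subgroup.subset[OF P(1)] by simp
  have PG: "subgroup P G" by (rule incl_subgroup[OF H(1) P(1)])
  interpret P: subgroup P G by (rule PG)
  interpret Pg: group "G\<lparr>carrier := P\<rparr>" by (rule subgroup_imp_group) (rule PG)
  have "p dvd card {x \<in> N. \<forall>h\<in>carrier (G\<lparr>carrier := P\<rparr>). inv h \<otimes> x \<otimes> h = x}"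
    by (rule p_dvd_card_fixed_points[OF Pg.is_group _ assms(2), where n = 1])
      (use P pN finite_subset[OF N.subset assms(1)] N.inv_op_closed1 in \<open>auto simp: free_normalize\<close>)
  moreover have "\<one> \<in> {x \<in> N. \<forall>h\<in>carrier (G\<lparr>carrier := P\<rparr>). inv h \<otimes> x \<otimes> h = x}" (is "_ \<in> ?Fix")
    by simp
  ultimately have "?Fix \<noteq> {\<one>}" using p1 by auto
  then obtain c where c: "c \<in> N" "c \<noteq> \<one>" "\<And>h. h \<in> P \<Longrightarrow> inv h \<otimes> c \<otimes> h = c"
    using \<open>\<one> \<in> ?Fix\<close> by auto
  have "c \<in> H"
  proof (rule fusion[OF PG PH])
    fix x assume x: "x \<in> P"
    have "c \<otimes> x \<otimes> inv c = x \<otimes> (inv x \<otimes> c \<otimes> x) \<otimes> inv c"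
      using x c(1) by (simp add: free_normalize)
    also have "\<dots> = x" unfolding c(3)[OF x] using c(1) x by (simp add: m_assoc)
    finally show "c \<otimes> x \<otimes> inv c \<in> H" using x PH by auto
  qed (use P c in auto)
  have NH: "subgroup (N \<inter> H) G" by (rule subgroups_Inter_pair[OF N.subgroup_axioms H(1)])
  have pNH: "p dvd card (N \<inter> H)"
  proof -
    have "card (N \<inter> H) dvd p ^ n"
      using card_subgroup_dvd[OF NH N.subgroup_axioms] card_N by simp
    then obtain k where k: "card (N \<inter> H) = p ^ k" using assms(2) divides_primepow_nat by blast
    have "k \<noteq> 0"
    proof
      assume "k = 0"
      then obtain z where z: "N \<inter> H = {z}" using k by (auto simp: card_1_singleton_iff)
      have "c \<in> {z}" unfolding z[symmetric] using c \<open>c \<in> H\<close> by simp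
      moreover have "\<one> \<in> {z}" unfolding z[symmetric] by simp
      ultimately show False using c(2) by simp
    qed
    then show ?thesis using k by simp
  qed
  have "N \<subseteq> H"
  proof (rule ccontr)
    assume "\<not> N \<subseteq> H"
    then have ne: "N \<inter> H \<noteq> carrier (G\<lparr>carrier := N\<rparr>)" by auto
    obtain g where g: "g \<in> N" "g \<notin> N \<inter> H"
      "\<And>h. h \<in> N \<inter> H \<Longrightarrow> inv\<^bsub>G\<lparr>carrier := N\<rparr>\<^esub> g \<otimes> h \<otimes> g \<in> N \<inter> H"
      using Ng.normalizer_grows[OF subgroup_incl[OF NH N.subgroup_axioms] ne] by auto
    have gc: "g \<in> carrier G" using g(1) by simp
    have "inv g \<in> H"
      by (rule fusion[OF NH _ pNH])
        (use g gc m_inv_consistent[OF N.subgroup_axioms g(1)] in auto)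
    then have "inv (inv g) \<in> H" by (rule H.m_inv_closed)
    then show False using g gc by simp
  qed
  obtain g where g: "g \<in> carrier G" "g \<notin> H" using H(2) H.subset by blast
  have "g \<in> H"
    by (rule fusion[OF N.subgroup_axioms \<open>N \<subseteq> H\<close> pN g(1)])
      (use N.inv_op_closed2[OF g(1)] \<open>N \<subseteq> H\<close> in blast)
  then show False using g by simp
qed

lemma (in group) grank_consistent:
  assumes "subgroup H G"
  shows "grank (G\<lparr>carrier := H\<rparr>) H = grank G H"
proof -
  have "(A \<subseteq> H \<and> finite A \<and> card A = n \<and> generate (G\<lparr>carrier := H\<rparr>) A = H) \<longleftrightarrow>
    (A \<subseteq> H \<and> finite A \<and> card A = n \<and> generate G A = H)" for A n
    using generate_consistent[OF _ assms] by auto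
  then show ?thesis unfolding grank_def by simp
qed

lemma (in group) frattini_consistent:
  assumes "subgroup H G"
  shows "frattini (G\<lparr>carrier := H\<rparr>) H = frattini G H"
proof -
  have "subgroup K (G\<lparr>carrier := H\<rparr>) \<longleftrightarrow> subgroup K G \<and> K \<subseteq> H" for K
    using subgroup_incl[OF _ assms] incl_subgroup[OF assms] subgroup.subset by fastforce
  then have "maximal_subgroup (G\<lparr>carrier := H\<rparr>) H M = maximal_subgroup G H M" for M
    unfolding maximal_subgroup_def by blast
  then show ?thesis by (simp add: frattini_def)
qed

section \<open>Automorphism groups in a fusion system\<close>

locale p_fusion_system = finite_p_group +
  fixes F :: "'a set \<Rightarrow> 'a set \<Rightarrow> ('a \<Rightarrow> 'a) set"
  assumes fusion: "fusion_system G F"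
begin

lemma F_subgroup: "\<phi> \<in> F P Q \<Longrightarrow> subgroup P G \<and> subgroup Q G"
  using fusion unfolding fusion_system_def by blast

lemma F_injhom: "\<phi> \<in> F P Q \<Longrightarrow> \<phi> \<in> injhom G P Q"
  using fusion F_subgroup unfolding fusion_system_def by blast

lemma F_conj:
  "subgroup P G \<Longrightarrow> subgroup Q G \<Longrightarrow> g \<in> carrier G \<Longrightarrow> conjmap G g ` P \<subseteq> Q \<Longrightarrow> restrict (conjmap G g) P \<in> F P Q"
  using fusion unfolding fusion_system_def HomS_def by blast

lemma F_comp: "\<phi> \<in> F P Q \<Longrightarrow> \<psi> \<in> F Q R \<Longrightarrow> restrict (\<psi> \<circ> \<phi>) P \<in> F P R"
  using fusion unfolding fusion_system_def by blast

lemma F_codomain: "\<phi> \<in> F P Q \<Longrightarrow> subgroup R G \<Longrightarrow> \<phi> ` P \<subseteq> R \<Longrightarrow> \<phi> \<in> F P R"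
  using fusion unfolding fusion_system_def by blast

lemma F_inv: "\<phi> \<in> F P Q \<Longrightarrow> restrict (inv_into P \<phi>) (\<phi> ` P) \<in> F (\<phi> ` P) P"
  using fusion unfolding fusion_system_def by blast

lemma F_mem: "\<phi> \<in> F P Q \<Longrightarrow> x \<in> P \<Longrightarrow> \<phi> x \<in> Q"
  using F_injhom[of \<phi> P Q] by (auto simp: injhom_def)

lemma F_sub_aut:
  assumes "\<phi> \<in> F P P"
  shows "sub_aut G P \<phi>"
proof -
  have "finite P" using F_subgroup[OF assms] finite_subgroup by blast
  moreover have "inj_on \<phi> P" "\<phi> ` P \<subseteq> P" using F_injhom[OF assms] by (auto simp: injhom_def)
  ultimately have "bij_betw \<phi> P P" by (simp add: bij_betw_def endo_inj_surj)
  then show ?thesis using F_injhom[OF assms] by (simp add: sub_aut_def injhom_def)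
qed

lemma AutGrp_simps [simp]:
  "carrier (AutGrp F P) = F P P" "\<phi> \<otimes>\<^bsub>AutGrp F P\<^esub> \<psi> = restrict (\<psi> \<circ> \<phi>) P" "\<one>\<^bsub>AutGrp F P\<^esub> = restrict id P"
  by (simp_all add: AutGrp_def)

lemma finite_F: "finite (F P P)"
proof (cases "F P P = {}")
  case False
  then have "finite P" using F_subgroup finite_subgroup by blast
  moreover have "F P P \<subseteq> P \<rightarrow>\<^sub>E P" using F_injhom unfolding injhom_def by blast
  ultimately show ?thesis by (meson finite_PiE finite_subset)
qed simp

lemma F_id: "subgroup P G \<Longrightarrow> restrict id P \<in> F P P"
proof -
  assume P: "subgroup P G"
  have "conjmap G \<one> x = x" if "x \<in> P" for x
    using that subgroup.mem_carrier[OF P] by (simp add: conjmap_def)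
  then have "restrict (conjmap G \<one>) P = restrict id P" "conjmap G \<one> ` P \<subseteq> P" by auto
  then show ?thesis using F_conj[OF P P one_closed] by simp
qed

lemma group_AutGrp:
  assumes "subgroup P G"
  shows "group (AutGrp F P)"
proof (rule groupI)
  fix \<phi> \<psi> \<chi>
  assume F: "\<phi> \<in> carrier (AutGrp F P)" "\<psi> \<in> carrier (AutGrp F P)" "\<chi> \<in> carrier (AutGrp F P)"
  show "\<phi> \<otimes>\<^bsub>AutGrp F P\<^esub> \<psi> \<in> carrier (AutGrp F P)" using F F_comp by simp
  show "\<phi> \<otimes>\<^bsub>AutGrp F P\<^esub> \<psi> \<otimes>\<^bsub>AutGrp F P\<^esub> \<chi> = \<phi> \<otimes>\<^bsub>AutGrp F P\<^esub> (\<psi> \<otimes>\<^bsub>AutGrp F P\<^esub> \<chi>)"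
    using F F_mem[of \<phi> P P] by (auto simp: fun_eq_iff restrict_def)
  show "\<one>\<^bsub>AutGrp F P\<^esub> \<otimes>\<^bsub>AutGrp F P\<^esub> \<phi> = \<phi>"
    using F F_injhom[of \<phi> P P] by (auto simp: fun_eq_iff restrict_def injhom_def PiE_def extensional_def)
  have "bij_betw \<phi> P P" using F_sub_aut[of \<phi> P] F by (simp add: sub_aut_def)
  then have im: "\<phi> ` P = P" and inj: "inj_on \<phi> P" by (auto simp: bij_betw_def)
  show "\<exists>\<psi>\<in>carrier (AutGrp F P). \<psi> \<otimes>\<^bsub>AutGrp F P\<^esub> \<phi> = \<one>\<^bsub>AutGrp F P\<^esub>"
  proof (rule bexI)
    show "restrict (inv_into P \<phi>) P \<in> carrier (AutGrp F P)" using F_inv[of \<phi> P P] F im by simp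
    show "restrict (inv_into P \<phi>) P \<otimes>\<^bsub>AutGrp F P\<^esub> \<phi> = \<one>\<^bsub>AutGrp F P\<^esub>"
      using im by (auto simp: fun_eq_iff restrict_def f_inv_into_f)
  qed
qed (use F_id[OF assms] in simp)

lemma aut_inv_apply:
  assumes "\<phi> \<in> F P P" "x \<in> P"
  shows "(inv\<^bsub>AutGrp F P\<^esub> \<phi>) (\<phi> x) = x" "\<phi> ((inv\<^bsub>AutGrp F P\<^esub> \<phi>) x) = x" "(inv\<^bsub>AutGrp F P\<^esub> \<phi>) x \<in> P"
    "inv\<^bsub>AutGrp F P\<^esub> \<phi> \<in> F P P"
proof -
  interpret A: group "AutGrp F P" using group_AutGrp F_subgroup assms by blast
  have "\<phi> \<otimes>\<^bsub>AutGrp F P\<^esub> inv\<^bsub>AutGrp F P\<^esub> \<phi> = \<one>\<^bsub>AutGrp F P\<^esub>" using assms by (intro A.r_inv) simp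
  from fun_cong[OF this, of x] show "(inv\<^bsub>AutGrp F P\<^esub> \<phi>) (\<phi> x) = x" using assms by simp
  have "inv\<^bsub>AutGrp F P\<^esub> \<phi> \<otimes>\<^bsub>AutGrp F P\<^esub> \<phi> = \<one>\<^bsub>AutGrp F P\<^esub>" using assms by (intro A.l_inv) simp
  from fun_cong[OF this, of x] show "\<phi> ((inv\<^bsub>AutGrp F P\<^esub> \<phi>) x) = x" using assms by simp
  show i: "inv\<^bsub>AutGrp F P\<^esub> \<phi> \<in> F P P" using A.inv_closed[of \<phi>] assms by simp
  show "(inv\<^bsub>AutGrp F P\<^esub> \<phi>) x \<in> P" using F_mem[OF i assms(2)] .
qed

lemma F_ext:
  assumes "\<phi> \<in> F P Q" "\<psi> \<in> F P R" "\<And>x. x \<in> P \<Longrightarrow> \<phi> x = \<psi> x"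
  shows "\<phi> = \<psi>"
  using F_injhom[OF assms(1)] F_injhom[OF assms(2)] assms(3)
  by (intro extensionalityI[of _ P]) (auto simp: injhom_def PiE_def)

lemma conjmap_mult:
  "g \<in> carrier G \<Longrightarrow> h \<in> carrier G \<Longrightarrow> x \<in> carrier G \<Longrightarrow> conjmap G (g \<otimes> h) x = conjmap G h (conjmap G g x)"
  by (simp add: conjmap_def free_normalize)

lemma subgroup_normS:
  assumes "subgroup P G"
  shows "subgroup (normS G P) G"
proof (rule subgroupI)
  have Pc: "P \<subseteq> carrier G" using assms subgroup.subset by blast
  show "normS G P \<subseteq> carrier G" by (auto simp: normS_def)
  have "conjmap G \<one> ` P = P" using Pc by (force simp: conjmap_def)
  then show "normS G P \<noteq> {}" by (auto simp: normS_def)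
  fix g assume g: "g \<in> normS G P"
  then have gc: "g \<in> carrier G" and gP: "conjmap G g ` P = P" by (auto simp: normS_def)
  have "conjmap G (inv g) ` conjmap G g ` P = P"
    unfolding image_image using gc Pc by (force simp: conjmap_def free_normalize)
  then show "inv g \<in> normS G P" unfolding gP using gc by (simp add: normS_def)
  fix h assume "h \<in> normS G P"
  then have hc: "h \<in> carrier G" and hP: "conjmap G h ` P = P" by (auto simp: normS_def)
  have "conjmap G (g \<otimes> h) ` P = conjmap G h ` conjmap G g ` P"
    unfolding image_image using gc hc Pc by (intro image_cong) (auto simp: conjmap_mult)
  then show "g \<otimes> h \<in> normS G P" unfolding gP hP using gc hc by (simp add: normS_def)
qed

lemma normS_mem:
  assumes "subgroup P G" "g \<in> P"
  shows "g \<in> normS G P"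
proof -
  interpret P: subgroup P G by fact
  have "x \<in> conjmap G g ` P" if "x \<in> P" for x
    using that assms(2) by (intro image_eqI[of _ _ "g \<otimes> x \<otimes> inv g"]) (auto simp: conjmap_def free_normalize)
  then show ?thesis using assms(2) by (auto simp: normS_def conjmap_def)
qed

lemma F_conj_normS:
  assumes "subgroup P G" "g \<in> normS G P"
  shows "restrict (conjmap G g) P \<in> F P P"
  by (rule F_conj) (use assms in \<open>auto simp: normS_def\<close>)

lemma InnS_normal:
  assumes P: "subgroup P G"
  shows "InnS G P \<lhd> AutGrp F P"
proof -
  interpret P: subgroup P G by (rule P)
  interpret A: group "AutGrp F P" by (rule group_AutGrp[OF P])
  have cl: "conjmap G g x \<in> P" if "g \<in> P" "x \<in> P" for g x using that by (simp add: conjmap_def)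
  have "group_hom (G\<lparr>carrier := P\<rparr>) (AutGrp F P) (\<lambda>g. restrict (conjmap G g) P)"
    unfolding group_hom_def group_hom_axioms_def
  proof (intro conjI homI subgroup_imp_group[OF P] A.is_group)
    show "restrict (conjmap G g) P \<in> carrier (AutGrp F P)" if "g \<in> carrier (G\<lparr>carrier := P\<rparr>)" for g
      using F_conj_normS[OF P] normS_mem[OF P] that by simp
    show "restrict (conjmap G (g \<otimes>\<^bsub>G\<lparr>carrier := P\<rparr>\<^esub> h)) P = restrict (conjmap G g) P \<otimes>\<^bsub>AutGrp F P\<^esub> restrict (conjmap G h) P"
      if "g \<in> carrier (G\<lparr>carrier := P\<rparr>)" "h \<in> carrier (G\<lparr>carrier := P\<rparr>)" for g h
      using that cl by (auto simp: fun_eq_iff restrict_def conjmap_mult)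
  qed
  then have "subgroup ((\<lambda>g. restrict (conjmap G g) P) ` P) (AutGrp F P)"
    using group_hom.img_is_subgroup by fastforce
  moreover have "(\<lambda>g. restrict (conjmap G g) P) ` P = InnS G P" by (auto simp: InnS_def)
  ultimately have sub: "subgroup (InnS G P) (AutGrp F P)" by simp
  show ?thesis
  proof (rule A.normal_invI[OF sub])
    fix \<phi> c assume phi: "\<phi> \<in> carrier (AutGrp F P)" and "c \<in> InnS G P"
    then have phi': "\<phi> \<in> F P P" by simp
    obtain g where g: "g \<in> P" "c = restrict (conjmap G g) P" using \<open>c \<in> _\<close> by (auto simp: InnS_def)
    \<comment> \<open>Products are read from left to right, so conjugating the inner automorphism of
      \<open>g\<close> in this way gives the inner automorphism of the preimage of \<open>g\<close>
      under \<open>\<phi>\<close>.\<close>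
    define h where "h = (inv\<^bsub>AutGrp F P\<^esub> \<phi>) g"
    have h: "h \<in> P" "\<phi> h = g" using aut_inv_apply[OF phi' g(1)] by (simp_all add: h_def)
    have cF: "c \<in> F P P" using g F_conj_normS[OF P] normS_mem[OF P] by simp
    have hF: "restrict (conjmap G h) P \<in> F P P" using h F_conj_normS[OF P] normS_mem[OF P] by simp
    have "\<phi> \<otimes>\<^bsub>AutGrp F P\<^esub> c = restrict (conjmap G h) P \<otimes>\<^bsub>AutGrp F P\<^esub> \<phi>"
    proof (rule F_ext)
      show "\<phi> \<otimes>\<^bsub>AutGrp F P\<^esub> c \<in> F P P" using A.m_closed[OF phi, of c] cF by simp
      show "restrict (conjmap G h) P \<otimes>\<^bsub>AutGrp F P\<^esub> \<phi> \<in> F P P" using A.m_closed[of _ \<phi>] phi hF by simp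
      fix x assume x: "x \<in> P"
      have "\<phi> (conjmap G h x) = conjmap G g (\<phi> x)"
        unfolding conjmap_def
        using sub_aut_simps(2,3)[OF P F_sub_aut[OF phi']] x h by simp
      then show "(\<phi> \<otimes>\<^bsub>AutGrp F P\<^esub> c) x = (restrict (conjmap G h) P \<otimes>\<^bsub>AutGrp F P\<^esub> \<phi>) x"
        using x g F_mem[OF phi' x] by simp
    qed
    moreover have "restrict (conjmap G h) P \<in> carrier (AutGrp F P)" using hF by simp
    ultimately have "\<phi> \<otimes>\<^bsub>AutGrp F P\<^esub> c \<otimes>\<^bsub>AutGrp F P\<^esub> inv\<^bsub>AutGrp F P\<^esub> \<phi> = restrict (conjmap G h) P"
      using phi by (simp only: A.m_assoc A.r_inv A.r_one A.inv_closed)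
    then show "\<phi> \<otimes>\<^bsub>AutGrp F P\<^esub> c \<otimes>\<^bsub>AutGrp F P\<^esub> inv\<^bsub>AutGrp F P\<^esub> \<phi> \<in> InnS G P"
      using h by (auto simp: InnS_def)
  qed
qed

text \<open>Conjugation by an isomorphism of the fusion system is injective on automorphisms and
  keeps inner ones inner. Applying the inequalities also to the inverse morphism turns them into
  equalities in \<open>T_neq_E\<close>.\<close>

lemma card_F_InnS_le:
  assumes phi: "\<phi> \<in> F P Q" and im: "\<phi> ` P = Q"
  shows "card (F P P) \<le> card (F Q Q)" "card (InnS G P) \<le> card (InnS G Q)"
proof -
  have P: "subgroup P G" and Q: "subgroup Q G" using F_subgroup[OF phi] by auto
  have inj: "inj_on \<phi> P" using F_injhom[OF phi] by (simp add: injhom_def)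
  define \<psi> where "\<psi> = restrict (inv_into P \<phi>) Q"
  have psi: "\<psi> \<in> F Q P" using F_inv[OF phi] im by (simp add: \<psi>_def)
  have psi_phi: "\<psi> (\<phi> x) = x" if "x \<in> P" for x
    using that im inj by (auto simp: \<psi>_def)
  have phi_psi: "\<phi> (\<psi> y) = y" if "y \<in> Q" for y
    using that im by (auto simp: \<psi>_def f_inv_into_f)
  define \<Theta> where "\<Theta> = (\<lambda>\<chi>. restrict (\<phi> \<circ> (restrict (\<chi> \<circ> \<psi>) Q)) Q)"
  have \<Theta>_F: "\<Theta> \<chi> \<in> F Q Q" if "\<chi> \<in> F P P" for \<chi>
    unfolding \<Theta>_def using F_comp[OF F_comp[OF psi that] phi] .
  have inj\<Theta>: "inj_on \<Theta> (F P P)"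
  proof (rule inj_onI)
    fix \<chi> \<chi>' assume c: "\<chi> \<in> F P P" "\<chi>' \<in> F P P" and eq: "\<Theta> \<chi> = \<Theta> \<chi>'"
    show "\<chi> = \<chi>'"
    proof (rule F_ext[OF c])
      fix x assume x: "x \<in> P"
      have "\<phi> (\<chi> x) = \<phi> (\<chi>' x)"
        using fun_cong[OF eq, of "\<phi> x"] F_mem[OF phi x] psi_phi[OF x] by (simp add: \<Theta>_def)
      then show "\<chi> x = \<chi>' x" using inj F_mem[OF c(1) x] F_mem[OF c(2) x] by (simp add: inj_on_eq_iff)
    qed
  qed
  show "card (F P P) \<le> card (F Q Q)"
    by (rule card_inj_on_le[OF inj\<Theta> _ finite_F]) (use \<Theta>_F in auto)
  have InnF: "InnS G P \<subseteq> F P P" if "subgroup P G" for P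
    using F_conj_normS[OF that] normS_mem[OF that] by (auto simp: InnS_def)
  have "\<Theta> c \<in> InnS G Q" if "c \<in> InnS G P" for c
  proof -
    obtain g where g: "g \<in> P" "c = restrict (conjmap G g) P"
      using \<open>c \<in> InnS G P\<close> by (auto simp: InnS_def)
    have "\<Theta> c = restrict (conjmap G (\<phi> g)) Q"
    proof (rule F_ext)
      show "\<Theta> c \<in> F Q Q" using \<Theta>_F InnF[OF P] that by blast
      show "restrict (conjmap G (\<phi> g)) Q \<in> F Q Q"
        using F_conj_normS[OF Q] normS_mem[OF Q F_mem[OF phi g(1)]] by simp
      fix y assume y: "y \<in> Q"
      have py: "\<psi> y \<in> P" by (rule F_mem[OF psi y])
      have hom: "\<phi> (u \<otimes> v) = \<phi> u \<otimes> \<phi> v" if "u \<in> P" "v \<in> P" for u v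
        using F_injhom[OF phi] that by (simp add: injhom_def)
      have ig: "inv g \<in> P" using g subgroup.m_inv_closed[OF P] by blast
      have "\<phi> (inv g) \<otimes> \<phi> g = \<phi> \<one>" using hom[OF ig g(1)] subgroup.mem_carrier[OF P g(1)] by simp
      moreover have "\<phi> \<one> = \<one>"
        using hom[of \<one> \<one>] subgroup.one_closed[OF P] subgroup.mem_carrier[OF Q F_mem[OF phi, of \<one>]] by simp
      ultimately have inv: "\<phi> (inv g) = inv (\<phi> g)"
        using F_mem[OF phi] g ig subgroup.mem_carrier[OF Q] by (metis inv_equality)
      have "\<phi> (inv g \<otimes> \<psi> y \<otimes> g) = inv (\<phi> g) \<otimes> y \<otimes> \<phi> g"
        using hom g ig py phi_psi[OF y] inv subgroup.m_closed[OF P] by simp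
      then show "\<Theta> c y = restrict (conjmap G (\<phi> g)) Q y"
        using y g py by (simp add: \<Theta>_def conjmap_def)
    qed
    then show ?thesis using F_mem[OF phi g(1)] by (auto simp: InnS_def)
  qed
  then show "card (InnS G P) \<le> card (InnS G Q)"
    using card_inj_on_le[OF inj_on_subset[OF inj\<Theta> InnF[OF P]]] InnF[OF Q] finite_subset[OF _ finite_F]
    by (metis image_subsetI)
qed

end

subsection \<open>Essential subgroups of rank 2\<close>

context p_fusion_system
begin

text \<open>For a chain C \<le> B \<le> P, the automorphisms of \<open>P\<close> in \<open>F\<close>
  that act trivially on the cosets of \<open>B\<close> in \<open>P\<close> and of \<open>C\<close>
  in \<open>B\<close>.\<close>

definition stab :: "'a set \<Rightarrow> 'a set \<Rightarrow> 'a set \<Rightarrow> ('a \<Rightarrow> 'a) set" where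
  "stab P B C = {\<phi> \<in> F P P. (\<forall>x\<in>P. inv x \<otimes> \<phi> x \<in> B) \<and> (\<forall>x\<in>B. inv x \<otimes> \<phi> x \<in> C)}"

lemma subgroup_stab:
  assumes P: "subgroup P G" and B: "subgroup B G" "B \<subseteq> P" and C: "subgroup C G" "C \<subseteq> B"
  shows "subgroup (stab P B C) (AutGrp F P)"
proof -
  interpret A: group "AutGrp F P" by (rule group_AutGrp[OF P])
  interpret P: subgroup P G by (rule P)
  interpret B: subgroup B G by (rule B(1))
  interpret C: subgroup C G by (rule C(1))
  have stabB: "\<phi> x \<in> B" if "\<phi> \<in> stab P B C" "x \<in> B" for \<phi> x
  proof -
    have "\<phi> x = x \<otimes> (inv x \<otimes> \<phi> x)"
      using that B F_mem[of \<phi> P P x] by (auto simp: stab_def free_normalize)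
    moreover have "inv x \<otimes> \<phi> x \<in> B" using that C by (auto simp: stab_def)
    ultimately show ?thesis using that(2) B.m_closed by metis
  qed
  have step: "inv x \<otimes> z \<in> D"
    if "subgroup D G" "inv x \<otimes> y \<in> D" "inv y \<otimes> z \<in> D" "x \<in> carrier G" "y \<in> carrier G" "z \<in> carrier G"
    for D x y z
  proof -
    have "(inv x \<otimes> y) \<otimes> (inv y \<otimes> z) \<in> D" by (rule subgroup.m_closed[OF that(1-3)])
    then show ?thesis using that by (simp add: free_normalize)
  qed
  show ?thesis
  proof (rule A.subgroupI)
    show "stab P B C \<subseteq> carrier (AutGrp F P)" by (auto simp: stab_def)
    have "restrict id P \<in> stab P B C"
      using F_id[OF P] B by (auto simp: stab_def)
    then show "stab P B C \<noteq> {}" by blast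
    fix \<phi> assume phi: "\<phi> \<in> stab P B C"
    then have phiF: "\<phi> \<in> F P P" by (simp add: stab_def)
    let ?i = "inv\<^bsub>AutGrp F P\<^esub> \<phi>"
    have i: "?i \<in> F P P" "?i x \<in> P" "\<phi> (?i x) = x" if "x \<in> P" for x
      using aut_inv_apply[OF phiF that] by auto
    have inv_step: "inv x \<otimes> ?i x \<in> D" if D: "subgroup D G" "inv (?i x) \<otimes> \<phi> (?i x) \<in> D" "x \<in> P" for x D
    proof -
      have "inv (inv (?i x) \<otimes> x) \<in> D" using D i(3) subgroup.m_inv_closed by fastforce
      then show ?thesis using i(2)[OF D(3)] D(3) by (simp add: free_normalize)
    qed
    have iB: "?i x \<in> B" if x: "x \<in> B" for x
    proof -
      have xP: "x \<in> P" using x B by blast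
      have "inv (?i x) \<otimes> x \<in> B" using phi i[OF xP] by (auto simp: stab_def)
      then have "x \<otimes> inv (inv (?i x) \<otimes> x) \<in> B" using x by simp
      then show ?thesis using i(2)[OF xP] xP by (simp add: free_normalize)
    qed
    have "inv x \<otimes> ?i x \<in> B" if "x \<in> P" for x
      using phi i(2)[OF that] that by (intro inv_step[OF B(1)]) (auto simp: stab_def)
    moreover have "inv x \<otimes> ?i x \<in> C" if "x \<in> B" for x
      using phi iB[OF that] that B by (intro inv_step[OF C(1)]) (auto simp: stab_def)
    ultimately show "?i \<in> stab P B C" using i(1)[OF P.one_closed] unfolding stab_def by blast
    fix \<psi> assume psi: "\<psi> \<in> stab P B C"
    then have psiF: "\<psi> \<in> F P P" by (simp add: stab_def)
    have car: "\<phi> x \<in> carrier G" "\<psi> (\<phi> x) \<in> carrier G" "\<phi> x \<in> P" if "x \<in> P" for x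
      using F_mem[OF phiF that] F_mem[OF psiF F_mem[OF phiF that]] by auto
    have stabD: "inv x \<otimes> \<chi> x \<in> B" "x \<in> B \<Longrightarrow> inv x \<otimes> \<chi> x \<in> C" if "\<chi> \<in> stab P B C" "x \<in> P" for \<chi> x
      using that by (simp_all add: stab_def)
    have "inv x \<otimes> \<psi> (\<phi> x) \<in> B" if "x \<in> P" for x
      by (rule step[OF B(1) stabD(1)[OF phi that] stabD(1)[OF psi car(3)[OF that]]])
        (use car[OF that] that in auto)
    moreover have "inv x \<otimes> \<psi> (\<phi> x) \<in> C" if x: "x \<in> B" for x
    proof -
      have xP: "x \<in> P" using x B by blast
      show ?thesis
        by (rule step[OF C(1) stabD(2)[OF phi xP x] stabD(2)[OF psi car(3)[OF xP] stabB[OF phi x]]])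
          (use car[OF xP] xP in auto)
    qed
    moreover have "\<phi> \<otimes>\<^bsub>AutGrp F P\<^esub> \<psi> \<in> F P P" using F_comp[OF phiF psiF] by simp
    ultimately show "\<phi> \<otimes>\<^bsub>AutGrp F P\<^esub> \<psi> \<in> stab P B C" using B by (auto simp: stab_def)
  qed
qed

lemma normal_stab:
  assumes P: "subgroup P G" and B: "subgroup B G" "B \<subseteq> P" and C: "subgroup C G" "C \<subseteq> B"
    and inv: "\<And>\<phi>. \<phi> \<in> F P P \<Longrightarrow> \<phi> ` B = B" "\<And>\<phi>. \<phi> \<in> F P P \<Longrightarrow> \<phi> ` C = C"
  shows "stab P B C \<lhd> AutGrp F P"
proof -
  interpret A: group "AutGrp F P" by (rule group_AutGrp[OF P])
  interpret P: subgroup P G by (rule P)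
  show ?thesis
  proof (rule A.normal_invI[OF subgroup_stab[OF P B C]])
    fix \<sigma> \<phi> assume "\<sigma> \<in> carrier (AutGrp F P)" and phi: "\<phi> \<in> stab P B C"
    then have sigma: "\<sigma> \<in> F P P" and phiF: "\<phi> \<in> F P P" by (auto simp: stab_def)
    let ?i = "inv\<^bsub>AutGrp F P\<^esub> \<sigma>"
    have i: "?i \<in> F P P" using aut_inv_apply(4)[OF sigma P.one_closed] .
    let ?c = "\<sigma> \<otimes>\<^bsub>AutGrp F P\<^esub> \<phi> \<otimes>\<^bsub>AutGrp F P\<^esub> ?i"
    have cF: "?c \<in> F P P" using F_comp[OF F_comp[OF sigma phiF] i] by simp
    have c: "inv x \<otimes> ?c x = ?i (inv (\<sigma> x) \<otimes> \<phi> (\<sigma> x))" if "x \<in> P" for x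
    proof -
      have s: "\<sigma> x \<in> P" "\<phi> (\<sigma> x) \<in> P" using F_mem[OF sigma that] F_mem[OF phiF] by auto
      have "?i (inv (\<sigma> x) \<otimes> \<phi> (\<sigma> x)) = inv (?i (\<sigma> x)) \<otimes> ?i (\<phi> (\<sigma> x))"
        using sub_aut_simps(2,3)[OF P F_sub_aut[OF i]] s by simp
      then show ?thesis using aut_inv_apply(1)[OF sigma that] that by simp
    qed
    have "inv x \<otimes> ?c x \<in> B" if "x \<in> P" for x
      unfolding c[OF that] using phi F_mem[OF sigma that] inv(1)[OF i] by (auto simp: stab_def)
    moreover have "inv x \<otimes> ?c x \<in> C" if "x \<in> B" for x
    proof -
      have xP: "x \<in> P" using that B by blast
      have "\<sigma> x \<in> B" using inv(1)[OF sigma] that by blast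
      then show ?thesis unfolding c[OF xP] using phi inv(2)[OF i] by (auto simp: stab_def)
    qed
    ultimately show "?c \<in> stab P B C" using cF by (simp only: stab_def mem_Collect_eq) blast
  qed
qed

text \<open>The stabiliser of the chain \<open>frat P < B < P\<close> acts freely on the pairs \<open>(u, v)\<close> with
  \<open>u \<in> a B\<close> and \<open>v \<in> b frat P\<close>, since each such pair generates \<open>P\<close>.\<close>
lemma card_stab:
  assumes P: "subgroup P G" and card_P: "card P = p\<^sup>2 * card (frat G p P)"
    and B: "subgroup B G" "frat G p P \<subset> B" "B \<subset> P"
  shows "\<exists>k. card (stab P B (frat G p P)) = p ^ k"
proof -
  let ?C = "frat G p P" and ?S = "stab P B (frat G p P)"
  interpret P: subgroup P G by (rule P)
  interpret B: subgroup B G by (rule B(1))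
  have C: "subgroup ?C G" by (rule subgroup_compow) (use P.subset in auto)
  interpret C: subgroup ?C G by (rule C)
  interpret A: group "AutGrp F P" by (rule group_AutGrp[OF P])
  have S: "subgroup ?S (AutGrp F P)" using B C by (intro subgroup_stab[OF P]) auto
  interpret S: group "(AutGrp F P)\<lparr>carrier := ?S\<rparr>" by (rule A.subgroup_imp_group[OF S])
  interpret Pg: finite_p_group "G\<lparr>carrier := P\<rparr>" p by (rule finite_p_group_subgroup[OF P])
  \<comment> \<open>The total index is p^2, so both steps of the chain have index exactly p.\<close>
  have pC: "p * card ?C \<le> card B" using subgroup_card_step[OF C B(1,2)] by simp
  have pB: "p * card B \<le> card P" using subgroup_card_step[OF B(1) P B(3)] by simp
  have PB: "card P \<le> p * card B"
    using card_P mult_le_mono2[OF pC, of p] by (simp add: power2_eq_square mult.assoc)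
  have BC: "card B \<le> p * card ?C"
  proof -
    have "p * card B \<le> p * (p * card ?C)" using pB card_P by (simp only: power2_eq_square mult.assoc)
    then show ?thesis using p_gt_1 by simp
  qed
  obtain a where a: "a \<in> P" "a \<notin> B" using B(3) by blast
  obtain b where b: "b \<in> B" "b \<notin> ?C" using B(2) by blast
  have bP: "b \<in> P" using b B by blast
  define \<Omega> where "\<Omega> = {u \<in> P. inv a \<otimes> u \<in> B} \<times> {v \<in> P. inv b \<otimes> v \<in> ?C}"
  have card_coset: "card {u \<in> P. inv x \<otimes> u \<in> D} = card D" if "x \<in> P" "D \<subseteq> P" for x D
  proof (rule bij_betw_same_card[of "\<lambda>u. inv x \<otimes> u"], rule bij_betw_byWitness[where f' = "\<lambda>d. x \<otimes> d"])
  qed (use that in \<open>auto simp: mult_inv_cancel subset_iff\<close>)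
  have card_\<Omega>: "card \<Omega> = card B * card ?C"
    unfolding \<Omega>_def card_cartesian_product using card_coset[OF a(1)] card_coset[OF bP] B by auto
  \<comment> \<open>\<open>v\<close> is in \<open>B\<close> but not in \<open>?C\<close>, and
    \<open>u\<close> is not in \<open>B\<close>. Together with \<open>?C\<close>, first
    \<open>v\<close> yields \<open>B\<close> and then \<open>u\<close> yields \<open>P\<close>; as
    the Frattini subgroup, \<open>?C\<close> can be omitted.\<close>
  have gen: "generate G {u, v} = P" if "(u, v) \<in> \<Omega>" for u v
  proof -
    have u: "u \<in> P" "inv a \<otimes> u \<in> B" and v: "v \<in> P" "inv b \<otimes> v \<in> ?C" using that by (auto simp: \<Omega>_def)
    have uB: "u \<notin> B"
    proof
      assume "u \<in> B"
      then have "u \<otimes> inv (inv a \<otimes> u) \<in> B" using u by simp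
      then show False using a u by (simp add: free_normalize)
    qed
    have vC: "v \<notin> ?C"
    proof
      assume "v \<in> ?C"
      then have "v \<otimes> inv (inv b \<otimes> v) \<in> ?C" using v by simp
      then show False using b bP v by (simp add: free_normalize)
    qed
    have vB: "v \<in> B"
    proof -
      have "b \<otimes> (inv b \<otimes> v) \<in> B" using b v B(2) by blast
      then show ?thesis using bP v by (simp add: free_normalize)
    qed
    let ?L = "generate G ({u, v} \<union> ?C)"
    have sub: "{u, v} \<union> ?C \<subseteq> P" using u v B by blast
    have L: "subgroup ?L G" by (rule generate_is_subgroup) (use sub P.subset in blast)
    have mem: "u \<in> ?L" "v \<in> ?L" "?C \<subseteq> ?L" by (auto intro: generate.incl)
    have LP: "?L \<subseteq> P" by (rule generate_subgroup_incl[OF sub P])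
    have "?L \<inter> B = B"
      by (rule subgroup_eq_of_index_p[OF C subgroups_Inter_pair[OF L B(1)] B(1) _ _ BC])
        (use mem vB vC B in auto)
    then have "?L = P"
      by (intro subgroup_eq_of_index_p[OF B(1) L P _ LP PB]) (use mem uB in auto)
    then have "P \<subseteq> generate (G\<lparr>carrier := P\<rparr>) ({u, v} \<union> ?C)"
      unfolding generate_consistent[OF sub P] by simp
    then have "generate (G\<lparr>carrier := P\<rparr>) {u, v} = P"
      using Pg.frat_nongenerating[of "{u, v}"] u v frat_consistent[OF P order.refl, of p] by simp
    then show ?thesis using generate_consistent[of "{u, v}" P] u v P by simp
  qed
  have "card (carrier ((AutGrp F P)\<lparr>carrier := ?S\<rparr>)) dvd card \<Omega>"
  proof (rule card_dvd_card_free_action[OF S.is_group, where act = "\<lambda>\<phi> (u, v). (\<phi> u, \<phi> v)"])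
    show "finite (carrier ((AutGrp F P)\<lparr>carrier := ?S\<rparr>))"
      using finite_subset[OF _ finite_F[of P]] by (auto simp: stab_def)
    show "finite \<Omega>" unfolding \<Omega>_def using finite_subgroup[OF P] by simp
    fix \<phi> w assume "\<phi> \<in> carrier ((AutGrp F P)\<lparr>carrier := ?S\<rparr>)" and w: "w \<in> \<Omega>"
    then have phi: "\<phi> \<in> ?S" by simp
    then have phiF: "\<phi> \<in> F P P" by (simp add: stab_def)
    obtain u v where uv: "w = (u, v)" by fastforce
    have u: "u \<in> P" "inv a \<otimes> u \<in> B" and v: "v \<in> P" "inv b \<otimes> v \<in> ?C" using w uv by (auto simp: \<Omega>_def)
    have vB: "v \<in> B"
    proof -
      have "b \<otimes> (inv b \<otimes> v) \<in> B" using b v B(2) by blast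
      then show ?thesis using bP v by (simp add: free_normalize)
    qed
    have pu: "\<phi> u \<in> P" "\<phi> v \<in> P" using F_mem[OF phiF] u v by auto
    have "(inv a \<otimes> u) \<otimes> (inv u \<otimes> \<phi> u) \<in> B" using phi u by (auto simp: stab_def)
    moreover have "(inv b \<otimes> v) \<otimes> (inv v \<otimes> \<phi> v) \<in> ?C" using phi v vB by (auto simp: stab_def)
    ultimately show "(case w of (u, v) \<Rightarrow> (\<phi> u, \<phi> v)) \<in> \<Omega>"
      using pu u v a bP by (simp add: uv \<Omega>_def free_normalize)
    assume "(case w of (u, v) \<Rightarrow> (\<phi> u, \<phi> v)) = w"
    then have fix_uv: "\<phi> u = u" "\<phi> v = v" by (auto simp: uv)
    have fixed: "\<phi> x = x" if "x \<in> generate G {u, v}" for x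
      using that
    proof (induction x rule: generate.induct)
      case one
      then show ?case
        using sub_aut_simps(3)[OF P F_sub_aut[OF phiF]] sub_aut_simps(4)[OF P F_sub_aut[OF phiF] u(1), of 0] by simp
    next
      case (incl h)
      then show ?case using fix_uv by auto
    next
      case (inv h)
      then have "h \<in> P" "\<phi> h = h" using fix_uv u v by auto
      then show ?case using sub_aut_simps(3)[OF P F_sub_aut[OF phiF]] by simp
    next
      case (eng h1 h2)
      have "h1 \<in> P" "h2 \<in> P" using eng.hyps gen[of u v] w uv by auto
      then show ?case using eng.IH sub_aut_simps(2)[OF P F_sub_aut[OF phiF]] by simp
    qed
    have "\<phi> = restrict id P"
      by (rule F_ext[OF phiF F_id[OF P]]) (use fixed gen[of u v] w uv in simp)
    then show "\<phi> = \<one>\<^bsub>(AutGrp F P)\<lparr>carrier := ?S\<rparr>\<^esub>" by simp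
  next
    show "(case w of (u, v) \<Rightarrow> (\<one>\<^bsub>(AutGrp F P)\<lparr>carrier := ?S\<rparr>\<^esub> u, \<one>\<^bsub>(AutGrp F P)\<lparr>carrier := ?S\<rparr>\<^esub> v)) = w"
      if "w \<in> \<Omega>" for w
      using that by (auto simp: \<Omega>_def)
    show "(case w of (u, v) \<Rightarrow> ((\<phi> \<otimes>\<^bsub>(AutGrp F P)\<lparr>carrier := ?S\<rparr>\<^esub> \<psi>) u, (\<phi> \<otimes>\<^bsub>(AutGrp F P)\<lparr>carrier := ?S\<rparr>\<^esub> \<psi>) v)) =
      (case (case w of (u, v) \<Rightarrow> (\<phi> u, \<phi> v)) of (u, v) \<Rightarrow> (\<psi> u, \<psi> v))" if "w \<in> \<Omega>" for \<phi> \<psi> w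
      using that by (auto simp: \<Omega>_def)
  qed
  moreover obtain i j where "card B = p ^ i" "card ?C = p ^ j"
    using card_subgroup_power[OF B(1)] card_subgroup_power[OF C] by metis
  ultimately have "card ?S dvd p ^ (i + j)" by (simp add: card_\<Omega> power_add)
  then show ?thesis using prime_p divides_primepow_nat by blast
qed

end

section \<open>Consequences of the strongly p-embedded subgroup\<close>

locale essential_rank_2 = p_fusion_system +
  fixes E :: "'a set"
  assumes saturated: "saturated_fusion_system p G F" and ess: "essential p G F E" and rank: "grank G E = 2"
begin

abbreviation "T \<equiv> normS G E"
abbreviation "Q \<equiv> frat G p E"

lemma E_sub: "subgroup E G" using ess by (simp add: essential_def)
lemma T_sub: "subgroup T G" by (rule subgroup_normS[OF E_sub])
lemma E_T: "E \<subseteq> T" using normS_mem[OF E_sub] by blast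
lemma E_carrier: "E \<subseteq> carrier G" using E_sub by (rule subgroup.subset)
lemma Q_sub: "subgroup Q G" using E_carrier by (intro subgroup_compow)
lemma Q_E: "Q \<subseteq> E" by (rule frat_subset[OF E_sub])

lemma frattini_E: "frattini G E = Q" "card E = p\<^sup>2 * card Q"
proof -
  interpret Eg: finite_p_group "G\<lparr>carrier := E\<rparr>" p by (rule finite_p_group_subgroup[OF E_sub])
  have "grank (G\<lparr>carrier := E\<rparr>) (carrier (G\<lparr>carrier := E\<rparr>)) = 2"
    using rank grank_consistent[OF E_sub] by simp
  from Eg.frattini_rank_2[OF this] show "frattini G E = Q" "card E = p\<^sup>2 * card Q"
    using frattini_consistent[OF E_sub] frat_consistent[OF E_sub order.refl, of p] by simp_all
qed

lemma Q_neq_E: "Q \<noteq> E"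
proof
  assume *: "Q = E"
  have "p\<^sup>2 > 1" by (rule one_less_power[OF p_gt_1]) simp
  moreover have "card E > 0" by (rule subgroup_card_pos[OF E_sub])
  ultimately show False using frattini_E(2) unfolding * by simp
qed

lemma aut_image:
  assumes "\<phi> \<in> F E E"
  shows "\<phi> ` E = E" "\<phi> ` Q = Q"
proof -
  show 1: "\<phi> ` E = E" using F_sub_aut[OF assms] by (simp add: sub_aut_def bij_betw_def)
  show "\<phi> ` Q = Q"
    using sub_aut_image_compow[OF E_sub F_sub_aut[OF assms], of E E] 1 by simp
qed

lemma card_Out: "card (carrier (OutGrp G F E)) * card (InnS G E) = card (F E E)"
proof -
  interpret A: group "AutGrp F E" by (rule group_AutGrp[OF E_sub])
  show ?thesis
    using A.lagrange[OF normal_imp_subgroup[OF InnS_normal[OF E_sub]]]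
    by (simp add: OutGrp_def FactGroup_def order_def)
qed

lemma group_Out: "group (OutGrp G F E)"
  unfolding OutGrp_def by (rule normal.factorgroup_is_group[OF InnS_normal[OF E_sub]])

lemma finite_Out: "finite (carrier (OutGrp G F E))"
  by (simp add: OutGrp_def FactGroup_def RCOSETS_def finite_F)

lemma p_dvd_Out: "p dvd card (carrier (OutGrp G F E))"
proof -
  obtain H where H: "strongly_p_embedded (OutGrp G F E) p H" using ess by (auto simp: essential_def)
  interpret O: group "OutGrp G F E" by (rule group_Out)
  have "card H dvd card (carrier (OutGrp G F E))"
    using H by (intro O.card_subgroup_dvd O.subgroup_self) (auto simp: strongly_p_embedded_def dest: subgroup.subset)
  moreover have "p dvd card H" using H by (simp add: strongly_p_embedded_def)
  ultimately show ?thesis by (rule dvd_trans[rotated])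
qed

text \<open>Saturation provides a fully automized conjugate \<open>P\<close> of \<open>E\<close>. If
  \<open>E\<close> were its own normalizer, maximality of the order of \<open>T\<close> would make
  \<open>P\<close> its own normalizer, so the inner automorphisms would form a Sylow p-subgroup of
  the automorphism group of \<open>P\<close>. The outer automorphism group, of the same order for
  \<open>P\<close> and \<open>E\<close>, would then have order prime to p.\<close>

lemma T_neq_E: "T \<noteq> E"
proof
  assume TE: "T = E"
  obtain P where P: "P \<in> Fclass F G E" "fully_automized p G F P"
    using saturated E_sub unfolding saturated_fusion_system_def by blast
  obtain \<phi> where phi0: "\<phi> \<in> F E (carrier G)" and P_eq: "P = \<phi> ` E" using P(1) by (auto simp: Fclass_def)
  have Ps: "subgroup P G" using F_subgroup[OF F_inv[OF phi0]] P_eq by simp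
  have phi: "\<phi> \<in> F E P" using F_codomain[OF phi0 Ps] P_eq by simp
  have psi: "restrict (inv_into E \<phi>) P \<in> F P E" using F_inv[OF phi0] P_eq by simp
  have inj: "inj_on \<phi> E" using F_injhom[OF phi] by (simp add: injhom_def)
  have psi_im: "restrict (inv_into E \<phi>) P ` P = E" using inj P_eq by (auto simp: image_iff)
  have card_F: "card (F P P) = card (F E E)" and card_Inn: "card (InnS G P) = card (InnS G E)"
    using card_F_InnS_le[OF phi P_eq[symmetric]] card_F_InnS_le[OF psi psi_im] by auto
  have "card (normS G P) \<le> card T" using ess P(1) by (auto simp: essential_def)
  moreover have "card P = card E" using inj P_eq by (simp add: card_image)
  ultimately have "card (normS G P) \<le> card P" using TE by simp
  then have NP: "normS G P = P"
    using normS_mem[OF Ps] finite_subgroup[OF subgroup_normS[OF Ps]] by (intro card_seteq[symmetric]) auto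
  have "HomS G P P = InnS G P"
  proof
    show "HomS G P P \<subseteq> InnS G P"
    proof
      fix c assume "c \<in> HomS G P P"
      then obtain g where g: "g \<in> carrier G" "conjmap G g ` P \<subseteq> P" "c = restrict (conjmap G g) P"
        by (auto simp: HomS_def)
      have "inj_on (conjmap G g) P"
        using g(1) subgroup.mem_carrier[OF Ps] by (auto simp: conjmap_def intro!: inj_onI)
      then have "conjmap G g ` P = P" using g(2) finite_subgroup[OF Ps] by (simp add: endo_inj_surj)
      then have "g \<in> P" using g NP by (auto simp: normS_def)
      then show "c \<in> InnS G P" using g by (auto simp: InnS_def)
    qed
    show "InnS G P \<subseteq> HomS G P P"
      using normS_mem[OF Ps] subgroup.mem_carrier[OF Ps] by (fastforce simp: InnS_def HomS_def normS_def)
  qed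
  then have "\<not> p dvd card (F P P) div card (InnS G P)"
    using P(2) by (simp add: fully_automized_def sylow_subgroup_def)
  moreover have "card (F E E) div card (InnS G E) = card (carrier (OutGrp G F E))"
  proof -
    have "restrict (conjmap G \<one>) E \<in> InnS G E" using subgroup.one_closed[OF E_sub] by (auto simp: InnS_def)
    moreover have "finite (InnS G E)" using finite_subgroup[OF E_sub] by (auto simp: InnS_def Setcompr_eq_image)
    ultimately have "card (InnS G E) > 0" by (auto simp: card_gt_0_iff)
    then show ?thesis by (simp flip: card_Out)
  qed
  ultimately show False using p_dvd_Out card_F card_Inn by simp
qed

text \<open>The image of \<open>N\<close> in \<open>OutGrp\<close> is a normal p-subgroup, and
  beside a strongly p-embedded subgroup such an image is trivial.\<close>

lemma normal_p_subgroup_inner: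
  assumes N: "N \<lhd> AutGrp F E" and Inn: "InnS G E \<subseteq> N" and card_N: "card N = p ^ k"
  shows "N = InnS G E"
proof -
  let ?A = "AutGrp F E" and ?I = "InnS G E"
  interpret A: group ?A by (rule group_AutGrp[OF E_sub])
  interpret I: normal ?I ?A by (rule InnS_normal[OF E_sub])
  interpret N: normal N ?A by (rule N)
  interpret Ng: group "?A\<lparr>carrier := N\<rparr>" by (rule A.subgroup_imp_group[OF N.subgroup_axioms])
  interpret q: group_hom ?A "?A Mod ?I" "\<lambda>x. ?I #>\<^bsub>?A\<^esub> x" by (rule I.group_hom_Mod)
  let ?N = "(\<lambda>x. ?I #>\<^bsub>?A\<^esub> x) ` N"
  have nN: "?N \<lhd> OutGrp G F E"
    unfolding OutGrp_def
    by (rule N.surj_hom_normal_subgroup[OF q.group_hom_axioms]) (auto simp: FactGroup_def RCOSETS_def)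
  have "?N = rcosets\<^bsub>?A\<lparr>carrier := N\<rparr>\<^esub> ?I" by (auto simp: RCOSETS_def)
  then have "card ?N * card ?I = p ^ k"
    using Ng.lagrange[OF A.subgroup_incl[OF I.subgroup_axioms N.subgroup_axioms Inn]] card_N
    by (simp add: order_def)
  then have "card ?N dvd p ^ k" by (metis dvd_triv_left)
  then obtain j where j: "card ?N = p ^ j" using prime_p divides_primepow_nat by blast
  obtain H where H: "strongly_p_embedded (OutGrp G F E) p H" using ess by (auto simp: essential_def)
  interpret O: group "OutGrp G F E" by (rule group_Out)
  have "?N = {\<one>\<^bsub>OutGrp G F E\<^esub>}"
    by (rule O.strongly_p_embedded_normal_p_subgroup[OF finite_Out prime_p odd_p H nN j])
  then have "?I #>\<^bsub>?A\<^esub> x = \<one>\<^bsub>?A Mod ?I\<^esub>" if "x \<in> N" for x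
    using that unfolding OutGrp_def by blast
  then have "x \<in> ?I" if "x \<in> N" for x
    using that I.coset_eq_one_iff[of x] N.mem_carrier[OF that] by simp
  then have "N \<subseteq> ?I" by (rule subsetI)
  then show ?thesis using Inn by blast
qed

text \<open>Invariance of \<open>B\<close> makes the stability group normal, and
  \<open>card_stab\<close> makes its order a power of p, so \<open>normal_p_subgroup_inner\<close>
  applies.\<close>

lemma stab_eq_Inn:
  assumes B: "subgroup B G" "Q \<subseteq> B" "B \<subset> E" "\<And>\<phi>. \<phi> \<in> F E E \<Longrightarrow> \<phi> ` B = B"
  shows "stab E B Q = InnS G E"
proof -
  interpret A: group "AutGrp F E" by (rule group_AutGrp[OF E_sub])
  have Qc: "Q \<subseteq> carrier G" using Q_sub subgroup.subset by blast
  have Inn: "InnS G E \<subseteq> stab E Q Q"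
  proof
    fix c assume "c \<in> InnS G E"
    then obtain g where g: "g \<in> E" "c = restrict (conjmap G g) E" by (auto simp: InnS_def)
    have "inv x \<otimes> c x \<in> Q" if "x \<in> E" for x
    proof -
      have "inv x \<otimes> c x = commr G x g"
        using that g E_carrier by (auto simp: conjmap_def commr_def m_assoc subset_iff)
      then show ?thesis using commr_in_compow[OF that g(1)] by simp
    qed
    then show "c \<in> stab E Q Q"
      using g F_conj_normS[OF E_sub] normS_mem[OF E_sub] Q_E by (auto simp: stab_def)
  qed
  have mono: "stab E Q Q \<subseteq> stab E B' Q" if "Q \<subseteq> B'" "B' \<subseteq> E" for B'
    using that by (auto simp: stab_def)
  have power: "\<exists>k. card (stab E B' Q) = p ^ k" if B': "subgroup B' G" "Q \<subseteq> B'" "B' \<subset> E" for B'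
  proof (cases "B' = Q")
    case False
    then have "Q \<subset> B'" using B' by blast
    then show ?thesis by (rule card_stab[OF E_sub frattini_E(2) B'(1) _ B'(3)])
  next
    case True
    \<comment> \<open>\<open>card_stab\<close> needs a proper middle term, which
      \<open>B' = Q\<close> is not. Any \<open>D\<close> strictly between \<open>Q\<close> and
      \<open>E\<close> helps, invariant or not: what acts trivially on \<open>E/Q\<close> also
      stabilizes the chain through \<open>D\<close>, and divisors of a power of p are powers of
      p.\<close>
    interpret Eg: finite_p_group "G\<lparr>carrier := E\<rparr>" p by (rule finite_p_group_subgroup[OF E_sub])
    obtain b where b: "b \<in> E" "b \<notin> Q" using Q_E Q_neq_E by blast
    have fr: "frat (G\<lparr>carrier := E\<rparr>) p E = Q" by (rule frat_consistent[OF E_sub order.refl])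
    obtain D where D: "subgroup D (G\<lparr>carrier := E\<rparr>)" "Q \<subseteq> D" "b \<in> D" "card D \<le> p * card Q"
      using Eg.adjoin_mod_frat[OF subgroup_incl[OF Q_sub E_sub Q_E], of b] b(1)
      unfolding partial_object.select_convs(1) partial_object.simps(1) by (auto simp: fr)
    have Ds: "subgroup D G" "D \<subseteq> E" using incl_subgroup[OF E_sub D(1)] subgroup.subset[OF D(1)] by auto
    have "D \<noteq> E"
    proof
      assume "D = E"
      then have "p * (p * card Q) \<le> p * card Q" using D(4) frattini_E(2) by (simp add: power2_eq_square mult.assoc)
      then show False using p_gt_1 subgroup_card_pos[OF Q_sub] by simp
    qed
    then obtain k where k: "card (stab E D Q) = p ^ k"
    proof -
      have "Q \<subset> D" "D \<subset> E" using b D Ds \<open>D \<noteq> E\<close> by auto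
      then show ?thesis using card_stab[OF E_sub frattini_E(2) Ds(1)] that by blast
    qed
    have "card (stab E Q Q) dvd card (stab E D Q)"
      by (rule A.card_subgroup_dvd) (use subgroup_stab[OF E_sub] Q_sub Q_E Ds D mono in auto)
    then have "card (stab E B' Q) dvd p ^ k" unfolding k True .
    then show ?thesis using prime_p divides_primepow_nat by blast
  qed
  obtain k where "card (stab E B Q) = p ^ k" using power[OF B(1-3)] by blast
  then show ?thesis
    by (intro normal_p_subgroup_inner)
      (use normal_stab[OF E_sub B(1) _ Q_sub B(2,4) aut_image(2)] B(3) Inn mono[OF B(2)] in auto)
qed

text \<open>If \<open>t\<close> acts on \<open>E\<close> like \<open>g \<in> E\<close>, then
  \<open>t \<otimes> inv g\<close> centralizes \<open>E\<close>, and an essential subgroup contains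
  its centralizer.\<close>

lemma normS_inner_imp_mem:
  assumes t: "t \<in> T" and inner: "restrict (conjmap G t) E \<in> InnS G E"
  shows "t \<in> E"
proof -
  obtain g where g: "g \<in> E" "restrict (conjmap G t) E = restrict (conjmap G g) E"
    using inner by (auto simp: InnS_def)
  have tc: "t \<in> carrier G" and gc: "g \<in> carrier G" using t g E_carrier by (auto simp: normS_def)
  have "t \<otimes> inv g \<in> centS G E"
  proof -
    have "(t \<otimes> inv g) \<otimes> x = x \<otimes> (t \<otimes> inv g)" if x: "x \<in> E" for x
    proof -
      have xc: "x \<in> carrier G" using x E_carrier by blast
      have "inv t \<otimes> x \<otimes> t = inv g \<otimes> x \<otimes> g"
        using fun_cong[OF g(2), of x] x by (simp add: conjmap_def)
      then have "t \<otimes> (inv t \<otimes> x \<otimes> t) \<otimes> inv g = t \<otimes> (inv g \<otimes> x \<otimes> g) \<otimes> inv g" by simp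
      then show ?thesis using tc gc xc by (simp add: free_normalize)
    qed
    then show ?thesis using tc gc by (simp add: centS_def)
  qed
  moreover have "E \<in> Fclass F G E"
  proof -
    have "restrict id E \<in> F E (carrier G)"
      using F_codomain[OF F_id[OF E_sub] subgroup_self] E_carrier by simp
    then show ?thesis unfolding Fclass_def by (intro CollectI exI[of _ "restrict id E"]) simp
  qed
  ultimately have "t \<otimes> inv g \<in> E" using ess by (auto simp: essential_def)
  then have "t \<otimes> inv g \<otimes> g \<in> E" using g subgroup.m_closed[OF E_sub] by blast
  then show ?thesis using tc gc by (simp add: m_assoc)
qed

end

section \<open>The action of the normalizer of \<open>E\<close>\<close>

context essential_rank_2
begin

abbreviation "GT \<equiv> G\<lparr>carrier := T\<rparr>"

text \<open>Conjugation by such a \<open>t\<close> belongs to the stability group of the chain,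
  hence is inner. As \<open>T\<close> is larger than \<open>E\<close>, this excludes that all of
  \<open>T\<close> acts trivially on the sections of an invariant chain.\<close>

lemma mem_E_of_unipotent:
  assumes B: "subgroup B G" "Q \<subseteq> B" "B \<subset> E" "\<And>\<phi>. \<phi> \<in> F E E \<Longrightarrow> \<phi> ` B = B"
    and t: "t \<in> T" and comm: "\<And>e. e \<in> E \<Longrightarrow> commr G e t \<in> B" "\<And>e. e \<in> B \<Longrightarrow> commr G e t \<in> Q"
  shows "t \<in> E"
proof (rule normS_inner_imp_mem[OF t])
  have tc: "t \<in> carrier G" using t by (simp add: normS_def)
  have "inv x \<otimes> conjmap G t x = commr G x t" if "x \<in> E" for x
    using that tc E_carrier by (auto simp: conjmap_def commr_def m_assoc subset_iff)
  then have "restrict (conjmap G t) E \<in> stab E B Q"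
    using F_conj_normS[OF E_sub t] comm B(3) by (auto simp: stab_def)
  then show "restrict (conjmap G t) E \<in> InnS G E" by (simp add: stab_eq_Inn[OF B])
qed

lemma finite_p_group_T: "finite_p_group GT p"
  by (rule finite_p_group_subgroup[OF T_sub])

text \<open>Elements of \<open>T\<close> act on \<open>E\<close> by morphisms in
  \<open>F E E\<close>, which leave \<open>B\<close> invariant.\<close>

lemma normal_in_T:
  assumes B: "subgroup B G" "B \<subseteq> E" "\<And>\<phi>. \<phi> \<in> F E E \<Longrightarrow> \<phi> ` B = B"
  shows "B \<lhd> GT"
proof -
  interpret Tg: group GT by (rule subgroup_imp_group[OF T_sub])
  show ?thesis
  proof (rule Tg.normal_invI)
    show "subgroup B GT" using B E_T by (intro subgroup_incl[OF B(1) T_sub]) auto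
    fix x h assume "x \<in> carrier GT" and h: "h \<in> B"
    then have x: "x \<in> T" by simp
    then have xi: "inv x \<in> T" by (rule subgroup.m_inv_closed[OF T_sub])
    have "restrict (conjmap G (inv x)) E h \<in> B"
      using B(3)[OF F_conj_normS[OF E_sub xi]] h by blast
    then show "x \<otimes>\<^bsub>GT\<^esub> h \<otimes>\<^bsub>GT\<^esub> inv\<^bsub>GT\<^esub> x \<in> B"
      using h B(2) x subgroup.mem_carrier[OF T_sub x] m_inv_consistent[OF T_sub x]
      by (auto simp: conjmap_def subset_iff)
  qed
qed

lemma commr_T: "x \<in> E \<Longrightarrow> t \<in> T \<Longrightarrow> commr GT x t = commr G x t"
  using E_T by (intro commr_consistent[OF T_sub]) auto

text \<open>\<open>T\<close> acts on the section \<open>E/Q\<close> of order p^2, so the kernel has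
  index at most p; by \<open>mem_E_of_unipotent\<close> with \<open>B = Q\<close> the kernel lies in
  \<open>E\<close>.\<close>

lemma card_T: "card T = p * card E"
proof (rule antisym)
  interpret Tg: finite_p_group GT p by (rule finite_p_group_T)
  have Q_norm: "Q \<lhd> GT" by (rule normal_in_T[OF Q_sub Q_E aut_image(2)])
  have "cenmod GT Q T E \<subseteq> E"
  proof
    fix t assume t: "t \<in> cenmod GT Q T E"
    then have tT: "t \<in> T" by (simp add: cenmod_def)
    have "commr G e t \<in> Q" if e: "e \<in> E" for e
    proof -
      have "e \<in> T" using e E_T by blast
      then have "commr GT t e \<in> Q \<longleftrightarrow> commr GT e t \<in> Q"
        using tT by (intro Tg.commr_mem_iff[OF normal_imp_subgroup[OF Q_norm]]) auto
      then show ?thesis using t e commr_T[OF e tT] by (simp add: cenmod_def)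
    qed
    then show "t \<in> E"
      using Q_E Q_neq_E by (intro mem_E_of_unipotent[OF Q_sub order.refl _ aut_image(2) tT]) auto
  qed
  then have "card (cenmod GT Q T E) \<le> card E"
    by (rule card_mono[OF finite_subgroup[OF E_sub]])
  moreover have "card T \<le> p * card (cenmod GT Q T E)"
    using Tg.card_centralizer_mod[OF Q_norm normal_in_T[OF E_sub order.refl aut_image(1)] Q_E]
      frattini_E(2) Tg.subgroup_self by simp
  ultimately show "card T \<le> p * card E" by (meson le_trans mult_le_mono2)
  show "p * card E \<le> card T"
    using E_T T_neq_E by (intro subgroup_card_step(2)[OF E_sub T_sub]) auto
qed

text \<open>A proper invariant \<open>B\<close> would give sections \<open>E/B\<close> and
  \<open>B/Q\<close> of order p, which the p-group \<open>T\<close> centralizes; then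
  \<open>T\<close> would be contained in \<open>E\<close>.\<close>

lemma F_E_irreducible:
  assumes B: "subgroup B G" "Q \<subseteq> B" "B \<subseteq> E" "\<And>\<phi>. \<phi> \<in> F E E \<Longrightarrow> \<phi> ` B = B"
  shows "B = Q \<or> B = E"
proof (rule ccontr)
  assume "\<not> (B = Q \<or> B = E)"
  then have BE: "B \<subset> E" and QB: "Q \<subset> B" using B by auto
  interpret Tg: finite_p_group GT p by (rule finite_p_group_T)
  have Q_norm: "Q \<lhd> GT" by (rule normal_in_T[OF Q_sub Q_E aut_image(2)])
  have B_norm: "B \<lhd> GT" by (rule normal_in_T[OF B(1,3,4)])
  have E_norm: "E \<lhd> GT" by (rule normal_in_T[OF E_sub order.refl aut_image(1)])
  have pQ: "p * card Q \<le> card B" by (rule subgroup_card_step(2)[OF Q_sub B(1) QB])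
  have pB: "p * card B \<le> card E" by (rule subgroup_card_step(2)[OF B(1) E_sub BE])
  have EB: "card E \<le> p * card B"
    unfolding frattini_E(2) using mult_le_mono2[OF pQ, of p] by (simp only: power2_eq_square mult.assoc)
  have BQ: "card B \<le> p * card Q"
  proof -
    have "p * card B \<le> p * (p * card Q)"
      using pB unfolding frattini_E(2) by (simp only: power2_eq_square mult.assoc)
    then show ?thesis using p_gt_1 by simp
  qed
  have "t \<in> E" if t: "t \<in> T" for t
  proof (rule mem_E_of_unipotent[OF B(1,2) BE B(4) t])
    show "commr G e t \<in> B" if "e \<in> E" for e
      using Tg.commr_of_index_p[OF B_norm E_norm B(3) EB that, of t] t commr_T[OF that t] by simp
    show "commr G e t \<in> Q" if "e \<in> B" for e
      using Tg.commr_of_index_p[OF Q_norm B_norm B(2) BQ that, of t] t commr_T[of e t] that B(3) by auto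
  qed
  then show False using E_T T_neq_E by blast
qed

text \<open>If \<open>E\<close> is normal in the whole group, the automorphism comes from the
  failure to be F-characteristic. Otherwise normalizers grow: some \<open>g\<close> outside
  \<open>T\<close> normalizes \<open>T\<close>, and it moves \<open>E\<close> because
  \<open>T\<close> is the full normalizer of \<open>E\<close>.\<close>

lemma exists_moving_automorphism:
  assumes "\<not> F_characteristic G F E"
  obtains \<alpha> where "sub_aut G T \<alpha>" "\<alpha> ` E \<noteq> E"
proof (cases "T = carrier G")
  case True
  obtain \<alpha> where "\<alpha> \<in> F (carrier G) (carrier G)" "\<alpha> ` E \<noteq> E"
    using assms by (auto simp: F_characteristic_def)
  then show ?thesis using F_sub_aut[of \<alpha> "carrier G"] True by (intro that[of \<alpha>]) simp_all
next
  case False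
  obtain g where g: "g \<in> carrier G" "g \<notin> T" "\<And>h. h \<in> T \<Longrightarrow> inv g \<otimes> h \<otimes> g \<in> T"
    using normalizer_grows[OF T_sub False] by blast
  have Tc: "x \<in> carrier G" if "x \<in> T" for x using that subgroup.mem_carrier[OF T_sub] by blast
  have "inj_on (conjmap G g) T" using g(1) Tc by (auto simp: conjmap_def intro!: inj_onI)
  moreover have "conjmap G g ` T \<subseteq> T" using g(3) by (auto simp: conjmap_def)
  ultimately have "bij_betw (conjmap G g) T T"
    using finite_subgroup[OF T_sub] by (simp add: bij_betw_def endo_inj_surj)
  then have "sub_aut G T (conjmap G g)"
    using g(1) Tc by (auto simp: sub_aut_def conjmap_def free_normalize)
  moreover have "conjmap G g ` E \<noteq> E" using g by (auto simp: normS_def)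
  ultimately show ?thesis by (rule that)
qed

theorem pearl_E:
  assumes rank_frattini: "grank G (frattini G E) \<le> 3" and moved: "\<not> F_characteristic G F E"
  shows "pearl p G F E"
proof -
  interpret Tg: finite_p_group GT p by (rule finite_p_group_T)
  obtain \<alpha> where \<alpha>: "sub_aut G T \<alpha>" "\<alpha> ` E \<noteq> E" using exists_moving_automorphism[OF moved] .
  interpret Eg: finite_p_group "G\<lparr>carrier := E\<rparr>" p by (rule finite_p_group_subgroup[OF E_sub])
  obtain D where D': "D \<subseteq> E" "finite D" "card D = 2" "generate (G\<lparr>carrier := E\<rparr>) D = E"
    using Eg.grank_generators by (auto simp: grank_consistent[OF E_sub] rank)
  note D = D'(1-3) D'(4)[unfolded generate_consistent[OF D'(1) E_sub]]
  then obtain a b where ab: "D = {a, b}" using D(3) by (auto simp: card_2_iff)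
  have frE: "frat GT p E = Q" by (rule frat_consistent[OF T_sub E_T])
  have frQ: "frat GT p Q = frat G p Q" using Q_E E_T by (intro frat_consistent[OF T_sub]) auto
  \<comment> \<open>The rank hypothesis becomes an index: three generators bound the Frattini
    quotient of \<open>Q\<close> by p^3.\<close>
  have card_Q: "card Q \<le> p ^ 3 * card (frat G p Q)"
  proof -
    interpret Qg: finite_p_group "G\<lparr>carrier := Q\<rparr>" p by (rule finite_p_group_subgroup[OF Q_sub])
    have "grank (G\<lparr>carrier := Q\<rparr>) Q \<le> 3"
      using rank_frattini frattini_E(1) grank_consistent[OF Q_sub] by simp
    then have "p ^ grank (G\<lparr>carrier := Q\<rparr>) Q \<le> p ^ 3" by (simp only: power_increasing_iff[OF p_gt_1])
    then have "p ^ grank (G\<lparr>carrier := Q\<rparr>) Q * card (frat G p Q) \<le> p ^ 3 * card (frat G p Q)"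
      by (rule mult_le_mono1)
    moreover have "card Q \<le> p ^ grank (G\<lparr>carrier := Q\<rparr>) Q * card (frat G p Q)"
      using Qg.card_le_grank by (simp add: frat_consistent[OF Q_sub order.refl])
    ultimately show ?thesis by linarith
  qed
  \<comment> \<open>The ambient group is now \<open>T\<close>, in which \<open>E\<close> is normal
    of index p, and \<open>F E E\<close> is the family acting irreducibly.\<close>
  interpret ip: irreducible_pair GT p E "F E E" \<alpha> a b
  proof (rule irreducible_pair.intro[OF finite_p_group_T irreducible_pair_axioms.intro], unfold frE frQ)
    show "E \<lhd> GT" by (rule normal_in_T[OF E_sub order.refl aut_image(1)])
    show "card (carrier GT) = p * card E" using card_T by simp
    show "card E = p\<^sup>2 * card Q" by (rule frattini_E(2))
    show "a \<in> E" "b \<in> E" using D ab by auto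
    show "generate GT {a, b} = E" using D ab E_T generate_consistent[of "{a, b}" T] T_sub by auto
    show "sub_aut GT E \<phi>" if "\<phi> \<in> F E E" for \<phi> using F_sub_aut[OF that] by (simp add: sub_aut_def)
    show "B = Q \<or> B = E"
      if "subgroup B GT" "Q \<subseteq> B" "B \<subseteq> E" "\<And>\<phi>. \<phi> \<in> F E E \<Longrightarrow> \<phi> ` B = B" for B
      by (rule F_E_irreducible[OF incl_subgroup[OF T_sub that(1)] that(2-4)])
    show "\<exists>e\<in>E. \<exists>t\<in>carrier GT. commr GT e t \<notin> Q"
    proof (rule ccontr)
      assume "\<not> ?thesis"
      then have "commr G e t \<in> Q" if "e \<in> E" "t \<in> T" for e t using that commr_T by simp
      then have "t \<in> E" if "t \<in> T" for t
        using Q_E Q_neq_E that by (intro mem_E_of_unipotent[OF Q_sub order.refl _ aut_image(2) that]) auto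
      then show False using E_T T_neq_E by blast
    qed
    show "sub_aut GT (carrier GT) \<alpha>" using \<alpha>(1) by (simp add: sub_aut_def)
    show "\<alpha> ` E \<noteq> E" by (rule \<alpha>(2))
    show "card Q \<le> p ^ 3 * card (frat G p Q)" by (rule card_Q)
  qed
  have noncomm: "x \<otimes> y \<noteq> y \<otimes> x \<longleftrightarrow> commr G x y \<noteq> \<one>" if "x \<in> E" "y \<in> E" for x y
    using commr_eq_one_iff[of x y] that E_carrier by auto
  consider "card Q = 1" | "card Q = p" "\<exists>x\<in>E. \<exists>y\<in>E. commr G x y \<noteq> \<one>"
  proof -
    have "commr GT x y = commr G x y" if "x \<in> E" "y \<in> E" for x y
      using commr_T that E_T by blast
    then show ?thesis using ip.frattini_small that by (auto simp: frE)
  qed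
  then show ?thesis
  proof cases
    case 1
    \<comment> \<open>A trivial [E, E] E^p means that \<open>E\<close> is elementary abelian; the
      orders in both cases come from \<open>card E = p\<^sup>2 * card Q\<close>.\<close>
    then have Q1: "Q = {\<one>}" using subgroup.one_closed[OF Q_sub] by (auto simp: card_1_singleton_iff)
    have "x \<otimes> y = y \<otimes> x" if "x \<in> E" "y \<in> E" for x y
      using noncomm[OF that] commr_in_compow[OF that, of p E] Q1 by auto
    moreover have "x [^] p = \<one>" if "x \<in> E" for x
      using pow_in_compow[OF that, of p E] Q1 by auto
    ultimately show ?thesis using ess frattini_E(2) 1 by (auto simp: pearl_def)
  next
    case 2
    then have "card E = p ^ 3" using frattini_E(2) by (simp add: power2_eq_square power3_eq_cube)
    then show ?thesis using ess 2(2) noncomm by (auto simp: pearl_def)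
  qed
qed

end

theorem theorem2p6:
  fixes p :: nat and S :: "('a,'b) monoid_scheme"
    and F :: "'a set \<Rightarrow> 'a set \<Rightarrow> ('a \<Rightarrow> 'a) set" and E :: "'a set"
  assumes "Factorial_Ring.prime p" and "odd p"
    and "p_group p S"
    and "saturated_fusion_system p S F"
    and "essential p S F E"
    and "grank S E = 2"
    and "grank S (frattini S E) \<le> 3"
    and "\<not> F_characteristic S F E"
  shows "pearl p S F E"
proof -
  have "group S" using assms(3) by (simp add: p_group_def)
  then interpret essential_rank_2 S p F E
    using assms by (auto simp: essential_rank_2_def essential_rank_2_axioms_def p_fusion_system_def
        p_fusion_system_axioms_def finite_p_group_def finite_p_group_axioms_def saturated_fusion_system_def)
  show ?thesis using assms(7,8) by (rule pearl_E)
qed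

end
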